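(* Let $A$ be a densely defined operator of half-plane type $0$ on a Hilbert space $H$. Then the following assertions are equivalent: (i) $-A$ is the generator of a bounded $C_0$-semigroup on $H$. (ii) $A$ has a strong $m$-bounded $\mathrm{H}^\infty$-calculus of type $0$ for some $m\in\mathbb{N}$. (ii') $A$ has a strong $m$-bounded $\mathrm{H}^\infty$-calculus of type $0$ for all $m\in\mathbb{N}$. In particular, if $-A$ generates a bounded $C_0$-semigroup then $A$ has an $m$-bounded $\mathrm{H}^\infty(\mathrm{R}_\omega)$-calculus for all $\omega<0$ and $m\in\mathbb{N}$.
   Context: $\mathbb{N}=\{1,2,\dots\}$; $\mathcal{L}(H)$: bounded operators on $H$; $R(z,A)=(z-A)^{-1}$. For $\omega\in\mathbb{R}$, $\mathrm{R}_\omega:=\{z\in\mathbb{C}:\operatorname{Re}z>\omega\}$, and $\mathrm{H}^\infty(\mathrm{R}_\omega)$ is the Banach algebra of bounded holomorphic functions on $\mathrm{R}_\omega$ with supremum norm. An operator $A$ is of half-plane type $0$ if $\sigma(A)\subseteq\overline{\mathrm{R}_{0}}$ and $\sup_{\lambda\in\mathbb{C}\setminus\mathrm{R}_\omega}\|R(\lambda,A)\|<\infty$ for all $\omega<0$. Its half-plane functional calculus: if $\omega<0$ and $g\in\mathrm{H}^\infty(\mathrm{R}_\omega)$ satisfies $g(z)=O(|z|^{-1-s})$ as $|z|\to\infty$ for some $s>0$, then $g(A):=-\frac1{2\pi}\int_{\mathbb{R}}g(\delta+ir)R(\delta+ir,A)\,dr$ for any $\delta\in(\omega,0)$; for general $f\in\mathrm{H}^\infty(\mathrm{R}_\omega)$,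 $f(A):=(A-\lambda)^2\,[f(z)(z-\lambda)^{-2}](A)$ for any $\lambda$ with $\operatorname{Re}\lambda<\omega$ (a closed operator independent of the choices). If $-A$ generates a bounded $C_0$-semigroup this agrees with the Hille–Phillips calculus. For $\omega<0$, $A$ has an $m$-bounded $\mathrm{H}^\infty(\mathrm{R}_\omega)$-calculus if there is $C\ge0$ with $f^{(m)}(A)\in\mathcal{L}(H)$ and $\|f^{(m)}(A)\|\le C\|f\|_{\mathrm{H}^\infty(\mathrm{R}_\omega)}$ for all $f\in\mathrm{H}^\infty(\mathrm{R}_\omega)$ (here $f^{(m)}$, the $m$-th derivative, is bounded on $\mathrm{R}_{\omega'}$ for each $\omega'>\omega$). It has a strong $m$-bounded $\mathrm{H}^\infty$-calculus of type $0$ if it has an $m$-bounded $\mathrm{H}^\infty(\mathrm{R}_\omega)$-calculus for every $\omega<0$ and there is one constant $C\ge0$ with $\|f^{(m)}(A)\|\le\frac{C}{|\omega|^m}\|f\|_{\mathrm{H}^\infty(\mathrm{R}_\omega)}$ for all $\omega<0$ and $f\in\mathrm{H}^\infty(\mathrm{R}_\omega)$. *)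

theory Defs
  imports "HOL-Analysis.Analysis"
begin

section \<open>Complex Hilbert spaces\<close>

class complex_vector = real_vector +
  fixes scaleC :: "complex \<Rightarrow> 'a \<Rightarrow> 'a"  (infixr \<open>*\<^sub>C\<close> 75)
  assumes scaleR_scaleC: "r *\<^sub>R x = complex_of_real r *\<^sub>C x"
    and scaleC_add_right: "a *\<^sub>C (x + y) = a *\<^sub>C x + a *\<^sub>C y"
    and scaleC_add_left: "(a + b) *\<^sub>C x = a *\<^sub>C x + b *\<^sub>C x"
    and scaleC_scaleC: "a *\<^sub>C b *\<^sub>C x = (a * b) *\<^sub>C x"
    and scaleC_one: "1 *\<^sub>C x = x"

text \<open>
  The inner product is linear in its first argument. Positive definiteness is implied by
  \<open>norm_eq_sqrt_cinner\<close> and the axioms of the norm; completeness comes from the class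
  \<^class>\<open>banach\<close>.
\<close>

class complex_hilbert_space = complex_vector + banach +
  fixes cinner :: "'a \<Rightarrow> 'a \<Rightarrow> complex"
  assumes cinner_commute: "cinner x y = cnj (cinner y x)"
    and cinner_add_left: "cinner (x + y) z = cinner x z + cinner y z"
    and cinner_scaleC_left: "cinner (a *\<^sub>C x) y = a * cinner x y"
    and norm_eq_sqrt_cinner: "norm x = sqrt (Re (cinner x x))"

instantiation complex :: complex_hilbert_space
begin

definition scaleC_complex :: "complex \<Rightarrow> complex \<Rightarrow> complex" where
  "scaleC_complex a x = a * x"

definition cinner_complex :: "complex \<Rightarrow> complex \<Rightarrow> complex" where
  "cinner_complex x y = x * cnj y"

instance
  by standard
    (simp_all add: scaleC_complex_def cinner_complex_def scaleR_conv_of_real algebra_simps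
      cmod_def power2_eq_square)

end

section \<open>Operators\<close>

text \<open>
  A possibly unbounded operator is identified with its graph. Its domain is then
  \<^term>\<open>Domain A\<close>, and inverses and products of operators are converses and compositions of
  relations, which take care of the domains.
\<close>

type_synonym 'a operator = "('a \<times> 'a) set"

definition linear_operator :: "'a::complex_vector operator \<Rightarrow> bool" where
  "linear_operator A \<longleftrightarrow>
     single_valued A \<and> (0, 0) \<in> A \<and>
     (\<forall>x y x' y'. (x, y) \<in> A \<longrightarrow> (x', y') \<in> A \<longrightarrow> (x + x', y + y') \<in> A) \<and>
     (\<forall>c x y. (x, y) \<in> A \<longrightarrow> (c *\<^sub>C x, c *\<^sub>C y) \<in> A)"

definition densely_defined :: "'a::complex_hilbert_space operator \<Rightarrow> bool" where
  "densely_defined A \<longleftrightarrow> closure (Domain A) = UNIV"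

definition bounded_clinear :: "('a::complex_hilbert_space \<Rightarrow> 'a) \<Rightarrow> bool" where
  "bounded_clinear T \<longleftrightarrow> bounded_linear T \<and> (\<forall>c x. T (c *\<^sub>C x) = c *\<^sub>C T x)"

text \<open>Membership of an operator in \<open>\<L>(H)\<close>; in particular it is defined everywhere.\<close>

definition bounded_operator :: "'a::complex_hilbert_space operator \<Rightarrow> bool" where
  "bounded_operator B \<longleftrightarrow> (\<exists>T. bounded_clinear T \<and> B = {(x, T x) |x. True})"

text \<open>Only meaningful for everywhere defined operators.\<close>

definition op_fun :: "'a operator \<Rightarrow> 'a \<Rightarrow> 'a" where
  "op_fun B x = (THE y. (x, y) \<in> B)"

definition op_norm :: "'a::complex_hilbert_space operator \<Rightarrow> real" where
  "op_norm B = onorm (op_fun B)"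

definition op_uminus :: "'a::complex_hilbert_space operator \<Rightarrow> 'a operator" where
  "op_uminus A = {(x, - y) |x y. (x, y) \<in> A}"

definition op_minus_scalar :: "'a::complex_hilbert_space operator \<Rightarrow> complex \<Rightarrow> 'a operator" where
  "op_minus_scalar A z = {(x, y - z *\<^sub>C x) |x y. (x, y) \<in> A}"

definition scalar_minus_op :: "complex \<Rightarrow> 'a::complex_hilbert_space operator \<Rightarrow> 'a operator" where
  "scalar_minus_op z A = {(x, z *\<^sub>C x - y) |x y. (x, y) \<in> A}"

definition resolvent :: "complex \<Rightarrow> 'a::complex_hilbert_space operator \<Rightarrow> 'a operator" where
  "resolvent z A = (scalar_minus_op z A)\<inverse>"

definition spectrum :: "'a::complex_hilbert_space operator \<Rightarrow> complex set" where
  "spectrum A = {z. \<not> bounded_operator (resolvent z A)}"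

section \<open>Strongly continuous semigroups\<close>

definition C0_semigroup :: "(real \<Rightarrow> 'a::complex_hilbert_space \<Rightarrow> 'a) \<Rightarrow> bool" where
  "C0_semigroup T \<longleftrightarrow>
     (\<forall>t\<ge>0. bounded_clinear (T t)) \<and>
     (\<forall>x. T 0 x = x) \<and>
     (\<forall>s\<ge>0. \<forall>t\<ge>0. \<forall>x. T (s + t) x = T s (T t x)) \<and>
     (\<forall>x. ((\<lambda>t. T t x) \<longlongrightarrow> x) (at_right 0))"

definition bounded_semigroup :: "(real \<Rightarrow> 'a::complex_hilbert_space \<Rightarrow> 'a) \<Rightarrow> bool" where
  "bounded_semigroup T \<longleftrightarrow> (\<exists>M. \<forall>t\<ge>0. onorm (T t) \<le> M)"

definition semigroup_generator :: "(real \<Rightarrow> 'a::complex_hilbert_space \<Rightarrow> 'a) \<Rightarrow> 'a operator" where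
  "semigroup_generator T = {(x, y). ((\<lambda>t. (1 / t) *\<^sub>R (T t x - x)) \<longlongrightarrow> y) (at_right 0)}"

definition generates_bounded_C0_semigroup :: "'a::complex_hilbert_space operator \<Rightarrow> bool" where
  "generates_bounded_C0_semigroup B \<longleftrightarrow>
     (\<exists>T. C0_semigroup T \<and> bounded_semigroup T \<and> semigroup_generator T = B)"

section \<open>Half-plane functional calculus\<close>

definition half_plane :: "real \<Rightarrow> complex set" where
  "half_plane \<omega> = {z. Re z > \<omega>}"

definition Hinf :: "real \<Rightarrow> (complex \<Rightarrow> complex) set" where
  "Hinf \<omega> = {f. f holomorphic_on half_plane \<omega> \<and> bounded (f ` half_plane \<omega>)}"

definition Hinf_norm :: "real \<Rightarrow> (complex \<Rightarrow> complex) \<Rightarrow> real" where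
  "Hinf_norm \<omega> f = (SUP z\<in>half_plane \<omega>. cmod (f z))"

definition half_plane_type_0 :: "'a::complex_hilbert_space operator \<Rightarrow> bool" where
  "half_plane_type_0 A \<longleftrightarrow>
     spectrum A \<subseteq> closure (half_plane 0) \<and>
     (\<forall>\<omega><0. bdd_above ((\<lambda>z. op_norm (resolvent z A)) ` (- half_plane \<omega>)))"

text \<open>
  The integral defining \<open>g(A)\<close> for quadratically (or just sufficiently fast) decaying \<open>g\<close>. The
  integrand is norm continuous and absolutely integrable, so evaluating at a vector commutes with
  integration. The Bochner integral of the library is confined to second countable spaces; the
  Henstock-Kurzweil integral has the same value here and needs no separability of \<open>H\<close>.
\<close>

definition elementary_calculus ::
    "'a::complex_hilbert_space operator \<Rightarrow> real \<Rightarrow> (complex \<Rightarrow> complex) \<Rightarrow> 'a \<Rightarrow> 'a" where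
  "elementary_calculus A \<delta> g x =
     - ((1 / (2 * pi)) *\<^sub>R
        integral UNIV (\<lambda>r. g (Complex \<delta> r) *\<^sub>C op_fun (resolvent (Complex \<delta> r) A) x))"

text \<open>
  The operator \<open>f(A) = (A - \<mu>)\<^sup>2 [f(z)(z - \<mu>)\<^sup>-\<^sup>2](A)\<close> with its natural domain. For an operator of
  half-plane type \<open>0\<close> the graph does not depend on the admissible choice of \<open>\<omega>\<close> (the half-plane on
  which \<open>f\<close> is considered), \<open>\<delta>\<close> and \<open>\<mu>\<close>. The definition singles out no particular choice: it is
  the union of the graphs over all of them, which all coincide.
\<close>

definition half_plane_calculus ::
    "'a::complex_hilbert_space operator \<Rightarrow> (complex \<Rightarrow> complex) \<Rightarrow> 'a operator" where
  "half_plane_calculus A f =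
     {(x, y). \<exists>\<omega> \<delta> \<mu>. \<omega> < \<delta> \<and> \<delta> < 0 \<and> Re \<mu> < \<omega> \<and> f \<in> Hinf \<omega> \<and>
        (elementary_calculus A \<delta> (\<lambda>z. f z / (z - \<mu>)\<^sup>2) x, y)
          \<in> op_minus_scalar A \<mu> O op_minus_scalar A \<mu>}"

text \<open>
  For \<open>f\<close> in \<^term>\<open>Hinf \<omega>\<close> with \<open>\<omega> < 0\<close> the derivative \<open>f\<^sup>(\<^sup>m\<^sup>)\<close> need not be in \<^term>\<open>Hinf \<omega>\<close>, but it
  is in \<^term>\<open>Hinf \<omega>'\<close> for all \<open>\<omega>'\<close> between \<open>\<omega>\<close> and \<open>0\<close>, so that the calculus applies to it.
\<close>

definition m_bounded_Hinf_calculus ::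
    "nat \<Rightarrow> real \<Rightarrow> 'a::complex_hilbert_space operator \<Rightarrow> bool" where
  "m_bounded_Hinf_calculus m \<omega> A \<longleftrightarrow>
     (\<exists>C\<ge>0. \<forall>f\<in>Hinf \<omega>.
        bounded_operator (half_plane_calculus A ((deriv ^^ m) f)) \<and>
        op_norm (half_plane_calculus A ((deriv ^^ m) f)) \<le> C * Hinf_norm \<omega> f)"

definition strong_m_bounded_Hinf_calculus_type_0 ::
    "nat \<Rightarrow> 'a::complex_hilbert_space operator \<Rightarrow> bool" where
  "strong_m_bounded_Hinf_calculus_type_0 m A \<longleftrightarrow>
     (\<forall>\<omega><0. m_bounded_Hinf_calculus m \<omega> A) \<and>
     (\<exists>C\<ge>0. \<forall>\<omega><0. \<forall>f\<in>Hinf \<omega>.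
        op_norm (half_plane_calculus A ((deriv ^^ m) f)) \<le> C / \<bar>\<omega>\<bar> ^ m * Hinf_norm \<omega> f)"

end

theory Submission
  imports Defs "HOL-Complex_Analysis.Complex_Analysis"
begin

text \<open>
  From the calculus to the semigroup: on \<open>R\<^sub>\<omega>\<close> the function \<open>e\<^sup>-\<^sup>t\<^sup>z\<close> has norm \<open>e\<^sup>t\<^sup>|\<^sup>\<omega>\<^sup>|\<close>, and its
  \<open>m\<close>-th derivative is \<open>(-t)\<^sup>m e\<^sup>-\<^sup>t\<^sup>z\<close>. Taking \<open>\<omega> = -1/t\<close> in the strong estimate, the powers of \<open>t\<close> cancel
  and \<open>\<parallel>e\<^sup>-\<^sup>t\<^sup>A\<parallel> \<le> C e\<close> for all \<open>t > 0\<close>. On the range of a power of the resolvent these operators are given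
  by absolutely convergent integrals, and the semigroup law and the generator are found there.

  From the semigroup to the calculus: Cauchy's estimates reduce the claim to \<open>m = 1\<close>. Integration by
  parts turns \<open>\<langle>f'(A)x, y\<rangle>\<close> into the integral of \<open>f(z)\<langle>R(z,A)\<^sup>2x, y\<rangle> = f(z)\<langle>R(z,A)x, R(z,A)\<^sup>*y\<rangle>\<close> over a vertical
  line \<open>Re z = \<delta>\<close>, and on a Hilbert space both resolvent orbits are square integrable there, with norms of
  order \<open>|\<delta>|\<^sup>-\<^sup>1\<^sup>/\<^sup>2\<close>. The Cauchy-Schwarz inequality gives \<open>\<parallel>f'(A)\<parallel> \<le> C |\<omega>|\<^sup>-\<^sup>1 \<parallel>f\<parallel>\<close>.
\<close>

section \<open>Complex Hilbert spaces\<close>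

text \<open>For bounded \<open>f\<close> the function \<open>f(z) R(z) x\<close> need not decay
  along a vertical line, so the boundary terms of the integration by parts are not under control.
  Hence \<open>f\<close> is multiplied by \<open>(N / (z - p))^2\<close>, with a real pole
  \<open>p\<close> at distance \<open>N\<close> to the left of the line. This forces decay, and its
  modulus on the line is the weight \<open>N^2 / (N^2 + r^2)\<close>, under which square functions
  reduce to the value of a holomorphic function at \<open>p\<close>. All bounds are uniform in
  \<open>N\<close>; the limit is taken on the range of three resolvents, a dense set. Adjoint orbits
  are not known in advance to be strongly continuous, so their square functions are estimated only
  for vectors in the range of the adjoint resolvent. The return to arbitrary vectors costs a factor
  \<open>M\<close>. This explains the constant \<open>M^4\<close>: two factors from the semigroup,
  one from the resolvent at \<open>p\<close>, one from this return. \<open>H\<close> need not be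
  separable. Integrability therefore comes from continuity and a majorant, and operator identities
  are mostly proved weakly, or on a dense range and extended, or after multiplication by an
  injective resolvent.\<close>

lemma scaleC_zero_left [simp]: "0 *\<^sub>C (x :: 'a::complex_vector) = 0"
  by (metis of_real_0 scaleR_scaleC scaleR_zero_left)

lemma scaleC_zero_right [simp]: "c *\<^sub>C (0 :: 'a::complex_vector) = 0"
  by (metis add_cancel_right_right scaleC_add_right)

lemma scaleC_minus_left [simp]: "(- c) *\<^sub>C (x :: 'a::complex_vector) = - (c *\<^sub>C x)"
  by (metis add.right_inverse add_eq_0_iff scaleC_add_left scaleC_zero_left)

lemma scaleC_minus_right [simp]: "c *\<^sub>C (- x :: 'a::complex_vector) = - (c *\<^sub>C x)"
  by (metis add.right_inverse add_eq_0_iff scaleC_add_right scaleC_zero_right)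

lemma scaleC_diff_left: "(b - c) *\<^sub>C (x :: 'a::complex_vector) = b *\<^sub>C x - c *\<^sub>C x"
  using scaleC_add_left[of b "- c" x] by simp

lemma scaleC_diff_right: "c *\<^sub>C (x - y :: 'a::complex_vector) = c *\<^sub>C x - c *\<^sub>C y"
  using scaleC_add_right[of c x "- y"] by simp

lemma scaleC_scaleR: "c *\<^sub>C (r *\<^sub>R x :: 'a::complex_vector) = r *\<^sub>R (c *\<^sub>C x)"
  by (simp add: scaleR_scaleC scaleC_scaleC mult.commute)

lemma scaleC_cancel: "c \<noteq> 0 \<Longrightarrow> c *\<^sub>C x = c *\<^sub>C y \<longleftrightarrow> x = (y :: 'a::complex_vector)"
  by (metis left_inverse scaleC_one scaleC_scaleC)

lemma cinner_add_right: "cinner (x::'a::complex_hilbert_space) (y + z) = cinner x y + cinner x z"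
  by (metis cinner_add_left cinner_commute complex_cnj_add)

lemma cinner_scaleC_right: "cinner (x::'a::complex_hilbert_space) (c *\<^sub>C y) = cnj c * cinner x y"
  by (metis cinner_commute cinner_scaleC_left complex_cnj_mult)

lemma cinner_zero_left [simp]: "cinner 0 (y::'a::complex_hilbert_space) = 0"
  by (metis cinner_scaleC_left mult_zero_left scaleC_zero_left)

lemma cinner_zero_right [simp]: "cinner (y::'a::complex_hilbert_space) 0 = 0"
  by (metis cinner_commute cinner_zero_left complex_cnj_zero)

lemma cinner_minus_left: "cinner (- x) (y::'a::complex_hilbert_space) = - cinner x y"
  by (metis cinner_scaleC_left mult_minus1 scaleC_minus_left scaleC_one)

lemma cinner_minus_right: "cinner (x::'a::complex_hilbert_space) (- y) = - cinner x y"
  by (metis cinner_commute cinner_minus_left complex_cnj_minus)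

lemma cinner_diff_left: "cinner (x - y) (z::'a::complex_hilbert_space) = cinner x z - cinner y z"
  using cinner_add_left[of x "- y" z] by (simp add: cinner_minus_left)

lemma cinner_diff_right: "cinner (x::'a::complex_hilbert_space) (y - z) = cinner x y - cinner x z"
  using cinner_add_right[of x y "- z"] by (simp add: cinner_minus_right)

lemma cinner_scaleR_left: "cinner (r *\<^sub>R x) (y::'a::complex_hilbert_space) = r *\<^sub>R cinner x y"
  by (simp add: scaleR_scaleC cinner_scaleC_left) (simp add: scaleC_complex_def)

lemma cinner_scaleR_right: "cinner (x::'a::complex_hilbert_space) (r *\<^sub>R y) = r *\<^sub>R cinner x y"
  by (simp add: scaleR_scaleC cinner_scaleC_right) (simp add: scaleC_complex_def)

lemma cinner_self: "cinner x x = complex_of_real ((norm (x::'a::complex_hilbert_space))\<^sup>2)"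
proof -
  have "0 \<le> Re (cinner x x)"
    using norm_eq_sqrt_cinner[of x] norm_ge_zero[of x] by (metis real_sqrt_ge_0_iff)
  moreover have "Im (cinner x x) = 0"
    using cinner_commute[of x x] by (metis Reals_cnj_iff complex_is_Real_iff)
  ultimately show ?thesis
    using norm_eq_sqrt_cinner[of x] by (simp add: complex_eq_iff)
qed

lemma norm_scaleC: "norm (c *\<^sub>C (x::'a::complex_hilbert_space)) = cmod c * norm x"
proof -
  have "(norm (c *\<^sub>C x))\<^sup>2 = Re (cinner (c *\<^sub>C x) (c *\<^sub>C x))"
    by (simp add: cinner_self)
  also have "\<dots> = Re (c * cnj c * cinner x x)"
    by (simp only: cinner_scaleC_left cinner_scaleC_right ac_simps)
  also have "\<dots> = (cmod c * norm x)\<^sup>2"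
    by (simp add: cinner_self complex_norm_square[symmetric] power_mult_distrib del: of_real_power)
  finally show ?thesis
    by (metis abs_norm_cancel abs_mult norm_ge_zero power2_eq_iff_nonneg zero_le_mult_iff)
qed

lemma norm_add_square: "(norm (x + y :: 'a::complex_hilbert_space))\<^sup>2 = (norm x)\<^sup>2 + 2 * Re (cinner x y) + (norm y)\<^sup>2"
proof -
  have "complex_of_real ((norm (x + y))\<^sup>2) = cinner x x + (cinner x y + cnj (cinner x y)) + cinner y y"
    using cinner_commute[of y x]
    by (simp only: cinner_self[symmetric] cinner_add_left cinner_add_right) simp
  then have "Re (complex_of_real ((norm (x + y))\<^sup>2)) = Re (cinner x x + (cinner x y + cnj (cinner x y)) + cinner y y)"
    by simp
  then show ?thesis
    by (simp add: cinner_self)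
qed

lemma norm_diff_square: "(norm (x - y :: 'a::complex_hilbert_space))\<^sup>2 = (norm x)\<^sup>2 - 2 * Re (cinner x y) + (norm y)\<^sup>2"
  using norm_add_square[of x "- y"] by (simp add: cinner_minus_right)

lemma cauchy_schwarz: "cmod (cinner x y) \<le> norm x * norm (y::'a::complex_hilbert_space)"
proof (cases "y = 0")
  case False
  define a where "a = cinner x y"
  define n where "n = (norm y)\<^sup>2"
  have n: "n > 0"
    using False by (simp add: n_def)
  define c where "c = a / of_real n"
  have "0 \<le> (norm (x - c *\<^sub>C y))\<^sup>2"
    by simp
  also have "\<dots> = (norm x)\<^sup>2 - 2 * Re (cnj c * a) + (cmod c)\<^sup>2 * n"
    by (simp add: norm_diff_square cinner_scaleC_right norm_scaleC power_mult_distrib a_def n_def)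
  also have "cnj c * a = of_real ((cmod a)\<^sup>2 / n)"
    by (simp add: c_def mult.commute[of _ a] complex_norm_square[symmetric] del: of_real_power)
  also have "(cmod c)\<^sup>2 * n = (cmod a)\<^sup>2 / n"
    using n by (simp add: c_def norm_divide power_divide power2_eq_square)
  finally have "(cmod a)\<^sup>2 / n \<le> (norm x)\<^sup>2"
    by simp
  then have "(cmod a)\<^sup>2 \<le> (norm x * norm y)\<^sup>2"
    using n by (simp add: field_simps n_def power_mult_distrib)
  then show ?thesis
    by (simp add: a_def abs_le_square_iff[symmetric] abs_mult)
qed simp

lemma cinner_eqI: "(\<And>y::'a::complex_hilbert_space. cinner x y = cinner x' y) \<Longrightarrow> x = x'"
proof -
  assume *: "\<And>y::'a::complex_hilbert_space. cinner x y = cinner x' y"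
  have "cinner (x - x') (x - x') = 0"
    by (simp add: cinner_diff_left *)
  then show ?thesis
    by (simp add: cinner_self)
qed

lemma norm_le_if_cinner_le:
  assumes "C \<ge> 0" and "\<And>y::'a::complex_hilbert_space. cmod (cinner x y) \<le> C * norm y"
  shows "norm x \<le> C"
proof (cases "x = 0")
  case False
  have "(norm x)\<^sup>2 \<le> C * norm x"
    using assms(2)[of x] by (simp add: cinner_self norm_power)
  then show ?thesis
    using False by (simp add: power2_eq_square)
qed (use assms in simp)

lemma parallelogram:
  "(norm (x + y))\<^sup>2 + (norm (x - y))\<^sup>2 = 2 * (norm x)\<^sup>2 + 2 * (norm (y::'a::complex_hilbert_space))\<^sup>2"
  by (simp add: norm_add_square norm_diff_square)

lemma bounded_bilinear_scaleC: "bounded_bilinear (scaleC :: complex \<Rightarrow> 'a::complex_hilbert_space \<Rightarrow> 'a)"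
proof
  show "\<exists>K. \<forall>a (b::'a). norm (a *\<^sub>C b) \<le> norm a * norm b * K"
    by (intro exI[of _ 1]) (simp add: norm_scaleC)
qed (simp_all add: scaleC_add_left scaleC_add_right scaleC_scaleR scaleC_scaleC
      scaleR_conv_of_real scaleR_scaleC[where 'a = 'a] mult.commute)

lemma bounded_bilinear_cinner: "bounded_bilinear (cinner :: 'a::complex_hilbert_space \<Rightarrow> 'a \<Rightarrow> complex)"
proof
  show "\<exists>K. \<forall>a (b::'a). norm (cinner a b) \<le> norm a * norm b * K"
    by (intro exI[of _ 1]) (simp add: cauchy_schwarz)
qed (simp_all add: cinner_add_left cinner_add_right cinner_scaleR_left cinner_scaleR_right)

lemmas continuous_on_scaleC [continuous_intros] =
  bounded_bilinear.continuous_on[OF bounded_bilinear_scaleC]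
lemmas continuous_on_cinner [continuous_intros] =
  bounded_bilinear.continuous_on[OF bounded_bilinear_cinner]
lemmas tendsto_scaleC [tendsto_intros] = bounded_bilinear.tendsto[OF bounded_bilinear_scaleC]
lemmas tendsto_cinner [tendsto_intros] = bounded_bilinear.tendsto[OF bounded_bilinear_cinner]
lemmas bounded_linear_cinner_left = bounded_bilinear.bounded_linear_left[OF bounded_bilinear_cinner]
lemmas bounded_linear_scaleC_right = bounded_bilinear.bounded_linear_right[OF bounded_bilinear_scaleC]

section \<open>Bounded complex-linear maps, minimal vectors, Riesz representation and
  adjoints\<close>

lemma bounded_clinearD:
  assumes "bounded_clinear T"
  shows "bounded_linear T" "T (c *\<^sub>C x) = c *\<^sub>C T x"
  using assms by (auto simp: bounded_clinear_def)

lemma bounded_clinearI: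
  assumes "\<And>x y. T (x + y) = T x + T y" "\<And>c x. T (c *\<^sub>C x) = c *\<^sub>C T x"
    and "\<And>x. norm (T x) \<le> K * norm x"
  shows "bounded_clinear (T :: 'a::complex_hilbert_space \<Rightarrow> 'a)"
  unfolding bounded_clinear_def
  using assms by (auto intro!: bounded_linear_intro[where K = K] simp: scaleR_scaleC mult.commute)

text \<open>A minimizing sequence is Cauchy: midpoints stay in \<open>S\<close> and so have norm at
  least the infimum, and the parallelogram law then makes differences small. Midpoints are the only
  form of convexity that this uses.\<close>

lemma minimal_norm_exists:
  fixes S :: "'a::complex_hilbert_space set"
  assumes "closed S" "S \<noteq> {}" and mid: "\<And>x y. x \<in> S \<Longrightarrow> y \<in> S \<Longrightarrow> (1/2) *\<^sub>R (x + y) \<in> S"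
  obtains p where "p \<in> S" "\<And>x. x \<in> S \<Longrightarrow> norm p \<le> norm x"
proof -
  define d where "d = Inf (norm ` S)"
  have bdd: "bdd_below (norm ` S)"
    by (intro bdd_belowI[of _ 0]) auto
  have d_le: "d \<le> norm x" if "x \<in> S" for x
    unfolding d_def using that bdd by (intro cInf_lower) auto
  have d0: "d \<ge> 0"
    unfolding d_def using assms(2) by (intro cInf_greatest) auto
  have "\<exists>x\<in>S. norm x < d + 1 / real (Suc n)" for n
    using cInf_lessD[of "norm ` S" "d + 1 / real (Suc n)"] assms(2) by (auto simp: d_def)
  then obtain u where u: "\<And>n. u n \<in> S" "\<And>n. norm (u n) < d + 1 / real (Suc n)"
    by metis
  have close: "(norm (x - y))\<^sup>2 \<le> 2 * (norm x)\<^sup>2 + 2 * (norm y)\<^sup>2 - 4 * d\<^sup>2" if "x \<in> S" "y \<in> S" for x y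
  proof -
    have "d \<le> norm (x + y) / 2"
      using d_le[OF mid[OF that]] by simp
    then have "d\<^sup>2 \<le> (norm (x + y) / 2)\<^sup>2"
      using d0 by (intro power_mono)
    then show ?thesis
      using parallelogram[of x y] by (simp add: power_divide)
  qed
  have lim: "(\<lambda>n. norm (u n)) \<longlonglongrightarrow> d"
  proof (rule tendsto_sandwich[OF _ _ tendsto_const])
    show "(\<lambda>n. d + 1 / real (Suc n)) \<longlonglongrightarrow> d"
      using tendsto_add[OF tendsto_const LIMSEQ_inverse_real_of_nat, of d] by (simp add: inverse_eq_divide)
  qed (use d_le[OF u(1)] u(2)[THEN less_imp_le] in \<open>auto simp del: of_nat_Suc\<close>)
  have "Cauchy u"
  proof (rule metric_CauchyI)
    fix e :: real
    assume e: "e > 0"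
    have "(\<lambda>n. (norm (u n))\<^sup>2) \<longlonglongrightarrow> d\<^sup>2"
      by (intro tendsto_intros lim)
    then have "\<forall>\<^sub>F n in sequentially. (norm (u n))\<^sup>2 < d\<^sup>2 + e\<^sup>2 / 4"
      using e by (intro order_tendstoD(2)) auto
    then obtain N where N: "\<And>n. n \<ge> N \<Longrightarrow> (norm (u n))\<^sup>2 < d\<^sup>2 + e\<^sup>2 / 4"
      by (auto simp: eventually_sequentially)
    have "dist (u m) (u n) < e" if "m \<ge> N" "n \<ge> N" for m n
    proof -
      have "(norm (u m - u n))\<^sup>2 < e\<^sup>2"
        using close[OF u(1) u(1), of m n] N[OF that(1)] N[OF that(2)] by simp
      then show ?thesis
        using e by (simp add: dist_norm power2_less_imp_less)
    qed
    then show "\<exists>M. \<forall>m\<ge>M. \<forall>n\<ge>M. dist (u m) (u n) < e"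
      by blast
  qed
  then obtain p where p: "u \<longlonglongrightarrow> p"
    by (auto simp: Cauchy_convergent_iff convergent_def)
  have "p \<in> S"
    using assms(1) u(1) p closed_sequentially by blast
  moreover have "norm p = d"
    using tendsto_norm[OF p] lim LIMSEQ_unique by blast
  ultimately show thesis
    using that d_le by blast
qed

text \<open>The competitor with \<open>c = <p,v> / |v|^2\<close> has squared norm
  \<open>|p|^2 - |<p,v>|^2 / |v|^2\<close>, which is below the minimum unless the inner product
  vanishes.\<close>

lemma orthogonal_if_minimal:
  fixes p v :: "'a::complex_hilbert_space"
  assumes "\<And>c. norm p \<le> norm (p - c *\<^sub>C v)"
  shows "cinner v p = 0"
proof (cases "v = 0")
  case False
  define a where "a = cinner p v"
  define n where "n = (norm v)\<^sup>2"
  have n: "n > 0"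
    using False by (simp add: n_def)
  define c where "c = a / of_real n"
  have "(norm p)\<^sup>2 \<le> (norm (p - c *\<^sub>C v))\<^sup>2"
    using assms[of c] by (intro power_mono) auto
  also have "\<dots> = (norm p)\<^sup>2 - 2 * Re (cnj c * a) + (cmod c)\<^sup>2 * n"
    by (simp add: norm_diff_square cinner_scaleC_right norm_scaleC power_mult_distrib a_def n_def)
  also have "cnj c * a = of_real ((cmod a)\<^sup>2 / n)"
    by (simp add: c_def mult.commute[of _ a] complex_norm_square[symmetric] del: of_real_power)
  also have "(cmod c)\<^sup>2 * n = (cmod a)\<^sup>2 / n"
    using n by (simp add: c_def norm_divide power_divide power2_eq_square)
  finally have "(cmod a)\<^sup>2 \<le> 0"
    using n by (simp add: field_simps)
  then show ?thesis
    by (subst cinner_commute) (simp add: a_def)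
qed simp

text \<open>The vector of minimal norm in the affine hyperplane where \<open>\<phi>\<close> equals
  \<open>1\<close> is orthogonal to the kernel of \<open>\<phi>\<close>. Dividing it by its squared
  norm gives the representing vector.\<close>

lemma riesz_representation:
  fixes \<phi> :: "'a::complex_hilbert_space \<Rightarrow> complex"
  assumes bl: "bounded_linear \<phi>" and cl: "\<And>c x. \<phi> (c *\<^sub>C x) = c * \<phi> x"
  obtains y where "\<And>x. \<phi> x = cinner x y"
proof (cases "\<forall>x. \<phi> x = 0")
  case True
  then show thesis using that[of 0] by simp
next
  case False
  interpret bounded_linear \<phi> by fact
  obtain x0 where x0: "\<phi> x0 \<noteq> 0" using False by blast
  define S where "S = \<phi> -` {1}"
  have "closed S"
    unfolding S_def by (intro continuous_closed_vimage) (auto simp: isCont)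
  moreover have "inverse (\<phi> x0) *\<^sub>C x0 \<in> S"
    using x0 by (simp add: S_def cl)
  moreover have "(1/2) *\<^sub>R (x + y) \<in> S" if "x \<in> S" "y \<in> S" for x y
    using that by (simp add: S_def scaleR add scaleR_conv_of_real)
  ultimately obtain p where p: "p \<in> S" "\<And>x. x \<in> S \<Longrightarrow> norm p \<le> norm x"
    using minimal_norm_exists[of S] by blast
  have phi_p: "\<phi> p = 1"
    using p(1) by (simp add: S_def)
  then have "p \<noteq> 0"
    using zero by auto
  have "\<phi> x = cinner x (inverse (of_real ((norm p)\<^sup>2)) *\<^sub>C p)" for x
  proof -
    define v where "v = x - \<phi> x *\<^sub>C p"
    have "\<phi> v = 0"
      by (simp add: v_def diff cl phi_p)
    then have "norm p \<le> norm (p - c *\<^sub>C v)" for c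
      by (intro p(2)) (simp add: S_def diff cl phi_p)
    then have "cinner v p = 0"
      by (rule orthogonal_if_minimal)
    then have "cinner x p = \<phi> x * of_real ((norm p)\<^sup>2)"
      by (simp add: v_def cinner_diff_left cinner_scaleC_left cinner_self)
    then show ?thesis
      using \<open>p \<noteq> 0\<close> by (simp add: cinner_scaleC_right)
  qed
  then show thesis by (rule that)
qed

lemma adjoint_exists:
  fixes T :: "'a::complex_hilbert_space \<Rightarrow> 'a"
  assumes "bounded_clinear T"
  shows "\<exists>z. \<forall>x. cinner (T x) y = cinner x z"
proof -
  have "bounded_linear (\<lambda>x. cinner (T x) y)"
    by (rule bounded_linear_compose[OF bounded_linear_cinner_left bounded_clinearD(1)[OF assms]])
  then show ?thesis
    by (rule riesz_representation)
      (auto simp: bounded_clinearD(2)[OF assms] cinner_scaleC_left)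
qed

text \<open>The Hilbert space adjoint, chosen pointwise in \<open>y\<close>. The choice is unique,
  and it is meaningful for \<open>bounded_clinear T\<close> by the Riesz representation.\<close>

definition adj :: "('a::complex_hilbert_space \<Rightarrow> 'a) \<Rightarrow> 'a \<Rightarrow> 'a" where
  "adj T y = (SOME z. \<forall>x. cinner (T x) y = cinner x z)"

lemma cinner_adj: "bounded_clinear T \<Longrightarrow> cinner (T x) y = cinner x (adj T y)"
  unfolding adj_def using someI_ex[OF adjoint_exists[of T y]] by blast

lemma adj_eqI: "bounded_clinear T \<Longrightarrow> (\<And>x. cinner (T x) y = cinner x z) \<Longrightarrow> adj T y = z"
  by (metis cinner_adj cinner_commute cinner_eqI)

lemma adj_add: "bounded_clinear T \<Longrightarrow> adj T (x + y) = adj T x + adj T y"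
  by (rule adj_eqI) (simp_all add: cinner_add_right cinner_adj)

lemma adj_scaleC: "bounded_clinear T \<Longrightarrow> adj T (c *\<^sub>C x) = c *\<^sub>C adj T x"
  by (rule adj_eqI) (simp_all add: cinner_scaleC_right cinner_adj)

lemma norm_adj_le:
  assumes "bounded_clinear T" "\<And>x. norm (T x) \<le> K * norm x"
  shows "norm (adj T y) \<le> K * norm y"
proof (cases "adj T y = 0")
  case False
  have "(norm (adj T y))\<^sup>2 = cmod (cinner (T (adj T y)) y)"
    by (simp add: cinner_adj[OF assms(1)] cinner_self norm_power)
  also have "\<dots> \<le> (K * norm (adj T y)) * norm y"
    by (meson assms(2) cauchy_schwarz mult_right_mono norm_ge_zero order_trans)
  finally show ?thesis
    using False by (simp add: power2_eq_square)
next
  case True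
  have "0 \<le> K * norm y"
    using assms(2)[of y] norm_ge_zero order_trans by blast
  then show ?thesis
    by (simp add: True)
qed

lemma adj_bounded_clinear:
  assumes "bounded_clinear T" "\<And>x. norm (T x) \<le> K * norm x"
  shows "bounded_clinear (adj T)"
  by (rule bounded_clinearI[OF _ _ norm_adj_le[OF assms]]) (auto simp: adj_add adj_scaleC assms)

section \<open>Improper integrals\<close>

text \<open>Takes the place of Bochner integrability for values in a possibly nonseparable space:
  continuity gives integrability on compact intervals, and the majorant controls the tails.\<close>

lemma integrable_on_UNIV_dominated:
  fixes f :: "real \<Rightarrow> 'b::banach"
  assumes "continuous_on UNIV f" "\<And>r. norm (f r) \<le> g r" "g integrable_on UNIV"
  shows "f integrable_on UNIV"
proof (rule integrable_on_all_intervals_integrable_bound[where g = g])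
  show "(\<lambda>x. if x \<in> UNIV then f x else 0) integrable_on cbox a b" for a b
    using integrable_continuous[OF continuous_on_subset[OF assms(1) subset_UNIV]] by simp
qed (use assms in auto)

lemma integrable_on_halfline_dominated:
  fixes f :: "real \<Rightarrow> 'b::banach"
  assumes f: "continuous_on {0..} f" and "\<And>r. r \<ge> 0 \<Longrightarrow> norm (f r) \<le> g r" "g integrable_on {0..}"
  shows "f integrable_on {0..}"
proof (rule integrable_on_all_intervals_integrable_bound[where g = g])
  show "(\<lambda>x. if x \<in> {0..} then f x else 0) integrable_on cbox a b" for a b
  proof -
    have "f integrable_on {max a 0..b}"
      by (intro integrable_continuous_interval continuous_on_subset[OF f]) auto
    moreover have "{max a 0..b} = {0..} \<inter> cbox a b"
      by auto
    ultimately show ?thesis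
      by (simp only: integrable_restrict_Int)
  qed
qed (use assms in auto)

lemma integral_symmetric_tendsto:
  fixes f :: "real \<Rightarrow> 'b::banach"
  assumes "f integrable_on UNIV"
  shows "(\<lambda>n. integral {- real n..real n} f) \<longlonglongrightarrow> integral UNIV f"
proof (rule LIMSEQ_I)
  fix e :: real
  assume "e > 0"
  moreover have "(f has_integral integral UNIV f) UNIV"
    using assms by (rule integrable_integral)
  ultimately obtain B where B: "B > 0"
    "\<And>a b. ball 0 B \<subseteq> cbox a b \<Longrightarrow> norm (integral (cbox a b) f - integral UNIV f) < e"
    unfolding has_integral_alt' by (auto simp: cbox_interval)
  obtain N where "real N > B"
    using reals_Archimedean2 by blast
  have "norm (integral {- real n..real n} f - integral UNIV f) < e" if "n \<ge> N" for n
  proof -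
    have "B < real n" using that \<open>real N > B\<close> by linarith
    then have "ball 0 B \<subseteq> cbox (- real n) (real n)"
      by (auto simp: dist_norm)
    from B(2)[OF this] show ?thesis by (simp add: cbox_interval)
  qed
  then show "\<exists>no. \<forall>n\<ge>no. norm (integral {- real n..real n} f - integral UNIV f) < e"
    by blast
qed

lemma integral_halfline_tendsto:
  fixes f :: "real \<Rightarrow> 'b::banach"
  assumes "f integrable_on {0..}"
  shows "(\<lambda>n. integral {0..real n} f) \<longlonglongrightarrow> integral {0..} f"
proof -
  have "integral {- real n..real n} (\<lambda>x. if x \<in> {0..} then f x else 0) = integral {0..real n} f" for n
  proof -
    have "{0..} \<inter> {- real n..real n} = {0..real n}" by auto
    then show ?thesis
      using integral_restrict_Int[of "{- real n..real n}" "{0..}" f] by simp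
  qed
  moreover have "(\<lambda>x. if x \<in> {0..} then f x else 0) integrable_on UNIV"
    using assms by (simp only: integrable_restrict_UNIV)
  ultimately show ?thesis
    using integral_symmetric_tendsto[of "\<lambda>x. if x \<in> {0..} then f x else 0"]
    by (simp only: integral_restrict_UNIV)
qed

lemma integral_halfline_derivative:
  fixes h :: "real \<Rightarrow> 'b::banach"
  assumes "\<And>t. t \<ge> 0 \<Longrightarrow> (h has_vector_derivative h' t) (at t within {0..})"
    and "h' integrable_on {0..}" and "(h \<longlongrightarrow> 0) at_top"
  shows "integral {0..} h' = - h 0"
proof (rule LIMSEQ_unique)
  show "(\<lambda>n. integral {0..real n} h') \<longlonglongrightarrow> integral {0..} h'"
    by (rule integral_halfline_tendsto) fact
  have "(h' has_integral (h (real n) - h 0)) {0..real n}" for n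
    by (intro fundamental_theorem_of_calculus)
       (auto intro: has_vector_derivative_within_subset[OF assms(1)])
  then have "integral {0..real n} h' = h (real n) - h 0" for n
    by (rule integral_unique)
  moreover have "(\<lambda>n. h (real n)) \<longlonglongrightarrow> 0"
    using assms(3) filterlim_compose filterlim_real_sequentially by blast
  ultimately show "(\<lambda>n. integral {0..real n} h') \<longlonglongrightarrow> - h 0"
    by (auto intro!: tendsto_eq_intros)
qed

lemma integral_line_derivative:
  fixes h :: "real \<Rightarrow> 'b::banach"
  assumes "\<And>t. (h has_vector_derivative h' t) (at t)"
    and "h' integrable_on UNIV" and "(h \<longlongrightarrow> 0) at_top" "(h \<longlongrightarrow> 0) at_bot"
  shows "integral UNIV h' = 0"
proof (rule LIMSEQ_unique)
  show "(\<lambda>n. integral {- real n..real n} h') \<longlonglongrightarrow> integral UNIV h'"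
    by (rule integral_symmetric_tendsto) fact
  have "(h' has_integral (h (real n) - h (- real n))) {- real n..real n}" for n
    by (intro fundamental_theorem_of_calculus)
       (auto intro: has_vector_derivative_at_within assms(1))
  then have "integral {- real n..real n} h' = h (real n) - h (- real n)" for n
    by (rule integral_unique)
  moreover have "(\<lambda>n. h (real n)) \<longlonglongrightarrow> 0"
    using assms(3) filterlim_compose filterlim_real_sequentially by blast
  moreover have "(\<lambda>n. h (- real n)) \<longlonglongrightarrow> 0"
    by (rule filterlim_compose[OF assms(4)])
       (simp add: filterlim_uminus_at_bot filterlim_real_sequentially)
  ultimately show "(\<lambda>n. integral {- real n..real n} h') \<longlonglongrightarrow> 0"
    by (auto intro!: tendsto_eq_intros)
qed

text \<open>Monotone convergence of the truncations, whose integrals are differences of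
  \<open>arctan\<close> and hence at most \<open>pi\<close>. All later majorants are compared with
  this function.\<close>

lemma integrable_inverse_quadratic: "(\<lambda>r::real. 1 / (1 + r\<^sup>2)) integrable_on UNIV"
proof -
  let ?f = "\<lambda>k (r::real). if r \<in> {- real k..real k} then 1 / (1 + r\<^sup>2) else 0"
  have hi: "((\<lambda>r. 1 / (1 + r\<^sup>2)) has_integral (arctan (real k) - arctan (- real k))) {- real k..real k}" for k
    by (intro fundamental_theorem_of_calculus)
       (auto intro!: derivative_eq_intros has_vector_derivative_at_within
             simp: has_real_derivative_iff_has_vector_derivative[symmetric] add_nonneg_eq_0_iff
               inverse_eq_divide)
  have hi': "(?f k has_integral (arctan (real k) - arctan (- real k))) UNIV" for k
    using hi by (simp only: has_integral_restrict_UNIV)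
  have "bounded (range (\<lambda>k. integral UNIV (?f k)))"
  proof (rule boundedI)
    fix x assume "x \<in> range (\<lambda>k. integral UNIV (?f k))"
    then obtain k where "x = arctan (real k) - arctan (- real k)"
      using hi' integral_unique by blast
    then show "norm x \<le> pi"
      using arctan_bounded[of "real k"] by (auto simp: arctan_minus)
  qed
  moreover have "(\<lambda>k. ?f k r) \<longlonglongrightarrow> 1 / (1 + r\<^sup>2)" for r
  proof (rule tendsto_eventually)
    obtain N where N: "real N > \<bar>r\<bar>" using reals_Archimedean2 by blast
    have "?f k r = 1 / (1 + r\<^sup>2)" if "k \<ge> N" for k
      using N that by auto
    then show "\<forall>\<^sub>F k in sequentially. ?f k r = 1 / (1 + r\<^sup>2)"
      unfolding eventually_sequentially by blast
  qed
  ultimately show ?thesis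
    using monotone_convergence_increasing[of ?f UNIV "\<lambda>r. 1 / (1 + r\<^sup>2)"] has_integral_integrable[OF hi']
    by simp
qed

section \<open>Cauchy's theorem on vertical lines\<close>

text \<open>Only the two horizontal sides, each of length \<open>b - a\<close>, are estimated; the
  vertical sides remain as line integrals. \<open>I\<close> is kept general so that both a residue
  and the value \<open>0\<close> can be inserted.\<close>

lemma rectpath_estimate:
  assumes ab: "a < b" and n: "n > 0" and B: "B \<ge> 0"
    and cont: "continuous_on (path_image (rectpath (Complex a (- n)) (Complex b n))) f"
    and I: "(f has_contour_integral I) (rectpath (Complex a (- n)) (Complex b n))"
    and bound: "\<And>z. a \<le> Re z \<Longrightarrow> Re z \<le> b \<Longrightarrow> \<bar>Im z\<bar> = n \<Longrightarrow> cmod (f z) \<le> B"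
  shows "cmod (I - \<i> * integral {-n..n} (\<lambda>r. f (Complex b r)) + \<i> * integral {-n..n} (\<lambda>r. f (Complex a r)))
    \<le> 2 * B * (b - a)"
proof -
  define a1 a2 a3 a4 where a: "a1 = Complex a (- n)" "a2 = Complex b (- n)" "a3 = Complex b n" "a4 = Complex a n"
  have path: "rectpath a1 a3 = linepath a1 a2 +++ linepath a2 a3 +++ linepath a3 a4 +++ linepath a4 a1"
    by (simp add: rectpath_def a Let_def)
  have im: "path_image (rectpath a1 a3) = {z. Re z \<in> {a, b} \<and> Im z \<in> {-n..n}} \<union> {z. Im z \<in> {-n, n} \<and> Re z \<in> {a..b}}"
    using ab n by (subst path_image_rectpath) (auto simp: a)
  have seg: "closed_segment a1 a2 \<subseteq> {z. Im z = - n \<and> Re z \<in> {a..b}}"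
    "closed_segment a2 a3 \<subseteq> {z. Re z = b \<and> Im z \<in> {-n..n}}"
    "closed_segment a3 a4 \<subseteq> {z. Im z = n \<and> Re z \<in> {a..b}}"
    "closed_segment a4 a1 \<subseteq> {z. Re z = a \<and> Im z \<in> {-n..n}}"
    "closed_segment a1 a4 \<subseteq> {z. Re z = a \<and> Im z \<in> {-n..n}}"
    using ab n by (auto simp: a closed_segment_same_Re closed_segment_same_Im closed_segment_eq_real_ivl)
  have cont': "continuous_on S f" if "S \<subseteq> path_image (rectpath a1 a3)" for S
    using that cont by (auto simp: a intro: continuous_on_subset)
  have ci: "f contour_integrable_on linepath a1 a2" "f contour_integrable_on linepath a2 a3"
    "f contour_integrable_on linepath a3 a4" "f contour_integrable_on linepath a4 a1"
    by (rule contour_integrable_continuous_linepath, rule cont', use seg im in blast)+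
  have I': "I = contour_integral (linepath a1 a2) f + (contour_integral (linepath a2 a3) f
      + (contour_integral (linepath a3 a4) f + contour_integral (linepath a4 a1) f))"
  proof (rule has_contour_integral_unique)
    show "(f has_contour_integral I) (rectpath a1 a3)"
      using I by (simp add: a)
    show "(f has_contour_integral (contour_integral (linepath a1 a2) f + (contour_integral (linepath a2 a3) f
      + (contour_integral (linepath a3 a4) f + contour_integral (linepath a4 a1) f)))) (rectpath a1 a3)"
      unfolding path
      by (intro has_contour_integral_join has_contour_integral_integral ci valid_path_join) auto
  qed
  have right: "contour_integral (linepath a2 a3) f = \<i> * integral {-n..n} (\<lambda>r. f (Complex b r))"
    by (rule contour_integral_linepath_same_Re) (use n in \<open>auto simp: a\<close>)
  have "contour_integral (linepath a1 a4) f = \<i> * integral {-n..n} (\<lambda>r. f (Complex a r))"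
    by (rule contour_integral_linepath_same_Re) (use n in \<open>auto simp: a\<close>)
  moreover have "contour_integral (linepath a4 a1) f = - contour_integral (linepath a1 a4) f"
    by (rule contour_integral_reverse_linepath, rule cont', use seg im in blast)
  ultimately have left: "contour_integral (linepath a4 a1) f = - (\<i> * integral {-n..n} (\<lambda>r. f (Complex a r)))"
    by simp
  have "cmod (contour_integral (linepath a1 a2) f) \<le> B * cmod (a2 - a1)"
    by (rule has_contour_integral_bound_linepath[OF has_contour_integral_integral[OF ci(1)] B])
       (use seg(1) bound n in auto)
  then have bot: "cmod (contour_integral (linepath a1 a2) f) \<le> B * (b - a)"
    using ab by (simp add: a cmod_def)
  have "cmod (contour_integral (linepath a3 a4) f) \<le> B * cmod (a4 - a3)"
    by (rule has_contour_integral_bound_linepath[OF has_contour_integral_integral[OF ci(3)] B])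
       (use seg(3) bound n in auto)
  then have top: "cmod (contour_integral (linepath a3 a4) f) \<le> B * (b - a)"
    using ab by (simp add: a cmod_def)
  have "I - \<i> * integral {-n..n} (\<lambda>r. f (Complex b r)) + \<i> * integral {-n..n} (\<lambda>r. f (Complex a r))
      = contour_integral (linepath a1 a2) f + contour_integral (linepath a3 a4) f"
    by (simp add: I' right left)
  then show ?thesis
    using norm_triangle_ineq[of "contour_integral (linepath a1 a2) f" "contour_integral (linepath a3 a4) f"] bot top
    by (simp add: algebra_simps)
qed

section \<open>Quadratic decay along a vertical line, and Cauchy's theorem on half-planes and
  strips\<close>

lemma weight_integrable: "(\<lambda>r::real. C / (1 + \<bar>r\<bar>)\<^sup>2) integrable_on UNIV"
proof -
  have "(\<lambda>r::real. 1 / (1 + \<bar>r\<bar>)\<^sup>2) integrable_on UNIV"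
  proof (rule integrable_on_UNIV_dominated[OF _ _ integrable_inverse_quadratic])
    show "continuous_on UNIV (\<lambda>r::real. 1 / (1 + \<bar>r\<bar>)\<^sup>2)"
      by (intro continuous_intros) auto
    show "norm (1 / (1 + \<bar>r\<bar>)\<^sup>2) \<le> 1 / (1 + r\<^sup>2)" for r :: real
      by (auto intro!: divide_left_mono simp: power2_sum add_pos_nonneg)
  qed
  from integrable_on_mult_right[OF this, of C] show ?thesis by simp
qed

lemma line_distance:
  assumes "Re c \<noteq> \<delta>"
  obtains K where "K > 0" "\<And>r. 1 + \<bar>r\<bar> \<le> K * cmod (Complex \<delta> r - c)"
proof -
  define e where "e = \<bar>\<delta> - Re c\<bar>"
  have e: "e > 0" using assms by (simp add: e_def)
  \<comment> \<open>\<open>e\<close> is the distance of \<open>c\<close> from the line. The summand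
    \<open>1\<close> handles the part of \<open>|r|\<close> controlled by the distance to
    \<open>c\<close>; the fraction handles the constant \<open>1 + |Im c|\<close>, as the distance
    to \<open>c\<close> is never below \<open>e\<close>.\<close>
  define K where "K = (1 + \<bar>Im c\<bar>) / e + 1"
  have "1 + \<bar>r\<bar> \<le> K * cmod (Complex \<delta> r - c)" for r
  proof -
    let ?D = "cmod (Complex \<delta> r - c)"
    have 1: "e \<le> ?D"
      using abs_Re_le_cmod[of "Complex \<delta> r - c"] by (simp add: e_def)
    have 2: "\<bar>r\<bar> \<le> \<bar>Im c\<bar> + ?D"
      using abs_Im_le_cmod[of "Complex \<delta> r - c"] by simp
    have "1 + \<bar>Im c\<bar> = (1 + \<bar>Im c\<bar>) / e * e"
      using e by simp
    also have "\<dots> \<le> (1 + \<bar>Im c\<bar>) / e * ?D"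
      using 1 e by (intro mult_left_mono) auto
    finally show ?thesis
      using 2 by (simp add: K_def ring_distribs)
  qed
  moreover have "K > 0"
    using e by (simp add: K_def add_nonneg_pos)
  ultimately show thesis by (rule that[rotated])
qed

text \<open>The weight does not refer to any centre in the plane, so bounds obtained with different
  centres can be combined. Continuity is included because integrability is derived from continuity
  and a majorant.\<close>

definition quad_decay :: "real \<Rightarrow> (complex \<Rightarrow> 'b::real_normed_vector) \<Rightarrow> bool" where
  "quad_decay \<delta> g \<longleftrightarrow> continuous_on UNIV (\<lambda>r. g (Complex \<delta> r)) \<and>
     (\<exists>C. \<forall>r. norm (g (Complex \<delta> r)) \<le> C / (1 + \<bar>r\<bar>)\<^sup>2)"

lemma quad_decay_integrable: "quad_decay \<delta> (g :: complex \<Rightarrow> 'b::banach) \<Longrightarrow> (\<lambda>r. g (Complex \<delta> r)) integrable_on UNIV"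
  unfolding quad_decay_def using integrable_on_UNIV_dominated[OF _ _ weight_integrable] by blast

text \<open>Two centres are allowed because in Cauchy's formula one factor of decay comes from the
  function and the other from the kernel.\<close>

lemma quad_decayI:
  assumes "continuous_on UNIV (\<lambda>r. g (Complex \<delta> r))" "Re a \<noteq> \<delta>" "Re b \<noteq> \<delta>"
    and "\<And>r. norm (g (Complex \<delta> r)) \<le> C / (cmod (Complex \<delta> r - a) * cmod (Complex \<delta> r - b))"
  shows "quad_decay \<delta> g"
proof -
  obtain K where K: "K > 0" "\<And>r. 1 + \<bar>r\<bar> \<le> K * cmod (Complex \<delta> r - a)"
    using line_distance[OF assms(2)] by metis
  obtain L where L: "L > 0" "\<And>r. 1 + \<bar>r\<bar> \<le> L * cmod (Complex \<delta> r - b)"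
    using line_distance[OF assms(3)] by metis
  have "norm (g (Complex \<delta> r)) \<le> (\<bar>C\<bar> * K * L) / (1 + \<bar>r\<bar>)\<^sup>2" for r
  proof -
    let ?A = "cmod (Complex \<delta> r - a)" and ?B = "cmod (Complex \<delta> r - b)"
    have A: "?A > 0" and B: "?B > 0"
      using assms(2,3) by auto
    have "(1 + \<bar>r\<bar>)\<^sup>2 \<le> (K * ?A) * (L * ?B)"
      unfolding power2_eq_square using K L by (intro mult_mono) auto
    then have "1 / (?A * ?B) \<le> (K * L) / (1 + \<bar>r\<bar>)\<^sup>2"
      using A B by (simp add: field_simps)
    then have "\<bar>C\<bar> * (1 / (?A * ?B)) \<le> \<bar>C\<bar> * ((K * L) / (1 + \<bar>r\<bar>)\<^sup>2)"
      by (intro mult_left_mono) auto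
    moreover have "C / (?A * ?B) \<le> \<bar>C\<bar> / (?A * ?B)"
      using A B by (intro divide_right_mono) auto
    ultimately show ?thesis
      using assms(4)[of r] by (simp add: mult.assoc)
  qed
  then show ?thesis
    using assms(1) by (auto simp: quad_decay_def)
qed

lemma continuous_on_Complex_line: "continuous_on S (\<lambda>r. Complex \<delta> r)"
  by (auto simp: Complex_eq intro!: continuous_intros)

lemma continuous_on_line:
  assumes "continuous_on S f" "\<And>r. Complex \<delta> r \<in> S"
  shows "continuous_on UNIV (\<lambda>r. f (Complex \<delta> r))"
  by (rule continuous_on_compose2[OF assms(1) continuous_on_Complex_line]) (use assms(2) in auto)

text \<open>Cauchy's formula on the rectangle of width \<open>n\<close> and height
  \<open>2 n\<close> whose left side lies on the line. On the other three sides the integrand is of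
  order \<open>n^-2\<close>, while their total length is \<open>4 n\<close>. A positively oriented
  contour runs down the left side, hence the minus sign.\<close>

lemma cauchy_halfplane:
  fixes \<psi> :: "complex \<Rightarrow> complex"
  assumes holo: "\<psi> holomorphic_on half_plane \<omega>" and \<delta>: "\<omega> < \<delta>" and w: "\<delta> < Re w"
    and c: "Re c < \<delta>" and B: "\<And>z. \<delta> \<le> Re z \<Longrightarrow> cmod (\<psi> z) \<le> B / cmod (z - c)"
  shows "((\<lambda>r. \<psi> (Complex \<delta> r) / (Complex \<delta> r - w)) has_integral (- 2 * pi * \<psi> w)) UNIV"
proof -
  define F where "F z = \<psi> z / (z - w)" for z
  have B0: "B \<ge> 0"
    using order_trans[OF norm_ge_zero B[of w]] w c by (auto simp: zero_le_divide_iff)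
  have op: "open (half_plane \<omega>)" and cv: "convex (half_plane \<omega>)"
    unfolding half_plane_def by (simp_all add: open_halfspace_Re_gt convex_halfspace_Re_gt)
  have contF: "continuous_on (half_plane \<omega> - {w}) F"
    unfolding F_def
    by (intro continuous_intros holomorphic_on_imp_continuous_on holomorphic_on_subset[OF holo]) auto
  have Fbound: "cmod (F z) \<le> B / (cmod (z - c) * cmod (z - w))" if "\<delta> \<le> Re z" for z
    unfolding F_def norm_divide using divide_right_mono[OF B[OF that], of "cmod (z - w)"] by simp
  have "quad_decay \<delta> F"
    by (rule quad_decayI[where a = c and b = w and C = B, OF continuous_on_line[OF contF]])
       (use \<delta> w c Fbound in \<open>auto simp: half_plane_def\<close>)
  then have int: "(\<lambda>r. F (Complex \<delta> r)) integrable_on UNIV"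
    by (rule quad_decay_integrable)
  \<comment> \<open>For \<open>n > N\<close> the point \<open>w\<close> lies inside the rectangle,
    and both \<open>c\<close> and \<open>w\<close> have distance at least \<open>n / 2\<close> from
    its three far sides.\<close>
  define N where "N = 1 + 2 * cmod c + 2 * cmod w + 2 * \<bar>\<delta>\<bar>"
  have est: "cmod (2 * pi * \<i> * \<psi> w + \<i> * integral {- real n..real n} (\<lambda>r. F (Complex \<delta> r))) \<le> 16 * B / real n"
    if n: "real n > N" for n
  proof -
    define n' where "n' = real n"
    define p where "p = rectpath (Complex \<delta> (- n')) (Complex (\<delta> + n') n')"
    have nN: "n' > N"
      using n by (simp add: n'_def)
    then have n0: "n' > 0"
      using norm_ge_zero[of c] norm_ge_zero[of w] unfolding N_def by linarith
    have wbox: "w \<in> box (Complex \<delta> (- n')) (Complex (\<delta> + n') n')"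
      using w n0 nN abs_Re_le_cmod[of w] abs_Im_le_cmod[of w] norm_ge_zero[of c]
      unfolding in_box_complex_iff N_def complex.sel greaterThanLessThan_iff by linarith
    have pim: "path_image p = {z. Re z \<in> {\<delta>, \<delta> + n'} \<and> Im z \<in> {-n'..n'}} \<union> {z. Im z \<in> {-n', n'} \<and> Re z \<in> {\<delta>..\<delta> + n'}}"
      unfolding p_def using n0 by (subst path_image_rectpath) auto
    have psub: "path_image p \<subseteq> half_plane \<omega> - {w}"
      using wbox \<delta> n0 by (auto simp: pim half_plane_def in_box_complex_iff)
    have "(F has_contour_integral (2 * pi * \<i> * winding_number p w * \<psi> w)) p"
      unfolding F_def
      by (rule Cauchy_integral_formula_convex_simple[OF cv holo _ _ psub])
         (use w \<delta> op in \<open>auto simp: p_def interior_open half_plane_def\<close>)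
    moreover have "winding_number p w = 1"
      unfolding p_def by (rule winding_number_rectpath[OF wbox])
    ultimately have I: "(F has_contour_integral (2 * pi * \<i> * \<psi> w)) p"
      by simp
    have far: "cmod (F z) \<le> 4 * B / n'\<^sup>2" if "\<delta> \<le> Re z" "\<bar>Im z\<bar> = n' \<or> Re z = \<delta> + n'" for z
    proof -
      have "n' \<le> cmod z + \<bar>\<delta>\<bar>"
        using that abs_Im_le_cmod[of z] abs_Re_le_cmod[of z] by auto
      then have "n' / 2 \<le> cmod (z - c)" "n' / 2 \<le> cmod (z - w)"
        using nN norm_triangle_ineq2[of z c] norm_triangle_ineq2[of z w]
          norm_ge_zero[of c] norm_ge_zero[of w]
        unfolding N_def by linarith+
      moreover from this have pos: "cmod (z - c) > 0" "cmod (z - w) > 0"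
        using n0 by linarith+
      ultimately have "n' / 2 * (n' / 2) \<le> cmod (z - c) * cmod (z - w)"
        using n0 by (intro mult_mono) auto
      then have "B / (cmod (z - c) * cmod (z - w)) \<le> B / (n' / 2 * (n' / 2))"
        using B0 n0 pos by (intro divide_left_mono mult_pos_pos) auto
      then show ?thesis
        using Fbound[OF that(1)] by (simp add: power2_eq_square mult.commute)
    qed
    have "cmod (2 * pi * \<i> * \<psi> w - \<i> * integral {-n'..n'} (\<lambda>r. F (Complex (\<delta> + n') r))
        + \<i> * integral {-n'..n'} (\<lambda>r. F (Complex \<delta> r))) \<le> 2 * (4 * B / n'\<^sup>2) * (\<delta> + n' - \<delta>)"
      by (rule rectpath_estimate[OF _ n0 _ _ I[unfolded p_def]])
         (use n0 B0 far psub contF in \<open>auto simp: p_def intro: continuous_on_subset\<close>)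
    \<comment> \<open>The far vertical side is not covered by the rectangle estimate. Its length is
      \<open>2 n'\<close>, so its contribution is of order \<open>1 / n'\<close> as well.\<close>
    moreover have "cmod (\<i> * integral {-n'..n'} (\<lambda>r. F (Complex (\<delta> + n') r))) \<le> (4 * B / n'\<^sup>2) * (n' - (- n'))"
      unfolding norm_mult norm_ii mult_1
    proof (rule integral_bound)
      show "continuous_on {-n'..n'} (\<lambda>r. F (Complex (\<delta> + n') r))"
        by (rule continuous_on_compose2[OF contF continuous_on_Complex_line])
           (use psub \<delta> n0 pim in \<open>force simp: half_plane_def\<close>)
    qed (use n0 far in auto)
    ultimately have "cmod (2 * pi * \<i> * \<psi> w + \<i> * integral {-n'..n'} (\<lambda>r. F (Complex \<delta> r)))
       \<le> 2 * (4 * B / n'\<^sup>2) * n' + (4 * B / n'\<^sup>2) * (n' + n')"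
      by (smt (verit) norm_triangle_ineq add.commute add_diff_cancel_left' diff_add_eq norm_triangle_sub)
    also have "\<dots> = 16 * B / n'"
      using n0 by (simp add: field_simps power2_eq_square)
    finally show ?thesis
      by (simp add: n'_def)
  qed
  have "(\<lambda>n. 2 * pi * \<i> * \<psi> w + \<i> * integral {- real n..real n} (\<lambda>r. F (Complex \<delta> r))) \<longlonglongrightarrow> 0"
  proof (rule Lim_null_comparison)
    show "\<forall>\<^sub>F n in sequentially. cmod (2 * pi * \<i> * \<psi> w + \<i> * integral {- real n..real n} (\<lambda>r. F (Complex \<delta> r))) \<le> 16 * B / real n"
    proof -
      obtain n0 where n0: "real n0 > N" using reals_Archimedean2 by blast
      have "real n > N" if "n \<ge> n0" for n
        using n0 that by linarith
      then show ?thesis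
        using est unfolding eventually_sequentially by blast
    qed
    show "(\<lambda>n. 16 * B / real n) \<longlonglongrightarrow> 0"
      by (rule tendsto_divide_0[OF tendsto_const]) (rule filterlim_at_top_imp_at_infinity[OF filterlim_real_sequentially])
  qed
  moreover have "(\<lambda>n. 2 * pi * \<i> * \<psi> w + \<i> * integral {- real n..real n} (\<lambda>r. F (Complex \<delta> r)))
      \<longlonglongrightarrow> 2 * pi * \<i> * \<psi> w + \<i> * integral UNIV (\<lambda>r. F (Complex \<delta> r))"
    by (intro tendsto_intros integral_symmetric_tendsto int)
  ultimately have "2 * pi * \<i> * \<psi> w + \<i> * integral UNIV (\<lambda>r. F (Complex \<delta> r)) = 0"
    using LIMSEQ_unique by blast
  then have "\<i> * (2 * pi * \<psi> w + integral UNIV (\<lambda>r. F (Complex \<delta> r))) = 0"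
    by (simp add: algebra_simps)
  then have "integral UNIV (\<lambda>r. F (Complex \<delta> r)) = - 2 * pi * \<psi> w"
    by (simp add: eq_neg_iff_add_eq_0 add.commute)
  then show ?thesis
    using integrable_integral[OF int] by (simp add: F_def)
qed

text \<open>Cauchy's formula for \<open>G z * (z - w)\<close> at \<open>w\<close>: the kernel
  cancels the added factor, and the residue is zero. Any \<open>w\<close> to the right of the line
  would serve; the factor turns quadratic decay into the simple decay that the formula asks
  for.\<close>

lemma cauchy_halfplane_0:
  fixes G :: "complex \<Rightarrow> complex"
  assumes holo: "G holomorphic_on half_plane \<omega>" and \<delta>: "\<omega> < \<delta>"
    and c: "Re c < \<delta>" and B: "\<And>z. \<delta> \<le> Re z \<Longrightarrow> cmod (G z) \<le> B / (cmod (z - c))\<^sup>2"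
  shows "((\<lambda>r. G (Complex \<delta> r)) has_integral 0) UNIV"
proof -
  define w where "w = Complex (\<delta> + 1) 0"
  define d where "d = \<delta> - Re c"
  have d: "d > 0" using c by (simp add: d_def)
  have B0: "B \<ge> 0"
    using order_trans[OF norm_ge_zero B[of w]] c by (auto simp: zero_le_divide_iff w_def)
  have "((\<lambda>r. (G (Complex \<delta> r) * (Complex \<delta> r - w)) / (Complex \<delta> r - w)) has_integral (- 2 * pi * (G w * (w - w)))) UNIV"
  proof (rule cauchy_halfplane[where \<psi> = "\<lambda>z. G z * (z - w)", OF _ \<delta> _ c])
    show "(\<lambda>z. G z * (z - w)) holomorphic_on half_plane \<omega>"
      by (intro holomorphic_intros holo)
    show "cmod (G z * (z - w)) \<le> (B * (1 + cmod (c - w) / d)) / cmod (z - c)" if "\<delta> \<le> Re z" for z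
    proof -
      have D: "d \<le> cmod (z - c)"
        using complex_Re_le_cmod[of "z - c"] that by (simp add: d_def)
      have "cmod (z - w) \<le> cmod (z - c) + cmod (c - w)"
        using norm_triangle_ineq[of "z - c" "c - w"] by simp
      also have "cmod (c - w) = cmod (c - w) / d * d"
        using d by simp
      also have "\<dots> \<le> cmod (c - w) / d * cmod (z - c)"
        using D d by (intro mult_left_mono) auto
      finally have "cmod (z - w) \<le> (1 + cmod (c - w) / d) * cmod (z - c)"
        by (simp add: algebra_simps)
      then have "cmod (G z) * cmod (z - w) \<le> B / (cmod (z - c))\<^sup>2 * ((1 + cmod (c - w) / d) * cmod (z - c))"
        using B[OF that] B0 by (intro mult_mono) auto
      also have "\<dots> = (B * (1 + cmod (c - w) / d)) / cmod (z - c)"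
        using D d by (simp add: power2_eq_square)
      finally show ?thesis by (simp add: norm_mult)
    qed
  qed (simp add: w_def)
  moreover have "Complex \<delta> r \<noteq> w" for r
    by (auto simp: w_def)
  ultimately show ?thesis by simp
qed

text \<open>The reflection \<open>z \<mapsto> - cnj z\<close>, combined with conjugation of the
  values, preserves holomorphy, exchanges left and right half-planes and keeps the parameter
  \<open>r\<close> of the line. It reverses the orientation, hence the positive sign.\<close>

lemma cauchy_left_halfplane:
  fixes \<psi> :: "complex \<Rightarrow> complex"
  assumes holo: "\<psi> holomorphic_on {z. Re z < \<omega>}" and \<delta>: "\<delta> < \<omega>" and w: "Re w < \<delta>"
    and c: "\<delta> < Re c" and B: "\<And>z. Re z \<le> \<delta> \<Longrightarrow> cmod (\<psi> z) \<le> B / cmod (z - c)"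
  shows "((\<lambda>r. \<psi> (Complex \<delta> r) / (Complex \<delta> r - w)) has_integral (2 * pi * \<psi> w)) UNIV"
proof -
  define \<phi> where "\<phi> z = cnj (\<psi> (- cnj z))" for z
  have op: "open (uminus ` half_plane \<omega>')" "open (half_plane \<omega>')" for \<omega>'
    unfolding half_plane_def
    by (intro open_negations) (simp_all add: open_halfspace_Re_gt)
  have "\<phi> = cnj \<circ> (\<psi> \<circ> uminus) \<circ> cnj"
    by (auto simp: \<phi>_def)
  moreover have "\<psi> \<circ> uminus holomorphic_on cnj ` half_plane (- \<omega>)"
    by (rule holomorphic_on_compose[OF _ holomorphic_on_subset[OF holo]])
       (auto simp: half_plane_def intro!: holomorphic_intros)
  ultimately have "\<phi> holomorphic_on half_plane (- \<omega>)"
    using holomorphic_on_compose_cnj_cnj[OF _ op(2)] by metis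
  then have "((\<lambda>r. \<phi> (Complex (- \<delta>) r) / (Complex (- \<delta>) r - (- cnj w))) has_integral (- 2 * pi * \<phi> (- cnj w))) UNIV"
  proof (rule cauchy_halfplane)
    show "cmod (\<phi> z) \<le> B / cmod (z - (- cnj c))" if "- \<delta> \<le> Re z" for z
    proof -
      have "cmod (z + cnj c) = cmod (- cnj z - c)"
        by (metis (no_types, lifting) complex_cnj_add complex_cnj_cnj complex_mod_cnj minus_add_distrib norm_minus_cancel uminus_add_conv_diff add.commute diff_minus_eq_add minus_diff_eq)
      then show ?thesis
        using B[of "- cnj z"] that by (simp add: \<phi>_def)
    qed
  qed (use assms in auto)
  moreover have "\<phi> (Complex (- \<delta>) r) / (Complex (- \<delta>) r - (- cnj w)) = cnj (- (\<psi> (Complex \<delta> r) / (Complex \<delta> r - w)))" for r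
  proof -
    have 1: "- cnj (Complex (- \<delta>) r) = Complex \<delta> r"
      by (simp add: complex_eq_iff)
    have 2: "Complex (- \<delta>) r - (- cnj w) = - cnj (Complex \<delta> r - w)"
      by (simp add: complex_eq_iff)
    show ?thesis
      unfolding \<phi>_def 1 2 by (simp only: complex_cnj_minus complex_cnj_divide minus_divide_right)
  qed
  ultimately have "((cnj \<circ> (\<lambda>r. - (\<psi> (Complex \<delta> r) / (Complex \<delta> r - w)))) has_integral cnj (- 2 * pi * \<psi> w)) UNIV"
    by (simp add: o_def \<phi>_def)
  from has_integral_neg[OF this[unfolded has_integral_cnj]] show ?thesis
    by simp
qed

text \<open>The rectangles have fixed width, so quadratic decay makes the horizontal sides vanish in
  the limit. This is what moves the line of integration.\<close>

lemma cauchy_strip: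
  fixes G :: "complex \<Rightarrow> complex"
  assumes holo: "G holomorphic_on S" and S: "{z. \<delta>1 \<le> Re z \<and> Re z \<le> \<delta>2} \<subseteq> S"
    and \<delta>: "\<delta>1 < \<delta>2" and c: "Re c < \<delta>1"
    and B: "\<And>z. \<delta>1 \<le> Re z \<Longrightarrow> Re z \<le> \<delta>2 \<Longrightarrow> cmod (G z) \<le> B / (cmod (z - c))\<^sup>2"
  shows "integral UNIV (\<lambda>r. G (Complex \<delta>1 r)) = integral UNIV (\<lambda>r. G (Complex \<delta>2 r))"
proof -
  define T where "T = {z. \<delta>1 \<le> Re z \<and> Re z \<le> \<delta>2}"
  have holT: "G holomorphic_on T"
    using holo S by (auto simp: T_def intro: holomorphic_on_subset)
  then have contT: "continuous_on T G"
    by (rule holomorphic_on_imp_continuous_on)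
  have "T = {z. \<delta>1 \<le> Re z} \<inter> {z. Re z \<le> \<delta>2}"
    by (auto simp: T_def)
  then have cv: "convex T"
    by (simp add: convex_Int convex_halfspace_Re_ge convex_halfspace_Re_le)
  have B0: "B \<ge> 0"
    using order_trans[OF norm_ge_zero B[of "of_real \<delta>1"]] c \<delta> by (auto simp: zero_le_divide_iff)
  have "quad_decay \<delta> G" if "\<delta> \<in> {\<delta>1, \<delta>2}" for \<delta>
    by (rule quad_decayI[where a = c and b = c and C = B, OF continuous_on_line[OF contT]])
       (use that \<delta> c B in \<open>auto simp: T_def power2_eq_square\<close>)
  then have int: "(\<lambda>r. G (Complex \<delta>1 r)) integrable_on UNIV" "(\<lambda>r. G (Complex \<delta>2 r)) integrable_on UNIV"
    by (auto intro: quad_decay_integrable)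
  define N where "N = 1 + 2 * cmod c"
  let ?D = "\<lambda>n. \<i> * integral {- real n..real n} (\<lambda>r. G (Complex \<delta>1 r)) - \<i> * integral {- real n..real n} (\<lambda>r. G (Complex \<delta>2 r))"
  have est: "cmod (?D n) \<le> 8 * B * (\<delta>2 - \<delta>1) / real n" if n: "real n > N" for n
  proof -
    define n' where "n' = real n"
    define p where "p = rectpath (Complex \<delta>1 (- n')) (Complex \<delta>2 n')"
    have nN: "n' > N"
      using n by (simp add: n'_def)
    then have n0: "n' \<ge> 1"
      using norm_ge_zero[of c] unfolding N_def by linarith
    have psub: "path_image p \<subseteq> T"
      unfolding p_def T_def using n0 \<delta> by (subst path_image_rectpath) auto
    have I: "(G has_contour_integral 0) p"
      by (rule Cauchy_theorem_convex_simple[OF holT cv _ psub]) (auto simp: p_def)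
    have far: "cmod (G z) \<le> 4 * B / n'\<^sup>2" if "\<delta>1 \<le> Re z" "Re z \<le> \<delta>2" "\<bar>Im z\<bar> = n'" for z
    proof -
      have "n' / 2 \<le> cmod (z - c)"
        using nN norm_triangle_ineq2[of z c] that abs_Im_le_cmod[of z] norm_ge_zero[of c]
        unfolding N_def by linarith
      then have "(n' / 2)\<^sup>2 \<le> (cmod (z - c))\<^sup>2"
        using n0 by (intro power_mono) auto
      then have "B / (cmod (z - c))\<^sup>2 \<le> B / (n' / 2)\<^sup>2"
        using B0 n0 by (intro divide_left_mono) (auto intro!: mult_pos_pos zero_less_power order.strict_trans2[OF _ \<open>n' / 2 \<le> cmod (z - c)\<close>] simp del: zero_less_norm_iff)
      then show ?thesis
        using B[OF that(1,2)] by (simp add: power_divide mult.commute)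
    qed
    have "cmod (0 - \<i> * integral {-n'..n'} (\<lambda>r. G (Complex \<delta>2 r))
        + \<i> * integral {-n'..n'} (\<lambda>r. G (Complex \<delta>1 r))) \<le> 2 * (4 * B / n'\<^sup>2) * (\<delta>2 - \<delta>1)"
      by (rule rectpath_estimate[OF \<delta> _ _ _ I[unfolded p_def]])
         (use n0 B0 far psub contT in \<open>auto simp: p_def intro: continuous_on_subset\<close>)
    also have "\<dots> \<le> 8 * B * (\<delta>2 - \<delta>1) / n'"
    proof -
      have "8 * B * (\<delta>2 - \<delta>1) / n'\<^sup>2 \<le> 8 * B * (\<delta>2 - \<delta>1) / n'"
        using n0 B0 \<delta> by (intro divide_left_mono) (auto simp: power2_eq_square)
      then show ?thesis by simp
    qed
    finally show ?thesis
      by (simp add: n'_def add.commute)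
  qed
  have "?D \<longlonglongrightarrow> 0"
  proof (rule Lim_null_comparison)
    show "\<forall>\<^sub>F n in sequentially. cmod (?D n) \<le> 8 * B * (\<delta>2 - \<delta>1) / real n"
    proof -
      obtain n0 where n0: "real n0 > N" using reals_Archimedean2 by blast
      have "real n > N" if "n \<ge> n0" for n
        using n0 that by linarith
      then show ?thesis
        using est unfolding eventually_sequentially by blast
    qed
    show "(\<lambda>n. 8 * B * (\<delta>2 - \<delta>1) / real n) \<longlonglongrightarrow> 0"
      by (rule tendsto_divide_0[OF tendsto_const]) (rule filterlim_at_top_imp_at_infinity[OF filterlim_real_sequentially])
  qed
  moreover have "?D \<longlonglongrightarrow> \<i> * integral UNIV (\<lambda>r. G (Complex \<delta>1 r)) - \<i> * integral UNIV (\<lambda>r. G (Complex \<delta>2 r))"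
    by (intro tendsto_intros integral_symmetric_tendsto int)
  ultimately have "\<i> * integral UNIV (\<lambda>r. G (Complex \<delta>1 r)) - \<i> * integral UNIV (\<lambda>r. G (Complex \<delta>2 r)) = 0"
    using LIMSEQ_unique by blast
  then show ?thesis by simp
qed

section \<open>Resolvent families and the elementary calculus\<close>

text \<open>No operator is attached to the family, so that the same results serve for the resolvent
  of \<open>A\<close> and for the family of adjoint resolvents.\<close>

locale resolvent_family =
  fixes L :: "complex \<Rightarrow> 'a::complex_hilbert_space \<Rightarrow> 'a"
  assumes bcl: "Re z < 0 \<Longrightarrow> bounded_clinear (L z)"
    and bound: "\<delta> < 0 \<Longrightarrow> \<exists>K. \<forall>z x. Re z \<le> \<delta> \<longrightarrow> norm (L z x) \<le> K * norm x"
    and resolvent_identity: "Re z < 0 \<Longrightarrow> Re w < 0 \<Longrightarrow> L z x - L w x = (w - z) *\<^sub>C L z (L w x)"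
begin

lemma blin: "Re z < 0 \<Longrightarrow> bounded_linear (L z)"
  using bcl bounded_clinearD by blast

lemmas L_add = linear_add[OF bounded_linear.linear[OF blin]]
lemmas L_diff = linear_diff[OF bounded_linear.linear[OF blin]]
lemmas L_scaleC = bounded_clinearD(2)[OF bcl]

lemma boundE:
  assumes "\<delta> < 0"
  obtains K where "K > 0" "\<And>z x. Re z \<le> \<delta> \<Longrightarrow> norm (L z x) \<le> K * norm x"
proof -
  obtain K where K: "\<And>z x. Re z \<le> \<delta> \<Longrightarrow> norm (L z x) \<le> K * norm x"
    using bound[OF assms] by blast
  have "norm (L z x) \<le> max 1 K * norm x" if "Re z \<le> \<delta>" for z x
    using K[OF that] by (meson max.cobounded2 mult_right_mono norm_ge_zero order_trans)
  then show thesis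
    using that[of "max 1 K"] by simp
qed

lemma commute:
  assumes "Re z < 0" "Re w < 0"
  shows "L z (L w x) = L w (L z x)"
proof (cases "z = w")
  case False
  have "(w - z) *\<^sub>C L z (L w x) = - ((z - w) *\<^sub>C L w (L z x))"
    unfolding resolvent_identity[OF assms, of x, symmetric] resolvent_identity[OF assms(2,1), of x, symmetric]
    by simp
  also have "\<dots> = (w - z) *\<^sub>C L w (L z x)"
    by (metis minus_diff_eq scaleC_minus_left)
  finally show ?thesis
    using False by (simp add: scaleC_cancel)
qed simp

lemma L_product:
  assumes "Re z < 0" "Re w < 0" "z \<noteq> w"
  shows "L z (L w x) = (1 / (w - z)) *\<^sub>C L z x - (1 / (w - z)) *\<^sub>C L w x"
proof -
  have "(1 / (w - z)) *\<^sub>C (L z x - L w x) = L z (L w x)"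
    using assms by (simp add: resolvent_identity scaleC_scaleC scaleC_one)
  then show ?thesis by (simp add: scaleC_diff_right)
qed

lemma tendsto_L:
  assumes "Re w < 0"
  shows "((\<lambda>z. L z x) \<longlongrightarrow> L w x) (at w within S)"
proof -
  define \<delta> where "\<delta> = Re w / 2"
  have \<delta>: "\<delta> < 0" "Re w < \<delta>" using assms by (auto simp: \<delta>_def)
  obtain K where K: "K > 0" "\<And>z x. Re z \<le> \<delta> \<Longrightarrow> norm (L z x) \<le> K * norm x"
    using boundE[OF \<delta>(1)] by metis
  have "\<forall>\<^sub>F z in at w within S. Re z < \<delta>"
    using \<delta>(2) by (intro order_tendstoD(2)[of Re "Re w"] tendsto_intros)
  then have ev: "\<forall>\<^sub>F z in at w within S. norm (L z x - L w x) \<le> cmod (w - z) * (K * norm (L w x))"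
  proof (rule eventually_mono)
    fix z assume z: "Re z < \<delta>"
    then have "norm (L z x - L w x) = cmod (w - z) * norm (L z (L w x))"
      using assms \<delta> by (subst resolvent_identity) (auto simp: norm_scaleC)
    then show "norm (L z x - L w x) \<le> cmod (w - z) * (K * norm (L w x))"
      using K(2)[of z "L w x"] z by (simp add: mult_left_mono)
  qed
  have "((\<lambda>z. cmod (w - z) * (K * norm (L w x))) \<longlongrightarrow> cmod (w - w) * (K * norm (L w x))) (at w within S)"
    by (intro tendsto_intros)
  then have "((\<lambda>z. L z x - L w x) \<longlongrightarrow> 0) (at w within S)"
    by (intro Lim_null_comparison[OF ev]) simp
  then show ?thesis
    by (simp add: LIM_zero_iff)
qed

lemma continuous_L: "S \<subseteq> {z. Re z < 0} \<Longrightarrow> continuous_on S (\<lambda>z. L z x)"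
  unfolding continuous_on_def using tendsto_L by blast

lemma continuous_L_line: "\<delta> < 0 \<Longrightarrow> continuous_on UNIV (\<lambda>r. L (Complex \<delta> r) x)"
  by (rule continuous_on_line[OF continuous_L[OF order.refl]]) auto

text \<open>By the resolvent identity the difference quotient is exactly
  \<open>- \<phi> (L z (L w x))\<close>, so only strong continuity is needed. Holomorphy is treated
  through complex-linear functionals because the scalar Cauchy theorems are applied to
  these.\<close>

lemma has_derivative_L:
  assumes w: "Re w < 0" and \<phi>: "bounded_linear \<phi>" "\<And>c x. \<phi> (c *\<^sub>C x) = c * \<phi> x"
  shows "((\<lambda>z. \<phi> (L z x)) has_field_derivative (- \<phi> (L w (L w x)))) (at w)"
proof -
  interpret \<phi>: bounded_linear \<phi> by fact
  have "\<forall>\<^sub>F z in at w. Re z < 0"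
    using w by (intro order_tendstoD(2)[of Re "Re w"] tendsto_intros)
  moreover have "\<forall>\<^sub>F z in at w. z \<noteq> w"
    by (rule eventually_neq_at_within)
  ultimately have "\<forall>\<^sub>F z in at w. - \<phi> (L z (L w x)) = (\<phi> (L z x) - \<phi> (L w x)) / (z - w)"
  proof eventually_elim
    case (elim z)
    have "\<phi> (L z x) - \<phi> (L w x) = (w - z) * \<phi> (L z (L w x))"
      using resolvent_identity[OF elim(1) w, of x] \<phi>(2) by (metis \<phi>.diff)
    then show ?case
      using elim by (simp add: field_simps)
  qed
  moreover have "((\<lambda>z. - \<phi> (L z (L w x))) \<longlongrightarrow> - \<phi> (L w (L w x))) (at w)"
    by (intro tendsto_minus \<phi>.tendsto tendsto_L w)
  ultimately show ?thesis
    unfolding has_field_derivative_iff by (rule Lim_transform_eventually[rotated])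
qed

lemma holomorphic_L:
  assumes "S \<subseteq> {z. Re z < 0}" and "bounded_linear \<phi>" "\<And>c x. \<phi> (c *\<^sub>C x) = c * \<phi> x"
  shows "(\<lambda>z. \<phi> (L z x)) holomorphic_on S"
  unfolding holomorphic_on_def field_differentiable_def
  using has_field_derivative_at_within[OF has_derivative_L[OF _ assms(2,3)]] assms(1) by blast

lemma holomorphic_cinner_L:
  "S \<subseteq> {z. Re z < 0} \<Longrightarrow> (\<lambda>z. cinner (L z x) y) holomorphic_on S"
  by (rule holomorphic_L[OF _ bounded_linear_cinner_left]) (auto simp: cinner_scaleC_left)

definition E :: "real \<Rightarrow> (complex \<Rightarrow> complex) \<Rightarrow> 'a \<Rightarrow> 'a" where
  "E \<delta> g x = - ((1 / (2 * pi)) *\<^sub>R integral UNIV (\<lambda>r. g (Complex \<delta> r) *\<^sub>C L (Complex \<delta> r) x))"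

lemma quad_decay_scaleC_L:
  assumes "\<delta> < 0" "quad_decay \<delta> g"
  shows "quad_decay \<delta> (\<lambda>z. g z *\<^sub>C L z x)"
proof -
  obtain K where K: "K > 0" "\<And>z x. Re z \<le> \<delta> \<Longrightarrow> norm (L z x) \<le> K * norm x"
    using boundE[OF assms(1)] by metis
  obtain C where C: "\<And>r. cmod (g (Complex \<delta> r)) \<le> C / (1 + \<bar>r\<bar>)\<^sup>2"
    using assms(2) by (auto simp: quad_decay_def)
  have "norm (g (Complex \<delta> r) *\<^sub>C L (Complex \<delta> r) x) \<le> (C * (K * norm x)) / (1 + \<bar>r\<bar>)\<^sup>2" for r
  proof -
    have "norm (g (Complex \<delta> r) *\<^sub>C L (Complex \<delta> r) x) \<le> C / (1 + \<bar>r\<bar>)\<^sup>2 * (K * norm x)"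
      unfolding norm_scaleC using C K order_trans[OF norm_ge_zero C] by (intro mult_mono) auto
    then show ?thesis by simp
  qed
  moreover have "continuous_on UNIV (\<lambda>r. g (Complex \<delta> r) *\<^sub>C L (Complex \<delta> r) x)"
    using assms by (intro continuous_intros continuous_L_line) (auto simp: quad_decay_def)
  ultimately show ?thesis
    unfolding quad_decay_def by blast
qed

lemma E_integrable:
  "\<delta> < 0 \<Longrightarrow> quad_decay \<delta> g \<Longrightarrow> (\<lambda>r. g (Complex \<delta> r) *\<^sub>C L (Complex \<delta> r) x) integrable_on UNIV"
  using quad_decay_integrable[OF quad_decay_scaleC_L] by blast

text \<open>\<open>W\<close> depends on \<open>\<delta>\<close> alone while \<open>C\<close> stays
  explicit. Pointwise estimates of symbols thereby become operator estimates, both for Taylor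
  remainders of exponentials and for the convergence of regularizations.\<close>

lemma E_norm_le:
  assumes "\<delta> < 0"
  obtains W where "W > 0" "\<And>g C x. continuous_on UNIV (\<lambda>r. g (Complex \<delta> r)) \<Longrightarrow>
    (\<And>r. cmod (g (Complex \<delta> r)) \<le> C / (1 + \<bar>r\<bar>)\<^sup>2) \<Longrightarrow> norm (E \<delta> g x) \<le> C * W * norm x"
proof -
  obtain K where K: "K > 0" "\<And>z x. Re z \<le> \<delta> \<Longrightarrow> norm (L z x) \<le> K * norm x"
    using boundE[OF assms(1)] by metis
  define I where "I = integral UNIV (\<lambda>r::real. 1 / (1 + \<bar>r\<bar>)\<^sup>2)"
  have I: "I \<ge> 0"
    unfolding I_def by (intro integral_nonneg weight_integrable) auto
  define W where "W = K * (I + 1)"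
  have "norm (E \<delta> g x) \<le> C * W * norm x"
    if cont: "continuous_on UNIV (\<lambda>r. g (Complex \<delta> r))" and C: "\<And>r. cmod (g (Complex \<delta> r)) \<le> C / (1 + \<bar>r\<bar>)\<^sup>2" for g C x
  proof -
    have C0: "C \<ge> 0"
      using order_trans[OF norm_ge_zero C[of 0]] by simp
    have qd: "quad_decay \<delta> g"
      using that by (auto simp: quad_decay_def)
    have "norm (integral UNIV (\<lambda>r. g (Complex \<delta> r) *\<^sub>C L (Complex \<delta> r) x))
        \<le> integral UNIV (\<lambda>r. (C * K * norm x) * (1 / (1 + \<bar>r\<bar>)\<^sup>2))"
    proof (rule integral_norm_bound_integral[OF E_integrable[OF assms qd]])
      show "norm (g (Complex \<delta> r) *\<^sub>C L (Complex \<delta> r) x) \<le> (C * K * norm x) * (1 / (1 + \<bar>r\<bar>)\<^sup>2)" for r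
      proof -
        have "norm (g (Complex \<delta> r) *\<^sub>C L (Complex \<delta> r) x) \<le> C / (1 + \<bar>r\<bar>)\<^sup>2 * (K * norm x)"
          unfolding norm_scaleC using C K order_trans[OF norm_ge_zero C] by (intro mult_mono) auto
        then show ?thesis by simp
      qed
    qed (use weight_integrable in simp)
    also have "\<dots> = C * K * norm x * I"
      unfolding I_def by (rule integral_mult_right)
    finally have 1: "norm (integral UNIV (\<lambda>r. g (Complex \<delta> r) *\<^sub>C L (Complex \<delta> r) x)) \<le> C * K * norm x * I" .
    have "norm (E \<delta> g x) \<le> 1 * norm (integral UNIV (\<lambda>r. g (Complex \<delta> r) *\<^sub>C L (Complex \<delta> r) x))"
      unfolding E_def norm_minus_cancel norm_scaleR
      by (intro mult_right_mono) (use pi_gt3 in auto)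
    also have "\<dots> \<le> C * K * norm x * (I + 1)"
      using 1 C0 K by (simp add: ring_distribs add_increasing2)
    finally show ?thesis by (simp add: W_def ac_simps)
  qed
  moreover have "W > 0" using K I by (simp add: W_def)
  ultimately show thesis by (rule that[rotated])
qed

lemma E_add_left:
  assumes "\<delta> < 0" "quad_decay \<delta> g" "quad_decay \<delta> h"
  shows "E \<delta> (\<lambda>z. g z + h z) x = E \<delta> g x + E \<delta> h x"
  unfolding E_def
  by (simp add: scaleC_add_left integral_add[OF E_integrable E_integrable] assms scaleR_add_right)

lemma E_mult_left:
  assumes "\<delta> < 0" "quad_decay \<delta> g"
  shows "E \<delta> (\<lambda>z. c * g z) x = c *\<^sub>C E \<delta> g x"
  using integral_linear[OF E_integrable[OF assms, of x] bounded_linear_scaleC_right[of c]]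
  unfolding E_def by (simp add: scaleC_scaleC[symmetric] scaleC_scaleR o_def)

lemma E_minus_left: "E \<delta> (\<lambda>z. - g z) x = - E \<delta> g x"
  unfolding E_def by simp

lemma E_cong: "(\<And>r. g (Complex \<delta> r) = h (Complex \<delta> r)) \<Longrightarrow> E \<delta> g x = E \<delta> h x"
  unfolding E_def by simp

lemma E_commute:
  assumes "\<delta> < 0" "quad_decay \<delta> g" "bounded_clinear S" "\<And>r. S (L (Complex \<delta> r) x) = L (Complex \<delta> r) (S x)"
  shows "S (E \<delta> g x) = E \<delta> g (S x)"
proof -
  interpret bounded_linear S
    using assms(3) by (rule bounded_clinearD)
  show ?thesis
    using integral_linear[OF E_integrable[OF assms(1,2), of x] bounded_clinearD(1)[OF assms(3)]]
    unfolding E_def by (simp add: neg scaleR o_def bounded_clinearD(2)[OF assms(3)] assms(4))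
qed

lemma E_bounded_clinear:
  assumes "\<delta> < 0" "quad_decay \<delta> g"
  shows "bounded_clinear (E \<delta> g)"
proof -
  obtain W where W: "\<And>g C x. continuous_on UNIV (\<lambda>r. g (Complex \<delta> r)) \<Longrightarrow>
    (\<And>r. cmod (g (Complex \<delta> r)) \<le> C / (1 + \<bar>r\<bar>)\<^sup>2) \<Longrightarrow> norm (E \<delta> g x) \<le> C * W * norm x"
    using E_norm_le[OF assms(1)] by metis
  obtain C where C: "\<And>r. cmod (g (Complex \<delta> r)) \<le> C / (1 + \<bar>r\<bar>)\<^sup>2"
    using assms(2) by (auto simp: quad_decay_def)
  have L0: "Re (Complex \<delta> r) < 0" for r using assms by simp
  show ?thesis
  proof (rule bounded_clinearI)
    show "E \<delta> g (x + y) = E \<delta> g x + E \<delta> g y" for x y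
      unfolding E_def
      by (simp add: scaleC_add_right L_add[OF L0] integral_add[OF E_integrable E_integrable] assms scaleR_add_right)
    show "E \<delta> g (c *\<^sub>C x) = c *\<^sub>C E \<delta> g x" for c x
      using integral_linear[OF E_integrable[OF assms, of x] bounded_linear_scaleC_right[of c]]
      unfolding E_def by (simp add: L_scaleC[OF L0] scaleC_scaleC scaleC_scaleR o_def mult.commute)
    show "norm (E \<delta> g x) \<le> (C * W) * norm x" for x
      by (rule W) (use assms C in \<open>auto simp: quad_decay_def\<close>)
  qed
qed

lemma E_cinner:
  assumes "\<delta> < 0" "quad_decay \<delta> g"
  shows "cinner (E \<delta> g x) y = - ((1 / (2 * pi)) *\<^sub>R
    integral UNIV (\<lambda>r. g (Complex \<delta> r) * cinner (L (Complex \<delta> r) x) y))"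
  using integral_linear[OF E_integrable[OF assms, of x] bounded_linear_cinner_left[of y]]
  unfolding E_def by (simp add: cinner_minus_left cinner_scaleR_left cinner_scaleC_left o_def)

end

text \<open>The bound is imposed on the whole closed half-plane to the right of the line, where
  contours are closed; holomorphy on a larger half-plane leaves room around the line. Quadratic
  decay is enough, since every symbol used carries a factor \<open>1 / (z - c)^2\<close>.\<close>

definition elementary :: "real \<Rightarrow> real \<Rightarrow> (complex \<Rightarrow> complex) \<Rightarrow> bool" where
  "elementary \<omega> \<delta> g \<longleftrightarrow> \<omega> < \<delta> \<and> g holomorphic_on half_plane \<omega> \<and>
     (\<exists>B c. Re c < \<delta> \<and> (\<forall>z. \<delta> \<le> Re z \<longrightarrow> cmod (g z) \<le> B / (cmod (z - c))\<^sup>2))"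

lemma elementary_quad_decay:
  assumes "elementary \<omega> \<delta> g"
  shows "quad_decay \<delta> g"
proof -
  obtain B c where *: "\<omega> < \<delta>" "g holomorphic_on half_plane \<omega>" "Re c < \<delta>"
    "\<And>z. \<delta> \<le> Re z \<Longrightarrow> cmod (g z) \<le> B / (cmod (z - c))\<^sup>2"
    using assms by (auto simp: elementary_def)
  show ?thesis
    by (rule quad_decayI[where a = c and b = c and C = B, OF continuous_on_line])
       (use * in \<open>auto intro: holomorphic_on_imp_continuous_on simp: half_plane_def power2_eq_square\<close>)
qed

lemma elementary_mono:
  assumes "elementary \<omega> \<delta> g" "\<delta> \<le> \<delta>'"
  shows "elementary \<omega> \<delta>' g"
proof -
  obtain B c where *: "\<omega> < \<delta>" "g holomorphic_on half_plane \<omega>" "Re c < \<delta>"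
    "\<And>z. \<delta> \<le> Re z \<Longrightarrow> cmod (g z) \<le> B / (cmod (z - c))\<^sup>2"
    using assms(1) by (auto simp: elementary_def)
  show ?thesis
    unfolding elementary_def using * assms(2)
    by (intro conjI exI[of _ B] exI[of _ c]) auto
qed

lemma elementary_mult:
  assumes "elementary \<omega> \<delta> g" "h holomorphic_on half_plane \<omega>" "\<And>z. \<delta> \<le> Re z \<Longrightarrow> cmod (h z) \<le> C"
  shows "elementary \<omega> \<delta> (\<lambda>z. h z * g z)"
proof -
  obtain B c where *: "\<omega> < \<delta>" "g holomorphic_on half_plane \<omega>" "Re c < \<delta>"
    "\<And>z. \<delta> \<le> Re z \<Longrightarrow> cmod (g z) \<le> B / (cmod (z - c))\<^sup>2"
    using assms(1) by (auto simp: elementary_def)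
  have "cmod (h z * g z) \<le> (C * B) / (cmod (z - c))\<^sup>2" if "\<delta> \<le> Re z" for z
  proof -
    have "cmod (h z) * cmod (g z) \<le> C * (B / (cmod (z - c))\<^sup>2)"
      using * assms(3) that order_trans[OF norm_ge_zero assms(3)] by (intro mult_mono) auto
    then show ?thesis by (simp add: norm_mult)
  qed
  then show ?thesis
    unfolding elementary_def using * assms(2)
    by (intro conjI exI[of _ "C * B"] exI[of _ c] allI impI holomorphic_on_mult) auto
qed

lemma resolvent_function_bound:
  assumes "Re \<mu> < \<delta>" "\<delta> \<le> Re z"
  shows "cmod (1 / (\<mu> - z)) \<le> 1 / (\<delta> - Re \<mu>)"
proof -
  have "\<delta> - Re \<mu> \<le> cmod (z - \<mu>)"
    using complex_Re_le_cmod[of "z - \<mu>"] assms by simp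
  then show ?thesis
    using assms by (simp add: norm_divide norm_minus_commute divide_left_mono frac_le)
qed

lemma elementary_divide:
  assumes "elementary \<omega> \<delta> g" "Re \<mu> \<le> \<omega>"
  shows "elementary \<omega> \<delta> (\<lambda>z. g z / (\<mu> - z))"
proof -
  have \<delta>: "\<omega> < \<delta>" using assms by (auto simp: elementary_def)
  have "elementary \<omega> \<delta> (\<lambda>z. (1 / (\<mu> - z)) * g z)"
  proof (rule elementary_mult[OF assms(1)])
    show "(\<lambda>z. 1 / (\<mu> - z)) holomorphic_on half_plane \<omega>"
      using assms by (intro holomorphic_intros) (auto simp: half_plane_def)
    show "cmod (1 / (\<mu> - z)) \<le> 1 / (\<delta> - Re \<mu>)" if "\<delta> \<le> Re z" for z
      by (rule resolvent_function_bound) (use assms \<delta> that in auto)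
  qed
  then show ?thesis by simp
qed

lemma elementary_inverse_square:
  assumes "Re \<mu> \<le> \<omega>" "\<omega> < \<delta>"
  shows "elementary \<omega> \<delta> (\<lambda>z. 1 / (z - \<mu>)\<^sup>2)"
  unfolding elementary_def using assms
  by (intro conjI exI[of _ 1] exI[of _ \<mu>] allI impI holomorphic_intros)
     (auto simp: half_plane_def norm_divide norm_power)

lemma elementary_Hinf:
  assumes "f \<in> Hinf \<omega>" "Re \<mu> \<le> \<omega>" "\<omega> < \<delta>"
  shows "elementary \<omega> \<delta> (\<lambda>z. f z / (z - \<mu>)\<^sup>2)"
proof -
  obtain C where "\<And>z. z \<in> half_plane \<omega> \<Longrightarrow> cmod (f z) \<le> C"
    using assms(1) by (auto simp: Hinf_def bounded_iff)
  then have "elementary \<omega> \<delta> (\<lambda>z. f z * (1 / (z - \<mu>)\<^sup>2))"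
    using assms by (intro elementary_mult[where C = C] elementary_inverse_square)
      (auto simp: Hinf_def half_plane_def)
  then show ?thesis by simp
qed

section \<open>Products with resolvents, shifts of the line, and the normalization of the elementary
  calculus\<close>

context resolvent_family
begin

text \<open>Here \<open>L z (L \<mu> x)\<close> equals
  \<open>(L z x - L \<mu> x) / (\<mu> - z)\<close>. The second term contributes the scalar integral
  of \<open>g z / (\<mu> - z)\<close> times a fixed vector, and this integral vanishes on closing
  the contour to the right, away from \<open>\<mu>\<close>.\<close>

lemma E_resolvent:
  assumes g: "elementary \<omega> \<delta> g" and "\<delta> < 0" "Re \<mu> < \<delta>"
  shows "E \<delta> g (L \<mu> x) = E \<delta> (\<lambda>z. g z / (\<mu> - z)) x"
proof -
  obtain B c where *: "\<omega> < \<delta>" "g holomorphic_on half_plane \<omega>" "Re c < \<delta>"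
    "\<And>z. \<delta> \<le> Re z \<Longrightarrow> cmod (g z) \<le> B / (cmod (z - c))\<^sup>2"
    using g by (auto simp: elementary_def)
  \<comment> \<open>The half-plane of holomorphy is shrunk so that \<open>\<mu>\<close>, which may
    lie to the right of \<open>\<omega>\<close>, is excluded from it.\<close>
  have "elementary (max \<omega> (Re \<mu>)) \<delta> g"
    unfolding elementary_def using * assms
    by (intro conjI exI[of _ B] exI[of _ c]) (auto intro: holomorphic_on_subset simp: half_plane_def)
  then have el: "elementary (max \<omega> (Re \<mu>)) \<delta> (\<lambda>z. g z / (\<mu> - z))"
    by (rule elementary_divide) simp
  note qd = elementary_quad_decay[OF el]
  obtain B' c' where c': "Re c' < \<delta>" "\<And>z. \<delta> \<le> Re z \<Longrightarrow> cmod (g z / (\<mu> - z)) \<le> B' / (cmod (z - c'))\<^sup>2"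
    using el by (auto simp: elementary_def)
  have "((\<lambda>r. g (Complex \<delta> r) / (\<mu> - Complex \<delta> r)) has_integral 0) UNIV"
    by (rule cauchy_halfplane_0[OF _ _ c'(1,2)]) (use el in \<open>auto simp: elementary_def\<close>)
  from has_integral_linear[OF this bounded_bilinear.bounded_linear_left[OF bounded_bilinear_scaleC, of "L \<mu> x"]]
  have "((\<lambda>r. (g (Complex \<delta> r) / (\<mu> - Complex \<delta> r)) *\<^sub>C L \<mu> x) has_integral 0) UNIV"
    by (simp add: o_def)
  from integrable_integral[OF E_integrable[OF assms(2) qd, of x], THEN has_integral_diff, OF this, unfolded diff_zero]
  have "((\<lambda>r. g (Complex \<delta> r) *\<^sub>C L (Complex \<delta> r) (L \<mu> x)) has_integral
    integral UNIV (\<lambda>r. (g (Complex \<delta> r) / (\<mu> - Complex \<delta> r)) *\<^sub>C L (Complex \<delta> r) x)) UNIV"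
  proof (rule has_integral_eq[rotated])
    fix r :: real
    show "(g (Complex \<delta> r) / (\<mu> - Complex \<delta> r)) *\<^sub>C L (Complex \<delta> r) x - (g (Complex \<delta> r) / (\<mu> - Complex \<delta> r)) *\<^sub>C L \<mu> x
      = g (Complex \<delta> r) *\<^sub>C L (Complex \<delta> r) (L \<mu> x)"
      using assms by (subst L_product) (auto simp: scaleC_diff_right scaleC_scaleC)
  qed
  then show ?thesis
    unfolding E_def by (simp add: integral_unique)
qed

lemma E_shift_less:
  assumes g: "elementary \<omega> \<delta>1 g" and "\<delta>1 < \<delta>2" "\<delta>2 < 0"
  shows "E \<delta>1 g x = E \<delta>2 g x"
proof (rule cinner_eqI)
  fix y
  obtain B c where *: "\<omega> < \<delta>1" "g holomorphic_on half_plane \<omega>" "Re c < \<delta>1"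
    "\<And>z. \<delta>1 \<le> Re z \<Longrightarrow> cmod (g z) \<le> B / (cmod (z - c))\<^sup>2"
    using g by (auto simp: elementary_def)
  obtain K where K: "K > 0" "\<And>z x. Re z \<le> \<delta>2 \<Longrightarrow> norm (L z x) \<le> K * norm x"
    using boundE[OF assms(3)] by metis
  have "integral UNIV (\<lambda>r. g (Complex \<delta>1 r) * cinner (L (Complex \<delta>1 r) x) y) =
      integral UNIV (\<lambda>r. g (Complex \<delta>2 r) * cinner (L (Complex \<delta>2 r) x) y)"
  proof (rule cauchy_strip[where S = "{z. \<omega> < Re z \<and> Re z < 0}", OF _ _ assms(2) *(3)])
    show "(\<lambda>z. g z * cinner (L z x) y) holomorphic_on {z. \<omega> < Re z \<and> Re z < 0}"
      by (intro holomorphic_on_mult holomorphic_cinner_L holomorphic_on_subset[OF *(2)]) (auto simp: half_plane_def)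
    show "cmod (g z * cinner (L z x) y) \<le> (B * (K * norm x * norm y)) / (cmod (z - c))\<^sup>2"
      if "\<delta>1 \<le> Re z" "Re z \<le> \<delta>2" for z
    proof -
      have "cmod (cinner (L z x) y) \<le> K * norm x * norm y"
        using cauchy_schwarz[of "L z x" y] K(2)[OF that(2), of x] by (meson mult_right_mono norm_ge_zero order_trans)
      then have "cmod (g z) * cmod (cinner (L z x) y) \<le> B / (cmod (z - c))\<^sup>2 * (K * norm x * norm y)"
        using *(4)[OF that(1)] order_trans[OF norm_ge_zero *(4)[OF that(1)]] by (intro mult_mono) auto
      then show ?thesis by (simp add: norm_mult)
    qed
  qed (use * assms in auto)
  then show "cinner (E \<delta>1 g x) y = cinner (E \<delta>2 g x) y"
    using assms elementary_quad_decay[OF g] elementary_quad_decay[OF elementary_mono[OF g, of \<delta>2]]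
    by (simp add: E_cinner)
qed

lemma E_shift:
  assumes "elementary \<omega> \<delta>1 g" "\<delta>1 \<le> \<delta>2" "\<delta>2 < 0"
  shows "E \<delta>1 g x = E \<delta>2 g x"
  using assms E_shift_less by (cases "\<delta>1 = \<delta>2") auto

text \<open>\<open>\<phi>\<close> is merely bounded on left half-planes, so the residue formula is
  not applied to it directly. Writing \<open>\<phi> z = \<phi> \<mu> + (z - \<mu>) \<psi> z\<close>,
  the constant part integrates to zero by closing to the right; \<open>\<psi>\<close> decays like
  \<open>1 / |z|\<close>, and closing to the left yields \<open>2 pi \<psi> \<mu>\<close>.\<close>

lemma E_inverse_square:
  assumes "\<delta> < 0" "Re \<mu> < \<delta>"
  shows "E \<delta> (\<lambda>z. 1 / (z - \<mu>)\<^sup>2) x = L \<mu> (L \<mu> x)"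
proof (rule cinner_eqI)
  fix y
  define \<phi> where "\<phi> z = cinner (L z x) y" for z
  define \<psi> where "\<psi> z = - cinner (L z (L \<mu> x)) y" for z
  obtain K where K: "K > 0" "\<And>z x. Re z \<le> \<delta> \<Longrightarrow> norm (L z x) \<le> K * norm x"
    using boundE[OF assms(1)] by metis
  have ip: "cmod (cinner (L z u) y) \<le> K * norm u * norm y" if "Re z \<le> \<delta>" for z u
    using cauchy_schwarz[of "L z u" y] K(2)[OF that, of u] by (meson mult_right_mono norm_ge_zero order_trans)
  have split: "\<phi> z - \<phi> \<mu> = (z - \<mu>) * \<psi> z" if "Re z < 0" for z
    using arg_cong[OF resolvent_identity[OF that, of \<mu> x], of "\<lambda>u. cinner u y"] assms
    by (simp add: \<phi>_def \<psi>_def cinner_diff_left cinner_scaleC_left algebra_simps)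
  have el: "elementary (Re \<mu>) \<delta> (\<lambda>z. 1 / (z - \<mu>)\<^sup>2)"
    using elementary_inverse_square[of \<mu> "Re \<mu>" \<delta>] assms by simp
  have "((\<lambda>r. 1 / (Complex \<delta> r - \<mu>)\<^sup>2) has_integral 0) UNIV"
    by (rule cauchy_halfplane_0[where B = 1 and c = \<mu>]) (use el assms in \<open>auto simp: elementary_def norm_divide norm_power\<close>)
  then have 1: "((\<lambda>r. \<phi> \<mu> * (1 / (Complex \<delta> r - \<mu>)\<^sup>2)) has_integral \<phi> \<mu> * 0) UNIV"
    by (rule has_integral_mult_right)
  \<comment> \<open>\<open>P\<close> bounds \<open>(1 + |z - \<mu>|) |\<psi> z|\<close>: the first
    summand comes from the definition of \<open>\<psi>\<close>, the second from the two terms of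
    \<open>\<phi> z - \<phi> \<mu>\<close>. The bound then gives the decay of
    \<open>\<psi>\<close>.\<close>
  define P where "P = K * norm (L \<mu> x) * norm y + 2 * (K * norm x * norm y)"
  have 2: "((\<lambda>r. \<psi> (Complex \<delta> r) / (Complex \<delta> r - \<mu>)) has_integral 2 * pi * \<psi> \<mu>) UNIV"
  proof (rule cauchy_left_halfplane[where c = 0 and B = "P * (1 + cmod \<mu>)"])
    show "\<psi> holomorphic_on {z. Re z < 0}"
      unfolding \<psi>_def by (intro holomorphic_on_minus holomorphic_cinner_L) auto
    show "cmod (\<psi> z) \<le> P * (1 + cmod \<mu>) / cmod (z - 0)" if z: "Re z \<le> \<delta>" for z
    proof -
      have "cmod (\<psi> z) \<le> K * norm (L \<mu> x) * norm y"
        unfolding \<psi>_def using ip[OF z] by simp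
      moreover have "cmod (z - \<mu>) * cmod (\<psi> z) \<le> 2 * (K * norm x * norm y)"
      proof -
        have "cmod (z - \<mu>) * cmod (\<psi> z) = cmod (\<phi> z - \<phi> \<mu>)"
          using split[of z] z assms by (simp add: norm_mult)
        also have "\<dots> \<le> cmod (\<phi> z) + cmod (\<phi> \<mu>)"
          by (rule norm_triangle_ineq4)
        also have "\<dots> \<le> 2 * (K * norm x * norm y)"
          using ip[OF z, of x] ip[of \<mu> x] assms by (simp add: \<phi>_def)
        finally show ?thesis .
      qed
      ultimately have 3: "(1 + cmod (z - \<mu>)) * cmod (\<psi> z) \<le> P"
        by (simp add: P_def ring_distribs)
      have "cmod z \<le> cmod (z - \<mu>) + cmod \<mu>"
        using norm_triangle_ineq[of "z - \<mu>" \<mu>] by simp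
      also have "\<dots> \<le> (1 + cmod (z - \<mu>)) * (1 + cmod \<mu>)"
        by (simp add: ring_distribs)
      finally have "cmod z * cmod (\<psi> z) \<le> ((1 + cmod (z - \<mu>)) * (1 + cmod \<mu>)) * cmod (\<psi> z)"
        by (intro mult_right_mono) auto
      also have "\<dots> = ((1 + cmod (z - \<mu>)) * cmod (\<psi> z)) * (1 + cmod \<mu>)"
        by (simp add: ac_simps)
      also have "\<dots> \<le> P * (1 + cmod \<mu>)"
        using 3 by (intro mult_right_mono) auto
      finally have "cmod z * cmod (\<psi> z) \<le> P * (1 + cmod \<mu>)" .
      moreover have "z \<noteq> 0" using z assms by auto
      ultimately show ?thesis
        by (simp add: field_simps)
    qed
  qed (use assms in auto)
  have "((\<lambda>r. 1 / (Complex \<delta> r - \<mu>)\<^sup>2 * cinner (L (Complex \<delta> r) x) y) has_integral (\<phi> \<mu> * 0 + 2 * pi * \<psi> \<mu>)) UNIV"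
  proof (rule has_integral_eq[OF _ has_integral_add[OF 1 2]])
    fix r :: real
    let ?z = "Complex \<delta> r"
    have "\<phi> ?z = \<phi> \<mu> + (?z - \<mu>) * \<psi> ?z"
      using split[of ?z] assms by (simp add: algebra_simps)
    moreover have "?z - \<mu> \<noteq> 0" using assms by auto
    ultimately show "\<phi> \<mu> * (1 / (?z - \<mu>)\<^sup>2) + \<psi> ?z / (?z - \<mu>) = 1 / (?z - \<mu>)\<^sup>2 * cinner (L ?z x) y"
      unfolding \<phi>_def[of ?z, symmetric] by (simp add: add_divide_distrib power2_eq_square)
  qed
  then have "integral UNIV (\<lambda>r. 1 / (Complex \<delta> r - \<mu>)\<^sup>2 * cinner (L (Complex \<delta> r) x) y) = 2 * pi * \<psi> \<mu>"
    by (simp add: integral_unique)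
  then show "cinner (E \<delta> (\<lambda>z. 1 / (z - \<mu>)\<^sup>2) x) y = cinner (L \<mu> (L \<mu> x)) y"
    using assms elementary_quad_decay[OF el]
    by (simp add: E_cinner \<psi>_def scaleR_conv_of_real)
qed

end

section \<open>Operators of half-plane type\<close>

lemma bounded_operatorE:
  assumes "bounded_operator B"
  obtains "bounded_clinear (op_fun B)" "B = {(x, op_fun B x) |x. True}"
proof -
  obtain T where T: "bounded_clinear T" "B = {(x, T x) |x. True}"
    using assms by (auto simp: bounded_operator_def)
  have "op_fun B = T"
    by (auto simp: op_fun_def T(2))
  then show thesis using T that by simp
qed

lemma op_fun_graph: "op_fun {(x, S x) |x. True} = S"
  by (auto simp: op_fun_def)

lemma norm_le_op_norm:
  assumes "bounded_operator B"
  shows "norm (op_fun B x) \<le> op_norm B * norm x"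
proof -
  have "bounded_clinear (op_fun B)"
    using assms by (rule bounded_operatorE)
  then show ?thesis
    unfolding op_norm_def by (intro onorm) (rule bounded_clinearD)
qed

lemma dense_le:
  fixes f g :: "'b::topological_space \<Rightarrow> real"
  assumes D: "closure (range D) = UNIV" and "continuous_on UNIV f" "continuous_on UNIV g" and le: "\<And>x. f (D x) \<le> g (D x)"
  shows "f x \<le> g x"
proof -
  have "closure (range D) \<subseteq> {x. f x \<le> g x}"
    using le by (intro closure_minimal closed_Collect_le assms) auto
  then show ?thesis
    using D by auto
qed

lemma dense_range_comp:
  assumes "continuous_on UNIV f" "closure (range f) = UNIV" "closure (range g) = UNIV"
  shows "closure (range (\<lambda>x. f (g x))) = UNIV"
proof -
  have "f ` closure (range g) \<subseteq> closure (range (\<lambda>x. f (g x)))"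
    by (rule image_closure_subset)
       (auto intro: continuous_on_subset[OF assms(1)] closure_subset[THEN subsetD])
  then have "closure (range f) \<subseteq> closure (range (\<lambda>x. f (g x)))"
    using assms(3) by (intro closure_minimal) auto
  then show ?thesis
    using assms(2) by auto
qed

text \<open>The \<open>e / 3\<close> argument behind the Banach-Steinhaus theorem, with the dense
  set given as a range since in its uses it is the range of a resolvent or of a product of
  resolvents.\<close>

lemma dense_tendsto:
  fixes S :: "'c \<Rightarrow> 'a::real_normed_vector \<Rightarrow> 'b::real_normed_vector"
  assumes D: "closure (range D) = UNIV" and lip: "\<forall>\<^sub>F t in F. \<forall>x y. norm (S t x - S t y) \<le> M * norm (x - y)"
    and lip': "\<And>x y. norm (G x - G y) \<le> M * norm (x - y)"
    and conv: "\<And>x. ((\<lambda>t. S t (D x)) \<longlongrightarrow> G (D x)) F"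
  shows "((\<lambda>t. S t x) \<longlongrightarrow> G x) F"
proof (rule tendstoI)
  fix e :: real
  assume e: "e > 0"
  define M' where "M' = max M 1"
  have M': "M' > 0" "M \<le> M'" by (auto simp: M'_def)
  obtain u where u: "norm (D u - x) < e / (3 * M')"
    using D closure_approachable[of x "range D"] e M' by (auto simp: dist_norm dest!: spec[of _ "e / (3 * M')"])
  then have u': "M * norm (x - D u) < e / 3"
    using M' e mult_right_mono[OF M'(2) norm_ge_zero[of "D u - x"]]
    by (simp add: field_simps norm_minus_commute)
  have "\<forall>\<^sub>F t in F. dist (S t (D u)) (G (D u)) < e / 3"
    using conv e by (intro tendstoD) auto
  then show "\<forall>\<^sub>F t in F. dist (S t x) (G x) < e"
    using lip
  proof eventually_elim
    case (elim t)
    have "norm (S t x - S t (D u)) < e / 3" "norm (G (D u) - G x) < e / 3"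
      using elim(2) lip' u' by (metis order_le_less_trans norm_minus_commute)+
    moreover have "S t x - G x = (S t x - S t (D u)) + (S t (D u) - G (D u)) + (G (D u) - G x)"
      by simp
    ultimately show ?case
      using elim(1) norm_triangle_ineq[of "(S t x - S t (D u)) + (S t (D u) - G (D u))" "G (D u) - G x"]
        norm_triangle_ineq[of "S t x - S t (D u)" "S t (D u) - G (D u)"]
      by (simp add: dist_norm)
  qed
qed

locale half_plane_operator =
  fixes A :: "'a::complex_hilbert_space operator"
  assumes linear: "linear_operator A" and dense: "densely_defined A" and type0: "half_plane_type_0 A"
begin

text \<open>A total function for convenience; it is known to represent the resolvent when
  \<open>Re z < 0\<close>, and the facts about it carry that hypothesis.\<close>

definition R :: "complex \<Rightarrow> 'a \<Rightarrow> 'a" where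
  "R z = op_fun (resolvent z A)"

lemma mem_resolvent: "(u, v) \<in> resolvent z A \<longleftrightarrow> (v, z *\<^sub>C v - u) \<in> A"
  by (force simp: resolvent_def scalar_minus_op_def)

lemma bounded_resolvent: "Re z < 0 \<Longrightarrow> bounded_operator (resolvent z A)"
proof (rule ccontr)
  assume "Re z < 0" "\<not> bounded_operator (resolvent z A)"
  then have "z \<in> closure (half_plane 0)"
    using type0 by (auto simp: half_plane_type_0_def spectrum_def)
  moreover have "closure (half_plane 0) \<subseteq> {z. Re z \<ge> 0}"
    by (intro closure_minimal) (auto simp: half_plane_def closed_halfspace_Re_ge)
  ultimately show False
    using \<open>Re z < 0\<close> by auto
qed

lemma mem_resolvent_iff:
  assumes "Re z < 0"
  shows "(u, v) \<in> resolvent z A \<longleftrightarrow> v = R z u"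
proof -
  have "resolvent z A = {(x, R z x) |x. True}"
    unfolding R_def by (rule bounded_operatorE[OF bounded_resolvent[OF assms]])
  then show ?thesis by auto
qed

lemma mem_iff: "Re z < 0 \<Longrightarrow> (x, y) \<in> A \<longleftrightarrow> x = R z (z *\<^sub>C x - y)"
  using mem_resolvent[of "z *\<^sub>C x - y" x z] mem_resolvent_iff by simp

lemma R_mem: "Re z < 0 \<Longrightarrow> (R z u, z *\<^sub>C R z u - u) \<in> A"
  using mem_resolvent mem_resolvent_iff by blast

sublocale R: resolvent_family R
proof
  show "bounded_clinear (R z)" if "Re z < 0" for z
    unfolding R_def by (rule bounded_operatorE[OF bounded_resolvent[OF that]])
  show "\<exists>K. \<forall>z x. Re z \<le> \<delta> \<longrightarrow> norm (R z x) \<le> K * norm x" if \<delta>: "\<delta> < 0" for \<delta>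
  proof -
    have "bdd_above ((\<lambda>z. op_norm (resolvent z A)) ` (- half_plane \<delta>))"
      using type0 \<delta> by (simp add: half_plane_type_0_def)
    then obtain K where K: "\<And>z. Re z \<le> \<delta> \<Longrightarrow> op_norm (resolvent z A) \<le> K"
      by (force simp: bdd_above_def half_plane_def not_less)
    have "norm (R z x) \<le> K * norm x" if "Re z \<le> \<delta>" for z x
      using norm_le_op_norm[OF bounded_resolvent, of z x] K[OF that] that \<delta>
      unfolding R_def by (meson le_less_trans mult_right_mono norm_ge_zero order_trans)
    then show ?thesis by blast
  qed
  show "R z x - R w x = (w - z) *\<^sub>C R z (R w x)" if z: "Re z < 0" and w: "Re w < 0" for z w x
  proof -
    have lin: "bounded_clinear (R z)"
      unfolding R_def by (rule bounded_operatorE[OF bounded_resolvent[OF z]])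
    have "R w x = R z (z *\<^sub>C R w x - (w *\<^sub>C R w x - x))"
      using R_mem[OF w, of x] mem_iff[OF z] by blast
    also have "z *\<^sub>C R w x - (w *\<^sub>C R w x - x) = (z - w) *\<^sub>C R w x + x"
      by (simp add: scaleC_diff_left)
    also have "R z \<dots> = (z - w) *\<^sub>C R z (R w x) + R z x"
      using bounded_clinearD[OF lin] by (simp add: linear_add bounded_linear.linear)
    finally show ?thesis
      by (simp add: scaleC_diff_left algebra_simps)
  qed
qed

lemma elementary_calculus_eq: "elementary_calculus A = R.E"
  unfolding elementary_calculus_def R.E_def by (intro ext) (simp add: R_def)

lemma R_inject: "Re z < 0 \<Longrightarrow> R z x = R z y \<Longrightarrow> x = y"
  using R_mem[of z x] R_mem[of z y] linear by (auto simp: linear_operator_def dest: single_valuedD)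

lemma range_R: "Re z < 0 \<Longrightarrow> range (R z) = Domain A"
  using R_mem[of z] mem_iff[of z, THEN iffD1] by (blast intro: range_eqI)

lemma closure_range_R: "Re z < 0 \<Longrightarrow> closure (range (R z)) = UNIV"
  using dense by (simp add: range_R densely_defined_def)

section \<open>Independence of the calculus from its parameters\<close>

lemma E_resolvent_square:
  assumes "elementary \<omega> \<delta> g" "Re \<mu> \<le> \<omega>" "\<delta> < 0"
  shows "R \<mu> (R \<mu> (R.E \<delta> g x)) = R.E \<delta> (\<lambda>z. g z / (z - \<mu>)\<^sup>2) x"
proof -
  have \<mu>: "Re \<mu> < \<delta>" "Re \<mu> < 0" using assms by (auto simp: elementary_def)
  have comm: "R \<mu> (R.E \<delta> g x) = R.E \<delta> g (R \<mu> x)" for x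
    by (rule R.E_commute) (use assms \<mu> elementary_quad_decay in \<open>auto intro: R.bcl R.commute\<close>)
  have "R \<mu> (R \<mu> (R.E \<delta> g x)) = R.E \<delta> g (R \<mu> (R \<mu> x))"
    by (simp add: comm)
  also have "\<dots> = R.E \<delta> (\<lambda>z. g z / (\<mu> - z) / (\<mu> - z)) x"
    using assms \<mu> elementary_divide[OF assms(1,2)] by (simp add: R.E_resolvent)
  also have "\<dots> = R.E \<delta> (\<lambda>z. g z / (z - \<mu>)\<^sup>2) x"
    by (intro R.E_cong) (simp add: power2_commute[of _ \<mu>] power2_eq_square[of "\<mu> - _"])
  finally show ?thesis .
qed

text \<open>Both sides equal the elementary calculus of \<open>f\<close> divided by both squares, on
  the line at \<open>\<delta>2\<close>. The order of \<open>\<omega>1\<close> and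
  \<open>\<omega>2\<close> matters only for the shift: with \<open>\<omega>1\<close> the smaller
  one, the line at \<open>min \<delta>1 \<delta>2\<close> is admissible for the first
  symbol.\<close>

lemma calculus_independent_aux:
  assumes f: "f \<in> Hinf \<omega>1" "f \<in> Hinf \<omega>2" and le: "\<omega>1 \<le> \<omega>2"
    and "\<omega>1 < \<delta>1" "\<delta>1 < 0" "Re \<mu>1 < \<omega>1" "\<omega>2 < \<delta>2" "\<delta>2 < 0" "Re \<mu>2 < \<omega>2"
  shows "R \<mu>2 (R \<mu>2 (R.E \<delta>1 (\<lambda>z. f z / (z - \<mu>1)\<^sup>2) x)) = R \<mu>1 (R \<mu>1 (R.E \<delta>2 (\<lambda>z. f z / (z - \<mu>2)\<^sup>2) x))"
proof -
  let ?g1 = "\<lambda>z. f z / (z - \<mu>1)\<^sup>2" and ?g2 = "\<lambda>z. f z / (z - \<mu>2)\<^sup>2"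
  have "elementary \<omega>1 (min \<delta>1 \<delta>2) ?g1"
    using assms by (intro elementary_Hinf) auto
  then have "R.E (min \<delta>1 \<delta>2) ?g1 x = R.E \<delta>1 ?g1 x" "R.E (min \<delta>1 \<delta>2) ?g1 x = R.E \<delta>2 ?g1 x"
    using assms by (auto intro!: R.E_shift)
  then have shift: "R.E \<delta>1 ?g1 x = R.E \<delta>2 ?g1 x"
    by simp
  have el: "elementary \<omega>2 \<delta>2 ?g1" "elementary \<omega>2 \<delta>2 ?g2"
    using assms by (auto intro: elementary_Hinf)
  have "R \<mu>2 (R \<mu>2 (R.E \<delta>2 ?g1 x)) = R.E \<delta>2 (\<lambda>z. ?g1 z / (z - \<mu>2)\<^sup>2) x"
    by (rule E_resolvent_square[OF el(1)]) (use assms in auto)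
  also have "\<dots> = R.E \<delta>2 (\<lambda>z. ?g2 z / (z - \<mu>1)\<^sup>2) x"
    by (simp add: mult.commute)
  also have "\<dots> = R \<mu>1 (R \<mu>1 (R.E \<delta>2 ?g2 x))"
    by (rule E_resolvent_square[OF el(2), symmetric]) (use assms in auto)
  finally show ?thesis
    by (simp add: shift)
qed

text \<open>The identity of the auxiliary lemma becomes an identity between the two candidates once
  the injective factor \<open>R \<mu>1 (R \<mu>1 _)\<close> is cancelled. It makes the graphs united
  in the definition of the calculus coincide.\<close>

lemma calculus_independent:
  assumes "f \<in> Hinf \<omega>1" "f \<in> Hinf \<omega>2"
    and "\<omega>1 < \<delta>1" "\<delta>1 < 0" "Re \<mu>1 < \<omega>1" "\<omega>2 < \<delta>2" "\<delta>2 < 0" "Re \<mu>2 < \<omega>2"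
    and y: "R.E \<delta>1 (\<lambda>z. f z / (z - \<mu>1)\<^sup>2) x = R \<mu>1 (R \<mu>1 y)"
  shows "R.E \<delta>2 (\<lambda>z. f z / (z - \<mu>2)\<^sup>2) x = R \<mu>2 (R \<mu>2 y)"
proof -
  have "R \<mu>2 (R \<mu>2 (R.E \<delta>1 (\<lambda>z. f z / (z - \<mu>1)\<^sup>2) x)) = R \<mu>1 (R \<mu>1 (R.E \<delta>2 (\<lambda>z. f z / (z - \<mu>2)\<^sup>2) x))"
  proof (cases "\<omega>1 \<le> \<omega>2")
    case True
    then show ?thesis using assms by (intro calculus_independent_aux)
  next
    case False
    then have "\<omega>2 \<le> \<omega>1" by simp
    then show ?thesis
      using calculus_independent_aux[OF assms(2,1) _ assms(6,7,8,3,4,5)] by simp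
  qed
  moreover have "R \<mu>2 (R \<mu>2 (R \<mu>1 (R \<mu>1 y))) = R \<mu>1 (R \<mu>1 (R \<mu>2 (R \<mu>2 y)))"
    using assms by (simp add: R.commute[of \<mu>2 \<mu>1])
  ultimately show ?thesis
    using assms(3,4,5) unfolding y by (auto dest!: R_inject[rotated])
qed

lemma mem_op_minus_scalar:
  assumes "Re \<mu> < 0"
  shows "(u, v) \<in> op_minus_scalar A \<mu> \<longleftrightarrow> u = - R \<mu> v"
proof -
  have "(u, v) \<in> op_minus_scalar A \<mu> \<longleftrightarrow> (u, v + \<mu> *\<^sub>C u) \<in> A"
    by (force simp: op_minus_scalar_def)
  also have "\<dots> \<longleftrightarrow> u = R \<mu> (- v)"
    using assms by (simp add: mem_iff[of \<mu>])
  finally show ?thesis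
    by (simp add: linear_neg[OF bounded_linear.linear[OF R.blin[OF assms]]])
qed

lemma mem_calculus:
  "(x, y) \<in> half_plane_calculus A f \<longleftrightarrow> (\<exists>\<omega> \<delta> \<mu>. \<omega> < \<delta> \<and> \<delta> < 0 \<and> Re \<mu> < \<omega> \<and> f \<in> Hinf \<omega> \<and>
     R.E \<delta> (\<lambda>z. f z / (z - \<mu>)\<^sup>2) x = R \<mu> (R \<mu> y))"
proof -
  have *: "(u, y) \<in> op_minus_scalar A \<mu> O op_minus_scalar A \<mu> \<longleftrightarrow> u = R \<mu> (R \<mu> y)" if "Re \<mu> < 0" for u \<mu>
    using that
    by (auto simp: mem_op_minus_scalar relcomp_unfold linear_neg[OF bounded_linear.linear[OF R.blin]])
  show ?thesis
    unfolding half_plane_calculus_def elementary_calculus_eq mem_Collect_eq prod.case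
    by (intro ex_cong1 conj_cong refl *) simp
qed

text \<open>To identify the calculus, one admissible choice of parameters is enough. The two signs
  of \<open>A - \<mu> = - (\<mu> - A)\<close> cancel in the square, so the resolvents appear without
  sign.\<close>

lemma calculus_eq_graph:
  assumes "f \<in> Hinf \<omega>" "\<omega> < \<delta>" "\<delta> < 0" "Re \<mu> < \<omega>"
    and "\<And>x. R.E \<delta> (\<lambda>z. f z / (z - \<mu>)\<^sup>2) x = R \<mu> (R \<mu> (S x))"
  shows "half_plane_calculus A f = {(x, S x) |x. True}"
proof -
  have "(x, y) \<in> half_plane_calculus A f \<longleftrightarrow> y = S x" for x y
  proof
    assume "(x, y) \<in> half_plane_calculus A f"
    then obtain \<omega>' \<delta>' \<mu>' where "\<omega>' < \<delta>'" "\<delta>' < 0" "Re \<mu>' < \<omega>'" "f \<in> Hinf \<omega>'"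
      "R.E \<delta>' (\<lambda>z. f z / (z - \<mu>')\<^sup>2) x = R \<mu>' (R \<mu>' y)"
      unfolding mem_calculus by blast
    then have "R \<mu> (R \<mu> (S x)) = R \<mu> (R \<mu> y)"
      using calculus_independent[of f \<omega>' \<omega> \<delta>' \<mu>' \<delta> \<mu>] assms by simp
    moreover have "Re \<mu> < 0" using assms by simp
    ultimately show "y = S x"
      by (auto dest!: R_inject[rotated])
  next
    assume "y = S x"
    then show "(x, y) \<in> half_plane_calculus A f"
      unfolding mem_calculus using assms by blast
  qed
  then show ?thesis by auto
qed

text \<open>Membership in the calculus only provides some unknown parameters; independence transfers
  the equation to prescribed ones.\<close>

lemma bounded_calculusE:
  assumes f: "f \<in> Hinf \<omega>" "\<omega> < \<delta>" "\<delta> < 0" "Re \<mu> < \<omega>" and bdd: "bounded_operator (half_plane_calculus A f)"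
  obtains y where "R.E \<delta> (\<lambda>z. f z / (z - \<mu>)\<^sup>2) x = R \<mu> (R \<mu> y)" "norm y \<le> op_norm (half_plane_calculus A f) * norm x"
proof -
  define y where "y = op_fun (half_plane_calculus A f) x"
  have "half_plane_calculus A f = {(x, op_fun (half_plane_calculus A f) x) |x. True}"
    by (rule bounded_operatorE[OF bdd])
  then have "(x, y) \<in> half_plane_calculus A f"
    unfolding y_def by blast
  then obtain \<omega>' \<delta>' \<mu>' where *: "\<omega>' < \<delta>'" "\<delta>' < 0" "Re \<mu>' < \<omega>'" "f \<in> Hinf \<omega>'"
    "R.E \<delta>' (\<lambda>z. f z / (z - \<mu>')\<^sup>2) x = R \<mu>' (R \<mu>' y)"
    unfolding mem_calculus by blast
  have "R.E \<delta> (\<lambda>z. f z / (z - \<mu>)\<^sup>2) x = R \<mu> (R \<mu> y)"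
    by (rule calculus_independent[OF *(4) f(1) *(1,2,3) f(2,3,4) *(5)])
  then show thesis
    using that norm_le_op_norm[OF bdd, of x] by (simp add: y_def)
qed

end

section \<open>From the functional calculus to the semigroup\<close>

lemma vector_derivative_bound:
  fixes f :: "real \<Rightarrow> 'b::real_normed_vector"
  assumes "convex S" "\<And>t. t \<in> S \<Longrightarrow> (f has_vector_derivative f' t) (at t within S)"
    and "\<And>t. t \<in> S \<Longrightarrow> norm (f' t) \<le> B" "x \<in> S" "y \<in> S"
  shows "norm (f x - f y) \<le> B * \<bar>x - y\<bar>"
proof -
  have "norm (f x - f y) \<le> B * norm (x - y)"
  proof (rule differentiable_bound[where f' = "\<lambda>t h. h *\<^sub>R f' t", OF assms(1)])
    show "onorm (\<lambda>h. h *\<^sub>R f' t) \<le> B" if "t \<in> S" for t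
    proof (rule onorm_le)
      show "norm (h *\<^sub>R f' t) \<le> B * norm h" for h
        using mult_left_mono[OF assms(3)[OF that], of "\<bar>h\<bar>"] by (simp add: mult.commute)
    qed
  qed (use assms in \<open>auto simp: has_vector_derivative_def\<close>)
  then show ?thesis by simp
qed

lemma quadratic_has_vector_derivative:
  fixes f :: "real \<Rightarrow> 'b::real_normed_vector"
  assumes "\<And>s. s \<in> S \<Longrightarrow> norm (f s - f t - (s - t) *\<^sub>R d) \<le> C * (s - t)\<^sup>2"
  shows "(f has_vector_derivative d) (at t within S)"
  unfolding has_vector_derivative_def has_derivative_iff_norm
proof
  show "bounded_linear (\<lambda>h. h *\<^sub>R d)"
    by (rule bounded_linear_scaleR_left)
  have ev: "\<forall>\<^sub>F s in at t within S. norm (norm (f s - f t - (s - t) *\<^sub>R d) / norm (s - t)) \<le> C * \<bar>s - t\<bar>"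
    unfolding eventually_at_filter
  proof (intro always_eventually allI impI)
    fix s assume "s \<noteq> t" "s \<in> S"
    then have "norm (f s - f t - (s - t) *\<^sub>R d) / \<bar>s - t\<bar> \<le> C * (s - t)\<^sup>2 / \<bar>s - t\<bar>"
      using assms by (intro divide_right_mono) auto
    also have "\<dots> = C * \<bar>s - t\<bar>"
      using \<open>s \<noteq> t\<close> by (simp add: nonzero_divide_eq_eq power2_eq_square mult.assoc)
    finally show "norm (norm (f s - f t - (s - t) *\<^sub>R d) / norm (s - t)) \<le> C * \<bar>s - t\<bar>"
      by simp
  qed
  have "((\<lambda>s. C * \<bar>s - t\<bar>) \<longlongrightarrow> C * \<bar>t - t\<bar>) (at t within S)"
    by (intro tendsto_intros)
  then show "((\<lambda>s. norm (f s - f t - (s - t) *\<^sub>R d) / norm (s - t)) \<longlongrightarrow> 0) (at t within S)"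
    by (intro Lim_null_comparison[OF ev]) simp
qed

lemma exp_minus_lipschitz:
  fixes p q :: complex
  assumes "Re p \<ge> 0" "Re q \<ge> 0"
  shows "cmod (exp (- p) - exp (- q)) \<le> cmod (p - q)"
proof -
  have "cmod (exp (- p) - exp (- q)) \<le> 1 * cmod (p - q)"
    by (rule field_differentiable_bound[where S = "{z. Re z \<ge> 0}" and f' = "\<lambda>z. - exp (- z)"])
       (use assms in \<open>auto intro!: derivative_eq_intros convex_halfspace_Re_ge\<close>)
  then show ?thesis by simp
qed

text \<open>The mean value inequality is applied to the remainder itself on the segment, where its
  derivative is a difference of exponentials and hence Lipschitz. The constant \<open>1\<close>
  instead of \<open>1/2\<close> is sufficient.\<close>

lemma exp_minus_taylor:
  fixes p q :: complex
  assumes "Re p \<ge> 0" "Re q \<ge> 0"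
  shows "cmod (exp (- p) - exp (- q) + (p - q) * exp (- q)) \<le> (cmod (p - q))\<^sup>2"
proof -
  let ?f = "\<lambda>z. exp (- z) + z * exp (- q)"
  have "cmod (?f p - ?f q) \<le> cmod (p - q) * cmod (p - q)"
  proof (rule field_differentiable_bound[where S = "closed_segment q p" and f' = "\<lambda>z. - exp (- z) + exp (- q)"])
    show "cmod (- exp (- z) + exp (- q)) \<le> cmod (p - q)" if "z \<in> closed_segment q p" for z
    proof -
      have "closed_segment q p \<subseteq> {z. Re z \<ge> 0}"
        using assms by (intro closed_segment_subset convex_halfspace_Re_ge) auto
      then have "cmod (exp (- q) - exp (- z)) \<le> cmod (q - z)"
        using that assms by (intro exp_minus_lipschitz) auto
      also have "\<dots> \<le> cmod (p - q)"
        using segment_bound1[OF that] by (simp add: norm_minus_commute)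
      finally show ?thesis by simp
    qed
  qed (auto intro!: derivative_eq_intros)
  then show ?thesis
    by (simp add: algebra_simps power2_eq_square)
qed

text \<open>The vector \<open>y\<close> plays the role of \<open>exp (- t A) x\<close>, written with
  the fixed line \<open>- 1\<close> and the fixed point \<open>- 2\<close>. The essential content is
  the bound uniform in \<open>t\<close>.\<close>

locale half_plane_exponentials = half_plane_operator +
  fixes M :: real
  assumes exponential: "t > 0 \<Longrightarrow> \<exists>y. R.E (- 1) (\<lambda>z. exp (- (of_real t * z)) / (z - (- 2))\<^sup>2) x = R (- 2) (R (- 2) y)
      \<and> norm y \<le> M * norm x"
begin

text \<open>
  Here \<open>J = (A + 2)\<^sup>-\<^sup>1\<close>, \<open>U s = exp (- s (A + 2))\<close> and \<open>V k s = U s J\<^sup>k\<^sup>+\<^sup>2\<close>. The shift by \<open>2\<close> bounds the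
  exponentials by \<open>1\<close> on the line \<open>Re z = - 1\<close>.
\<close>

definition J :: "'a \<Rightarrow> 'a" where
  "J x = - R (- 2) x"

definition e :: "nat \<Rightarrow> real \<Rightarrow> complex \<Rightarrow> complex" where
  "e k s z = (exp (- (of_real s * (z + 2))) / (z + 2) ^ k) * (1 / (z - (- 2))\<^sup>2)"

definition V :: "nat \<Rightarrow> real \<Rightarrow> 'a \<Rightarrow> 'a" where
  "V k s = R.E (- 1) (e k s)"

lemma J_clinear: "bounded_clinear J"
proof -
  have "bounded_clinear (R (- 2))" by (rule R.bcl) simp
  then show ?thesis
    by (auto simp: bounded_clinear_def J_def[abs_def] intro: bounded_linear_minus)
qed

lemmas J_linear = bounded_linear.linear[OF bounded_clinearD(1)[OF J_clinear]]
lemmas J_simps = linear_add[OF J_linear] linear_diff[OF J_linear] linear_neg[OF J_linear] linear_0[OF J_linear]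
  linear_scale[OF J_linear] bounded_clinearD(2)[OF J_clinear]

lemma J_inject: "J x = J y \<longleftrightarrow> x = y"
  unfolding J_def using R_inject[of "- 2" x y] by auto

lemma R_eq_J: "R (- 2) x = J (- x)"
  by (simp add: J_simps) (simp add: J_def)

lemma norm_e_le:
  assumes "s \<ge> 0" "Re z \<ge> - 1"
  shows "cmod (exp (- (of_real s * (z + 2))) / (z + 2) ^ k) \<le> 1"
proof -
  have "1 \<le> cmod (z + 2)"
    using complex_Re_le_cmod[of "z + 2"] assms by simp
  then have "1 \<le> cmod (z + 2) ^ k"
    by (rule one_le_power)
  moreover have "cmod (exp (- (of_real s * (z + 2)))) \<le> 1"
    using assms by simp
  ultimately show ?thesis
    unfolding norm_divide norm_power
    by (meson divide_le_eq_1 divide_nonneg_nonneg less_le_trans norm_ge_zero order_trans zero_less_one)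
qed

lemma elementary_e:
  assumes "s \<ge> 0"
  shows "elementary (- 3/2) (- 1) (e k s)"
  unfolding e_def[abs_def]
proof (rule elementary_mult[where C = 1])
  show "elementary (- 3/2) (- 1) (\<lambda>z. 1 / (z - (- 2))\<^sup>2)"
    by (rule elementary_inverse_square) auto
  have "z + 2 \<noteq> 0" if "z \<in> half_plane (- 3/2)" for z
    using that by (auto simp: half_plane_def complex_eq_iff)
  then show "(\<lambda>z. exp (- (of_real s * (z + 2))) / (z + 2) ^ k) holomorphic_on half_plane (- 3/2)"
    by (auto intro!: holomorphic_intros)
qed (use norm_e_le[OF assms] in auto)

lemmas quad_decay_e = elementary_quad_decay[OF elementary_e]

lemma V_clinear: "s \<ge> 0 \<Longrightarrow> bounded_clinear (V k s)"
  unfolding V_def by (rule R.E_bounded_clinear) (auto intro: quad_decay_e)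

text \<open>\<open>J\<close> has the symbol \<open>1 / (z + 2)\<close>, so one more factor
  \<open>J\<close> raises the power in the denominator by one.\<close>

lemma V_J_Suc: "s \<ge> 0 \<Longrightarrow> V k s (J x) = V (Suc k) s x"
proof -
  assume s: "s \<ge> 0"
  have "V k s (R (- 2) (- x)) = R.E (- 1) (\<lambda>z. e k s z / (- 2 - z)) (- x)"
    unfolding V_def by (rule R.E_resolvent[OF elementary_e[OF s]]) auto
  also have "\<dots> = R.E (- 1) (\<lambda>z. - e (Suc k) s z) (- x)"
  proof (rule R.E_cong)
    fix r
    define w where "w = Complex (- 1) r + 2"
    have 1: "- 2 - Complex (- 1) r = - w" "Complex (- 1) r - (- 2) = w" by (simp_all add: w_def)
    show "e k s (Complex (- 1) r) / (- 2 - Complex (- 1) r) = - e (Suc k) s (Complex (- 1) r)"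
      unfolding e_def 1 w_def[symmetric] by (simp add: ac_simps)
  qed
  also have "\<dots> = V (Suc k) s x"
    using linear_neg[OF bounded_linear.linear[OF bounded_clinearD(1)[OF V_clinear[OF s, of "Suc k"]]]]
    by (simp add: R.E_minus_left V_def)
  finally show ?thesis
    by (simp add: R_eq_J)
qed

lemma V_J_commute: "s \<ge> 0 \<Longrightarrow> J (V k s x) = V k s (J x)"
  unfolding V_def
  by (rule R.E_commute[OF _ quad_decay_e J_clinear])
     (auto simp: J_def R.commute linear_neg[OF bounded_linear.linear[OF R.blin]])

lemma V_0: "V 0 0 x = J (J x)"
proof -
  have "V 0 0 x = R (- 2) (R (- 2) x)"
    using R.E_inverse_square[of "- 1" "- 2" x] by (simp add: V_def e_def[abs_def])
  then show ?thesis
    by (simp add: R_eq_J J_simps)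
qed

text \<open>At least \<open>1\<close>, so that the bound also covers the identity at time
  \<open>0\<close>, where the locale assumption is silent.\<close>

definition M' :: real where "M' = max 1 M"

lemma M'_ge: "1 \<le> M'" "M \<le> M'"
  by (auto simp: M'_def)

text \<open>The shift by \<open>2\<close> multiplies the symbol by the scalar
  \<open>exp (- 2 s)\<close>, so \<open>y\<close> is this scalar times the vector provided by
  \<open>exponential\<close>. At \<open>s = 0\<close> the vector \<open>x\<close> itself
  works.\<close>

lemma U_exists: "s \<ge> 0 \<Longrightarrow> \<exists>y. J (J y) = V 0 s x \<and> norm y \<le> exp (- 2 * s) * M' * norm x"
proof (cases "s = 0")
  case True
  then show ?thesis
    using V_0[of x] M'_ge by (intro exI[of _ x]) (auto simp: mult_le_cancel_right1)
next
  case False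
  assume "s \<ge> 0"
  with False obtain y where y: "R.E (- 1) (\<lambda>z. exp (- (of_real s * z)) / (z - (- 2))\<^sup>2) x = R (- 2) (R (- 2) y)"
    "norm y \<le> M * norm x"
    using exponential[of s x] by auto
  let ?c = "exp (- 2 * of_real s) :: complex"
  have "V 0 s x = R.E (- 1) (\<lambda>z. ?c * (exp (- (of_real s * z)) / (z - (- 2))\<^sup>2)) x"
    unfolding V_def e_def[abs_def]
    by (intro R.E_cong) (simp add: exp_add[symmetric] algebra_simps)
  also have "\<dots> = ?c *\<^sub>C R.E (- 1) (\<lambda>z. exp (- (of_real s * z)) / (z - (- 2))\<^sup>2) x"
  proof (rule R.E_mult_left)
    have "elementary (- 3/2) (- 1) (\<lambda>z. exp (- (of_real s * z)) * (1 / (z - (- 2))\<^sup>2))"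
    proof (rule elementary_mult[where C = "exp s"])
      show "elementary (- 3/2) (- 1) (\<lambda>z. 1 / (z - (- 2))\<^sup>2)"
        by (rule elementary_inverse_square) auto
      show "cmod (exp (- (of_real s * z))) \<le> exp s" if "- 1 \<le> Re z" for z
        using that \<open>s \<ge> 0\<close> mult_left_mono[of "-1" "Re z" s] by simp
    qed (auto intro!: holomorphic_intros)
    then show "quad_decay (- 1) (\<lambda>z. exp (- (of_real s * z)) / (z - (- 2))\<^sup>2)"
      using elementary_quad_decay by simp
  qed simp
  also have "\<dots> = J (J (?c *\<^sub>C y))"
    unfolding y(1) by (simp add: R_eq_J J_simps)
  finally have "J (J (?c *\<^sub>C y)) = V 0 s x" ..
  moreover have "norm (?c *\<^sub>C y) \<le> exp (- 2 * s) * M' * norm x"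
  proof -
    have "norm y \<le> M' * norm x"
      using y(2) M'_ge by (meson mult_right_mono norm_ge_zero order_trans)
    then show ?thesis by (simp add: norm_scaleC mult.assoc)
  qed
  ultimately show ?thesis by blast
qed

text \<open>The choice is unique because \<open>J\<close> is injective. Identities for
  \<open>U\<close> are therefore proved after applying \<open>J\<close> twice, where they concern
  absolutely convergent integrals.\<close>

definition U :: "real \<Rightarrow> 'a \<Rightarrow> 'a" where
  "U s x = (SOME y. J (J y) = V 0 s x)"

lemma J_J_U: "s \<ge> 0 \<Longrightarrow> J (J (U s x)) = V 0 s x"
  unfolding U_def using U_exists[of s x] by (metis (mono_tags, lifting) someI_ex)

lemma U_eqI: "s \<ge> 0 \<Longrightarrow> J (J y) = V 0 s x \<Longrightarrow> U s x = y"
  using J_J_U[of s x] J_inject by metis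

lemma norm_U: "s \<ge> 0 \<Longrightarrow> norm (U s x) \<le> exp (- 2 * s) * M' * norm x"
  using U_exists[of s x] U_eqI[of s _ x] by blast

lemma norm_U_le: "s \<ge> 0 \<Longrightarrow> norm (U s x) \<le> M' * norm x"
  by (rule order_trans[OF norm_U]) (use M'_ge in \<open>auto intro!: mult_right_mono mult_left_le_one_le\<close>)

lemma U_0: "U 0 x = x"
  by (rule U_eqI) (auto simp: V_0)

lemma U_clinear:
  assumes "s \<ge> 0"
  shows "bounded_clinear (U s)"
proof (rule bounded_clinearI)
  note V = V_clinear[OF assms, of 0]
  show "U s (x + y) = U s x + U s y" for x y
    by (rule U_eqI) (use assms V in \<open>auto simp: J_simps J_J_U linear_add bounded_linear.linear bounded_clinear_def\<close>)
  show "U s (c *\<^sub>C x) = c *\<^sub>C U s x" for c x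
    by (rule U_eqI) (use assms V in \<open>auto simp: J_simps J_J_U bounded_clinear_def\<close>)
qed (rule norm_U_le[OF assms])

lemma U_J_commute: "s \<ge> 0 \<Longrightarrow> U s (J x) = J (U s x)"
  by (rule U_eqI) (auto simp: J_J_U V_J_commute)

lemma V_2: "s \<ge> 0 \<Longrightarrow> V 2 s x = U s (J (J (J (J x))))"
  by (simp add: U_J_commute J_J_U V_J_commute V_J_Suc eval_nat_numeral)

lemma V_1: "s \<ge> 0 \<Longrightarrow> V (Suc 0) s x = U s (J (J (J x)))"
  by (simp add: U_J_commute J_J_U V_J_commute V_J_Suc)

lemma line_weight: "1 / (cmod (Complex (- 1) r + 2))\<^sup>2 \<le> 2 / (1 + \<bar>r\<bar>)\<^sup>2"
proof -
  have "(cmod (Complex (- 1) r + 2))\<^sup>2 = 1 + r\<^sup>2"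
    by (simp add: cmod_power2)
  moreover have "(1 + \<bar>r\<bar>)\<^sup>2 \<le> 2 * (1 + r\<^sup>2)"
    using sum_squares_bound[of 1 "\<bar>r\<bar>"] by (simp add: power2_sum)
  ultimately show ?thesis
    by (simp add: field_simps add_pos_nonneg)
qed

text \<open>With \<open>p = z + 2\<close> the remainder has as symbol a Taylor remainder of the
  exponential divided by \<open>p ^ 4\<close>. That remainder is at most
  \<open>(s' - s)^2 |p|^2\<close>, so two powers of \<open>p\<close> are spent on it and the other
  two ensure integrability. One bound serves all \<open>k\<close> because \<open>|p| >= 1\<close> on
  the line.\<close>

lemma V_estimates:
  obtains B where "B > 0" "\<And>k s x. s \<ge> 0 \<Longrightarrow> norm (V k s x) \<le> B * norm x"
    "\<And>s s' x. s \<ge> 0 \<Longrightarrow> s' \<ge> 0 \<Longrightarrow> norm (V 2 s' x - V 2 s x + (s' - s) *\<^sub>R V (Suc 0) s x) \<le> B * (s' - s)\<^sup>2 * norm x"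
proof -
  obtain W where W: "W > 0" "\<And>g C x. continuous_on UNIV (\<lambda>r. g (Complex (- 1) r)) \<Longrightarrow>
    (\<And>r. cmod (g (Complex (- 1) r)) \<le> C / (1 + \<bar>r\<bar>)\<^sup>2) \<Longrightarrow> norm (R.E (- 1) g x) \<le> C * W * norm x"
    using R.E_norm_le[of "- 1"] by auto
  have "norm (V k s x) \<le> (2 * W) * norm x" if "s \<ge> 0" for k s x
    unfolding V_def
  proof (rule W(2))
    show "continuous_on UNIV (\<lambda>r. e k s (Complex (- 1) r))"
      using quad_decay_e[OF that] by (simp add: quad_decay_def)
    show "cmod (e k s (Complex (- 1) r)) \<le> 2 / (1 + \<bar>r\<bar>)\<^sup>2" for r
    proof -
      have "cmod (e k s (Complex (- 1) r)) \<le> 1 * (1 / (cmod (Complex (- 1) r + 2))\<^sup>2)"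
        unfolding e_def norm_mult[of "_ / _ ^ k"] using norm_e_le[OF that, of "Complex (- 1) r" k]
        by (intro mult_mono) (auto simp: norm_divide norm_power)
      then show ?thesis using line_weight[of r] by simp
    qed
  qed
  moreover have "norm (V 2 s' x - V 2 s x + (s' - s) *\<^sub>R V (Suc 0) s x) \<le> (2 * W) * (s' - s)\<^sup>2 * norm x"
    if s: "s \<ge> 0" and s': "s' \<ge> 0" for s s' x
  proof -
    let ?g = "\<lambda>z. (e 2 s' z + (- 1) * e 2 s z) + of_real (s' - s) * e (Suc 0) s z"
    have m: "quad_decay (- 1) (\<lambda>z. c * e k t z)" if "t \<ge> 0" for c k t
      by (rule elementary_quad_decay[OF elementary_mult[OF elementary_e[OF that], of "\<lambda>_. c" "cmod c"]]) auto
    have qd: "quad_decay (- 1) (\<lambda>z. f z + h z)" if "quad_decay (- 1) f" "quad_decay (- 1) h" for f h :: "complex \<Rightarrow> complex"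
    proof -
      obtain C D where "\<And>r. cmod (f (Complex (- 1) r)) \<le> C / (1 + \<bar>r\<bar>)\<^sup>2" "\<And>r. cmod (h (Complex (- 1) r)) \<le> D / (1 + \<bar>r\<bar>)\<^sup>2"
        using \<open>quad_decay (- 1) f\<close> \<open>quad_decay (- 1) h\<close> by (auto simp: quad_decay_def)
      then have "cmod (f (Complex (- 1) r) + h (Complex (- 1) r)) \<le> (C + D) / (1 + \<bar>r\<bar>)\<^sup>2" for r
        by (simp add: add_divide_distrib norm_triangle_mono)
      then show ?thesis
        using that by (auto simp: quad_decay_def intro!: continuous_intros)
    qed
    have "R.E (- 1) ?g x = V 2 s' x - V 2 s x + (s' - s) *\<^sub>R V (Suc 0) s x"
      using m[OF s'] m[OF s] quad_decay_e[OF s'] quad_decay_e[OF s]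
      by (simp only: R.E_add_left R.E_mult_left qd V_def) (simp add: scaleC_one scaleR_scaleC)
    moreover have "norm (R.E (- 1) ?g x) \<le> (2 * (s' - s)\<^sup>2) * W * norm x"
    proof (rule W(2))
      have "quad_decay (- 1) ?g"
        using m[OF s'] m[OF s] quad_decay_e[OF s'] quad_decay_e[OF s] by (intro qd)
      then show "continuous_on UNIV (\<lambda>r. ?g (Complex (- 1) r))"
        by (simp add: quad_decay_def)
      show "cmod (?g (Complex (- 1) r)) \<le> (2 * (s' - s)\<^sup>2) / (1 + \<bar>r\<bar>)\<^sup>2" for r
      proof -
        define p where "p = Complex (- 1) r + 2"
        have p: "Re p = 1" "p \<noteq> 0" by (auto simp: p_def complex_eq_iff)
        have e: "e k t (Complex (- 1) r) = exp (- (of_real t * p)) / p ^ k * (1 / p\<^sup>2)" for k t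
          by (simp add: e_def p_def)
        have "?g (Complex (- 1) r) = (exp (- (of_real s' * p)) - exp (- (of_real s * p))
           + (of_real s' * p - of_real s * p) * exp (- (of_real s * p))) / p ^ 4"
          unfolding e using p(2) by (simp add: field_simps eval_nat_numeral)
        also have "cmod \<dots> \<le> (cmod (of_real s' * p - of_real s * p))\<^sup>2 / cmod p ^ 4"
          unfolding norm_divide norm_power using exp_minus_taylor[of "of_real s' * p" "of_real s * p"] s s' p
          by (intro divide_right_mono) auto
        also have "of_real s' * p - of_real s * p = of_real (s' - s) * p"
          by (simp add: algebra_simps)
        also have "(cmod (of_real (s' - s) * p))\<^sup>2 / cmod p ^ 4 = (s' - s)\<^sup>2 * (1 / (cmod p)\<^sup>2)"
          using p(2) by (simp add: norm_mult power_mult_distrib field_simps eval_nat_numeral flip: of_real_diff)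
        also have "\<dots> \<le> (s' - s)\<^sup>2 * (2 / (1 + \<bar>r\<bar>)\<^sup>2)"
          unfolding p_def by (intro mult_left_mono line_weight) auto
        finally show ?thesis by (simp add: mult.commute)
      qed
    qed
    ultimately show ?thesis by (simp add: ac_simps)
  qed
  ultimately show thesis
    using W(1) by (intro that[of "2 * W"]) auto
qed

lemma V_derivative:
  assumes "t \<ge> 0"
  shows "((\<lambda>s. V 2 s x) has_vector_derivative (- V (Suc 0) t x)) (at t within {0..})"
proof -
  obtain B where B: "\<And>s s' x. s \<ge> 0 \<Longrightarrow> s' \<ge> 0 \<Longrightarrow> norm (V 2 s' x - V 2 s x + (s' - s) *\<^sub>R V (Suc 0) s x) \<le> B * (s' - s)\<^sup>2 * norm x"
    using V_estimates by metis
  show ?thesis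
    by (rule quadratic_has_vector_derivative[where C = "B * norm x"])
       (use B[OF assms] in \<open>auto simp: ac_simps\<close>)
qed

text \<open>
  The product has derivative \<open>V 1 (t - s) V 2 s - V 2 (t - s) V 1 s\<close> in \<open>s\<close>, which vanishes because the
  factors commute with \<open>J\<close>. This yields the semigroup law without a double integral.
\<close>

lemma V_product_constant:
  assumes "0 \<le> s" "s \<le> t"
  shows "V 2 (t - s) (V 2 s x) = V 2 t (V 2 0 x)"
proof -
  obtain B where B: "B > 0" "\<And>k s x. s \<ge> 0 \<Longrightarrow> norm (V k s x) \<le> B * norm x"
    "\<And>s s' x. s \<ge> 0 \<Longrightarrow> s' \<ge> 0 \<Longrightarrow> norm (V 2 s' x - V 2 s x + (s' - s) *\<^sub>R V (Suc 0) s x) \<le> B * (s' - s)\<^sup>2 * norm x"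
    using V_estimates by metis
  define F where "F s = V 2 (t - s) (V 2 s x)" for s
  have est: "norm (F b - F a - (b - a) *\<^sub>R 0) \<le> (B * B * (3 + t) * norm x) * (b - a)\<^sup>2" if a: "a \<in> {0..t}" and b: "b \<in> {0..t}" for a b
  proof -
    define h where "h = b - a"
    have pos: "0 \<le> t - a" "0 \<le> t - b" "0 \<le> a" "0 \<le> b" using a b by auto
    note lin = bounded_linear.linear[OF bounded_clinearD(1)[OF V_clinear]]
    \<comment> \<open>The increment of the product is split into the first-order remainder of the
      left factor, that of the right factor, and a mixed term. The first-order terms left over
      cancel by \<open>swap\<close>, and every piece is of order \<open>(b - a)^2\<close>.\<close>
    define X1 where "X1 = V 2 (t - b) (V 2 b x) - V 2 (t - a) (V 2 b x) + ((t - b) - (t - a)) *\<^sub>R V (Suc 0) (t - a) (V 2 b x)"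
    define X2 where "X2 = V 2 (t - a) (V 2 b x - V 2 a x + (b - a) *\<^sub>R V (Suc 0) a x)"
    define X3 where "X3 = h *\<^sub>R V (Suc 0) (t - a) (V 2 b x - V 2 a x)"
    have swap: "V 2 (t - a) (V (Suc 0) a x) = V (Suc 0) (t - a) (V 2 a x)"
      using pos by (simp add: numeral_2_eq_2 V_J_commute flip: V_J_Suc)
    have sum: "F b - F a = X1 + X2 + X3"
      unfolding X1_def X2_def X3_def F_def h_def
      using pos by (simp add: linear_add[OF lin] linear_diff[OF lin] linear_scale[OF lin] swap algebra_simps)
    have "norm X1 \<le> B * h\<^sup>2 * (B * norm x)"
      unfolding X1_def by (rule order_trans[OF B(3)])
        (use pos B(1) B(2)[of b 2 x] in \<open>auto simp: h_def power2_commute intro!: mult_left_mono\<close>)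
    moreover have "norm X2 \<le> B * (B * h\<^sup>2 * norm x)"
      unfolding X2_def by (rule order_trans[OF B(2)])
        (use pos B(1) B(3)[of a b x] in \<open>auto simp: h_def intro!: mult_left_mono\<close>)
    moreover have "norm X3 \<le> \<bar>h\<bar> * (B * (\<bar>h\<bar> * (B * norm x) + B * h\<^sup>2 * norm x))"
    proof -
      have "norm (V 2 b x - V 2 a x) \<le> norm (V 2 b x - V 2 a x + (b - a) *\<^sub>R V (Suc 0) a x) + norm ((b - a) *\<^sub>R V (Suc 0) a x)"
        using norm_triangle_ineq4[of "V 2 b x - V 2 a x + (b - a) *\<^sub>R V (Suc 0) a x" "(b - a) *\<^sub>R V (Suc 0) a x"] by simp
      also have "\<dots> \<le> B * h\<^sup>2 * norm x + \<bar>h\<bar> * (B * norm x)"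
        using B(3)[of a b x] B(2)[of a "Suc 0" x] pos by (auto simp: h_def intro!: add_mono mult_left_mono)
      finally have "norm (V 2 b x - V 2 a x) \<le> \<bar>h\<bar> * (B * norm x) + B * h\<^sup>2 * norm x"
        by simp
      then have "B * norm (V 2 b x - V 2 a x) \<le> B * (\<bar>h\<bar> * (B * norm x) + B * h\<^sup>2 * norm x)"
        using B(1) by (intro mult_left_mono) auto
      then show ?thesis
        unfolding X3_def norm_scaleR using B(2)[OF pos(1), of "Suc 0" "V 2 b x - V 2 a x"]
        by (intro mult_left_mono) auto
    qed
    moreover have "norm (X1 + X2 + X3) \<le> norm X1 + norm X2 + norm X3"
      by (meson norm_triangle_ineq norm_triangle_le add_mono order_refl order_trans)
    moreover have "\<bar>h\<bar> * (B * (\<bar>h\<bar> * (B * norm x) + B * h\<^sup>2 * norm x)) = B * B * norm x * h\<^sup>2 * (1 + \<bar>h\<bar>)"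
    proof -
      have "a * (B * (a * (B * n) + B * a\<^sup>2 * n)) = B * B * n * a\<^sup>2 * (1 + a)" for a n :: real
        by (simp add: algebra_simps power2_eq_square)
      from this[of "\<bar>h\<bar>" "norm x"] show ?thesis
        by (simp only: power2_abs)
    qed
    moreover have "B * B * norm x * h\<^sup>2 * (1 + \<bar>h\<bar>) \<le> B * B * norm x * h\<^sup>2 * (1 + t)"
      using a b B(1) by (intro mult_left_mono) (auto simp: h_def)
    ultimately have "norm (F b - F a) \<le> B * h\<^sup>2 * (B * norm x) + B * (B * h\<^sup>2 * norm x) + B * B * norm x * h\<^sup>2 * (1 + t)"
      unfolding sum by linarith
    then show ?thesis
      by (simp add: h_def algebra_simps)
  qed
  have "(F has_vector_derivative 0) (at a within {0..t})" if "a \<in> {0..t}" for a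
    by (rule quadratic_has_vector_derivative[OF est]) (use that in auto)
  then have "\<exists>c. \<forall>a\<in>{0..t}. F a = c"
    by (intro has_derivative_zero_constant) (auto simp: has_vector_derivative_def)
  then have "F s = F 0"
    using assms by auto
  then show ?thesis
    by (simp add: F_def)
qed

text \<open>Both sides of the product identity carry eight factors \<open>J\<close>, which commute
  with the operators and are removed by injectivity.\<close>

lemma U_add:
  assumes "0 \<le> s" "0 \<le> t"
  shows "U (s + t) x = U s (U t x)"
proof -
  have "V 2 s (V 2 t x) = V 2 (s + t) (V 2 0 x)"
    using V_product_constant[of t "s + t" x] assms by simp
  then show ?thesis
    using assms by (simp add: V_2 U_J_commute J_inject U_0)
qed

section \<open>Strong continuity, the generator, and removal of the shift\<close>

lemma continuous_J: "continuous_on UNIV J"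
  using J_clinear by (simp add: bounded_clinear_def linear_continuous_on)

lemma dense_range_J: "closure (range J) = UNIV"
proof -
  have "range J = range (R (- 2))"
    by (auto simp: R_eq_J intro: range_eqI[of _ _ "- _"])
  then show ?thesis
    by (simp add: closure_range_R)
qed

lemma dense_range_J_J_J: "closure (range (\<lambda>x. J (J (J x)))) = UNIV"
  using dense_range_comp[OF continuous_J dense_range_J dense_range_comp[OF continuous_J dense_range_J dense_range_J]] .

text \<open>On the range of \<open>J^3\<close> this is the mean value inequality for
  \<open>V 2\<close>, with derivative \<open>- V 1\<close>. The resulting bound involves only the
  vector \<open>J (J (J x))\<close>, so it extends to all vectors by density.\<close>

lemma U_J_lipschitz:
  assumes "t \<ge> 0"
  shows "norm (U t (J x) - J x) \<le> t * M' * norm x"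
proof (rule dense_le[OF dense_range_J_J_J])
  have cU: "continuous_on UNIV (U t)"
    using U_clinear[OF assms] by (simp add: bounded_clinear_def linear_continuous_on)
  show "continuous_on UNIV (\<lambda>x. norm (U t (J x) - J x))"
    by (intro continuous_intros continuous_J continuous_on_compose2[OF cU]) auto
  show "continuous_on UNIV (\<lambda>x. t * M' * norm (x::'a))"
    by (intro continuous_intros)
  fix x
  have "norm (V 2 t x - V 2 0 x) \<le> M' * norm (J (J (J x))) * \<bar>t - 0\<bar>"
  proof (rule vector_derivative_bound[OF _ V_derivative])
    show "norm (- V (Suc 0) a x) \<le> M' * norm (J (J (J x)))" if "a \<in> {0..}" for a
      using norm_U_le[of a "J (J (J x))"] that by (simp add: V_1)
  qed (use assms in auto)
  then show "norm (U t (J (J (J (J x)))) - J (J (J (J x)))) \<le> t * M' * norm (J (J (J x)))"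
    using assms by (simp add: V_2 U_0 ac_simps)
qed

lemma U_continuous_0: "((\<lambda>t. U t x) \<longlongrightarrow> x) (at_right 0)"
proof (rule dense_tendsto[OF dense_range_J, of U M' _ "\<lambda>x. x"])
  have ev: "\<forall>\<^sub>F t::real in at_right 0. t > 0"
    by (rule eventually_at_right_less)
  show "\<forall>\<^sub>F t in at_right 0. \<forall>x y. norm (U t x - U t y) \<le> M' * norm (x - y)"
    using ev
  proof eventually_elim
    case (elim t)
    then show ?case
      using norm_U_le[of t] linear_diff[OF bounded_linear.linear[OF bounded_clinearD(1)[OF U_clinear]], of t]
      by (simp flip: linear_diff[OF bounded_linear.linear[OF bounded_clinearD(1)[OF U_clinear]], of t])
  qed
  show "((\<lambda>t. U t (J x)) \<longlongrightarrow> J x) (at_right 0)" for x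
  proof -
    have "((\<lambda>t. t * M' * norm x) \<longlongrightarrow> 0 * M' * norm x) (at_right 0)"
      by (intro tendsto_intros)
    then have lim: "((\<lambda>t. t * M' * norm x) \<longlongrightarrow> 0) (at_right 0)"
      by simp
    have "\<forall>\<^sub>F t in at_right 0. norm (U t (J x) - J x) \<le> t * M' * norm x"
      using ev by eventually_elim (rule U_J_lipschitz, simp)
    from Lim_null_comparison[OF this lim] show ?thesis
      unfolding LIM_zero_iff .
  qed
  show "norm (x - y) \<le> M' * norm (x - y)" for x y :: 'a
    using mult_right_mono[OF M'_ge(1), of "norm (x - y)"] by simp
qed

text \<open>The Lipschitz estimate makes the difference quotients on the range of \<open>J\<close>
  uniformly bounded operators of \<open>x\<close>. Their convergence is therefore needed only on the
  range of \<open>J^3\<close>, where it follows from the Taylor estimate for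
  \<open>V 2\<close>.\<close>

lemma U_J_derivative: "((\<lambda>t. (1 / t) *\<^sub>R (U t (J x) - J x)) \<longlongrightarrow> - x) (at_right 0)"
proof -
  have ev: "\<forall>\<^sub>F t::real in at_right 0. t > 0"
    by (rule eventually_at_right_less)
  show ?thesis
  proof (rule dense_tendsto[OF dense_range_J_J_J, of _ M' _ uminus])
    show "\<forall>\<^sub>F t in at_right 0. \<forall>x y. norm ((1 / t) *\<^sub>R (U t (J x) - J x) - (1 / t) *\<^sub>R (U t (J y) - J y)) \<le> M' * norm (x - y)"
      using ev
    proof (eventually_elim, intro allI)
      fix t :: real and x y
      assume t: "t > 0"
      have "(1 / t) *\<^sub>R (U t (J x) - J x) - (1 / t) *\<^sub>R (U t (J y) - J y) = (1 / t) *\<^sub>R (U t (J (x - y)) - J (x - y))"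
        using linear_diff[OF bounded_linear.linear[OF bounded_clinearD(1)[OF U_clinear]], of t "J x" "J y"] t
        by (simp add: J_simps scaleR_diff_right)
      moreover have "norm ((1 / t) *\<^sub>R (U t (J (x - y)) - J (x - y))) \<le> M' * norm (x - y)"
        using U_J_lipschitz[of t "x - y"] t by (simp add: pos_divide_le_eq ac_simps)
      ultimately show "norm ((1 / t) *\<^sub>R (U t (J x) - J x) - (1 / t) *\<^sub>R (U t (J y) - J y)) \<le> M' * norm (x - y)"
        by simp
    qed
    show "norm (- x - - y) \<le> M' * norm (x - y)" for x y :: 'a
      using M'_ge mult_right_mono[of 1 M' "norm (x - y)"] by (simp add: norm_minus_commute)
    fix x
    obtain B where B: "\<And>s s' x. s \<ge> 0 \<Longrightarrow> s' \<ge> 0 \<Longrightarrow> norm (V 2 s' x - V 2 s x + (s' - s) *\<^sub>R V (Suc 0) s x) \<le> B * (s' - s)\<^sup>2 * norm x"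
      using V_estimates by metis
    have "\<forall>\<^sub>F t in at_right 0. norm ((1 / t) *\<^sub>R (V 2 t x - V 2 0 x) - (- V (Suc 0) 0 x)) \<le> B * t * norm x"
      using ev
    proof eventually_elim
      case (elim t)
      have "(1 / t) *\<^sub>R (V 2 t x - V 2 0 x) - (- V (Suc 0) 0 x) = (1 / t) *\<^sub>R (V 2 t x - V 2 0 x + (t - 0) *\<^sub>R V (Suc 0) 0 x)"
        using elim by (simp add: scaleR_add_right)
      also have "norm \<dots> \<le> (1 / t) * (B * (t - 0)\<^sup>2 * norm x)"
        unfolding norm_scaleR using elim B[of 0 t x] by (intro mult_mono) auto
      also have "\<dots> = B * t * norm x"
        using elim by (simp add: power2_eq_square)
      finally show ?case .
    qed
    moreover have "((\<lambda>t. B * t * norm x) \<longlongrightarrow> B * 0 * norm x) (at_right 0)"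
      by (intro tendsto_intros)
    then have "((\<lambda>t. B * t * norm x) \<longlongrightarrow> 0) (at_right 0)"
      by simp
    ultimately have "((\<lambda>t. (1 / t) *\<^sub>R (V 2 t x - V 2 0 x) - (- V (Suc 0) 0 x)) \<longlongrightarrow> 0) (at_right 0)"
      by (rule Lim_null_comparison)
    then have "((\<lambda>t. (1 / t) *\<^sub>R (V 2 t x - V 2 0 x)) \<longlongrightarrow> - V (Suc 0) 0 x) (at_right 0)"
      by (simp only: LIM_zero_iff)
    then have "((\<lambda>t. (1 / t) *\<^sub>R (V 2 t x - J (J (J (J x))))) \<longlongrightarrow> - J (J (J x))) (at_right 0)"
      by (simp add: V_2 V_1 U_0)
    then show "((\<lambda>t. (1 / t) *\<^sub>R (U t (J (J (J (J x)))) - J (J (J (J x))))) \<longlongrightarrow> - J (J (J x))) (at_right 0)"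
    proof (rule Lim_transform_eventually)
      show "\<forall>\<^sub>F t in at_right 0. (1 / t) *\<^sub>R (V 2 t x - J (J (J (J x)))) = (1 / t) *\<^sub>R (U t (J (J (J (J x)))) - J (J (J (J x))))"
        using ev by eventually_elim (simp add: V_2)
    qed
  qed
qed

text \<open>The forward direction shows that the generator has no larger domain: applying
  \<open>J\<close> to a convergent difference quotient at \<open>x\<close> gives the one at
  \<open>J x\<close>, whose limit is \<open>- x\<close>, so \<open>J d = - x\<close>.\<close>

lemma U_derivative_iff: "((\<lambda>t. (1 / t) *\<^sub>R (U t x - x)) \<longlongrightarrow> d) (at_right 0) \<longleftrightarrow> x = J (- d)"
proof
  assume *: "((\<lambda>t. (1 / t) *\<^sub>R (U t x - x)) \<longlongrightarrow> d) (at_right 0)"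
  have "((\<lambda>t. J ((1 / t) *\<^sub>R (U t x - x))) \<longlongrightarrow> J d) (at_right 0)"
    using J_clinear * by (intro bounded_linear.tendsto[of J]) (auto simp: bounded_clinear_def)
  then have "((\<lambda>t. (1 / t) *\<^sub>R (U t (J x) - J x)) \<longlongrightarrow> J d) (at_right 0)"
  proof (rule Lim_transform_eventually)
    show "\<forall>\<^sub>F t in at_right 0. J ((1 / t) *\<^sub>R (U t x - x)) = (1 / t) *\<^sub>R (U t (J x) - J x)"
      using eventually_at_right_less[of "0::real"] by eventually_elim (simp add: J_simps U_J_commute)
  qed
  then have "J d = - x"
    using U_J_derivative tendsto_unique[OF trivial_limit_at_right_real] by blast
  then show "x = J (- d)"
    by (simp add: J_simps)
qed (use U_J_derivative[of "- d"] in simp)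

text \<open>Undoes the shift by \<open>2\<close>; the factor \<open>exp (- 2 s)\<close> in the bound
  for \<open>U\<close> cancels, leaving a bounded semigroup.\<close>

definition T :: "real \<Rightarrow> 'a \<Rightarrow> 'a" where
  "T t x = exp (2 * t) *\<^sub>R U t x"

lemma exp_quotient: "((\<lambda>t. (exp (c * t) - 1) / t) \<longlongrightarrow> c) (at_right (0::real))"
proof -
  have "((\<lambda>t. exp (c * t)) has_field_derivative c) (at 0)"
    by (auto intro!: derivative_eq_intros)
  then have "((\<lambda>t. (exp (c * t) - 1) / t) \<longlongrightarrow> c) (at 0)"
    by (simp add: has_field_derivative_iff)
  then show ?thesis
    by (rule tendsto_within_subset) simp
qed

lemma T_derivative_iff:
  "((\<lambda>t. (1 / t) *\<^sub>R (T t x - x)) \<longlongrightarrow> y) (at_right 0) \<longleftrightarrow> ((\<lambda>t. (1 / t) *\<^sub>R (U t x - x)) \<longlongrightarrow> y - 2 *\<^sub>R x) (at_right 0)"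
proof
  assume "((\<lambda>t. (1 / t) *\<^sub>R (T t x - x)) \<longlongrightarrow> y) (at_right 0)"
  then have "((\<lambda>t. exp (- 2 * t) *\<^sub>R ((1 / t) *\<^sub>R (T t x - x)) + ((exp (- 2 * t) - 1) / t) *\<^sub>R x)
      \<longlongrightarrow> exp (- 2 * 0) *\<^sub>R y + (- 2) *\<^sub>R x) (at_right 0)"
    by (intro tendsto_intros exp_quotient)
  moreover have "exp (- 2 * t) *\<^sub>R ((1 / t) *\<^sub>R (T t x - x)) + ((exp (- 2 * t) - 1) / t) *\<^sub>R x = (1 / t) *\<^sub>R (U t x - x)" for t
    by (simp add: T_def algebra_simps diff_divide_distrib exp_add[symmetric])
  ultimately show "((\<lambda>t. (1 / t) *\<^sub>R (U t x - x)) \<longlongrightarrow> y - 2 *\<^sub>R x) (at_right 0)"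
    by simp
next
  assume "((\<lambda>t. (1 / t) *\<^sub>R (U t x - x)) \<longlongrightarrow> y - 2 *\<^sub>R x) (at_right 0)"
  then have "((\<lambda>t. exp (2 * t) *\<^sub>R ((1 / t) *\<^sub>R (U t x - x)) + ((exp (2 * t) - 1) / t) *\<^sub>R x)
      \<longlongrightarrow> exp (2 * 0) *\<^sub>R (y - 2 *\<^sub>R x) + 2 *\<^sub>R x) (at_right 0)"
    by (intro tendsto_intros exp_quotient)
  moreover have "exp (2 * t) *\<^sub>R ((1 / t) *\<^sub>R (U t x - x)) + ((exp (2 * t) - 1) / t) *\<^sub>R x = (1 / t) *\<^sub>R (T t x - x)" for t
    by (simp add: T_def algebra_simps diff_divide_distrib)
  ultimately show "((\<lambda>t. (1 / t) *\<^sub>R (T t x - x)) \<longlongrightarrow> y) (at_right 0)"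
    by simp
qed

lemma norm_T_le: "t \<ge> 0 \<Longrightarrow> norm (T t x) \<le> M' * norm x"
proof -
  assume "t \<ge> 0"
  then have "norm (T t x) \<le> exp (2 * t) * (exp (- 2 * t) * M' * norm x)"
    unfolding T_def norm_scaleR using norm_U[of t x] by simp
  also have "\<dots> = M' * norm x"
    by (simp add: exp_minus)
  finally show ?thesis .
qed

lemma generates: "generates_bounded_C0_semigroup (op_uminus A)"
  unfolding generates_bounded_C0_semigroup_def
proof (intro exI conjI)
  show "C0_semigroup T"
    unfolding C0_semigroup_def
  proof (intro conjI allI impI)
    show "bounded_clinear (T t)" if "t \<ge> 0" for t
      by (rule bounded_clinearI[OF _ _ norm_T_le[OF that]])
         (use U_clinear[OF that] in \<open>auto simp: T_def bounded_clinear_def linear_add bounded_linear.linear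
           scaleR_add_right scaleC_scaleR\<close>)
    show "T 0 x = x" for x
      by (simp add: T_def U_0)
    show "T (s + t) x = T s (T t x)" if "s \<ge> 0" "t \<ge> 0" for s t x
      using that linear_scale[OF bounded_linear.linear[OF bounded_clinearD(1)[OF U_clinear[of s]]]]
      by (simp add: T_def U_add distrib_left exp_add)
    show "((\<lambda>t. T t x) \<longlongrightarrow> x) (at_right 0)" for x
    proof -
      have "((\<lambda>t. T t x) \<longlongrightarrow> exp (2 * 0) *\<^sub>R x) (at_right 0)"
        unfolding T_def by (intro tendsto_intros U_continuous_0)
      then show ?thesis by simp
    qed
  qed
  show "bounded_semigroup T"
    unfolding bounded_semigroup_def using norm_T_le M'_ge by (intro exI[of _ M'] allI impI onorm_bound) auto
  have "(x, y) \<in> semigroup_generator T \<longleftrightarrow> (x, y) \<in> op_uminus A" for x y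
  proof -
    have "(x, y) \<in> semigroup_generator T \<longleftrightarrow> x = J (- (y - 2 *\<^sub>R x))"
      by (simp add: semigroup_generator_def T_derivative_iff U_derivative_iff)
    also have "\<dots> \<longleftrightarrow> x = R (- 2) ((- 2) *\<^sub>C x - (- y))"
      by (simp add: R_eq_J scaleR_scaleC)
    also have "\<dots> \<longleftrightarrow> (x, - y) \<in> A"
      by (rule mem_iff[symmetric]) simp
    also have "\<dots> \<longleftrightarrow> (x, y) \<in> op_uminus A"
      unfolding op_uminus_def by force
    finally show ?thesis .
  qed
  then show "semigroup_generator T = op_uminus A"
    by auto
qed

end

section \<open>Square function estimates\<close>

lemma bounded_bilinear_has_vector_derivative:
  assumes "bounded_bilinear B"
    and f: "(f has_vector_derivative f') (at t within S)" and g: "(g has_vector_derivative g') (at t within S)"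
  shows "((\<lambda>t. B (f t) (g t)) has_vector_derivative (B (f t) g' + B f' (g t))) (at t within S)"
proof -
  interpret bounded_bilinear B by fact
  show ?thesis
    using FDERIV[OF f[unfolded has_vector_derivative_def] g[unfolded has_vector_derivative_def]]
    unfolding has_vector_derivative_def by (simp add: scaleR_right scaleR_left scaleR_add_right)
qed

lemma exp_has_vector_derivative:
  "((\<lambda>t. exp (of_real t * z)) has_vector_derivative (z * exp (of_real t * z))) (at t within S)"
  for z :: complex
proof -
  have "((\<lambda>w. exp (w * z)) has_field_derivative (z * exp (of_real t * z))) (at (of_real t))"
    by (auto intro!: derivative_eq_intros)
  then show ?thesis
    by (rule has_vector_derivative_real_field[THEN has_vector_derivative_at_within])
qed

lemma exp_decay_tendsto: "a < 0 \<Longrightarrow> ((\<lambda>t::real. C * exp (a * t)) \<longlongrightarrow> 0) at_top"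
  by (intro tendsto_mult_right_zero filterlim_compose[OF exp_at_bot])
     (auto intro!: filterlim_tendsto_neg_mult_at_bot tendsto_const filterlim_ident)

lemma exp_integrable:
  assumes "a < 0"
  shows "(\<lambda>t::real. C * exp (a * t)) integrable_on {0..}" "integral {0..} (\<lambda>t::real. C * exp (a * t)) = C / \<bar>a\<bar>"
proof -
  have "((\<lambda>t::real. exp (- (- a) * t)) has_integral exp (- (- a) * 0) / (- a)) {0..}"
    by (rule has_integral_exp_minus_to_infinity) (use assms in auto)
  from has_integral_mult_right[OF this, of C]
  have "((\<lambda>t::real. C * exp (a * t)) has_integral C / \<bar>a\<bar>) {0..}"
    using assms by simp
  then show "(\<lambda>t::real. C * exp (a * t)) integrable_on {0..}" "integral {0..} (\<lambda>t::real. C * exp (a * t)) = C / \<bar>a\<bar>"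
    by (auto simp: has_integral_iff)
qed

text \<open>This is \<open>pi N\<close> times the Poisson kernel of a half-plane for the point at
  distance \<open>N\<close> opposite \<open>r = 0\<close>, normalized to the value \<open>1\<close>
  there.\<close>

definition poisson_weight :: "real \<Rightarrow> real \<Rightarrow> real" where
  "poisson_weight N r = N\<^sup>2 / (N\<^sup>2 + r\<^sup>2)"

lemma poisson_weight_bound:
  assumes "N > 0"
  shows "0 \<le> poisson_weight N r" "poisson_weight N r \<le> 2 * (N\<^sup>2 + 1) / (1 + \<bar>r\<bar>)\<^sup>2"
proof -
  have N: "N\<^sup>2 > 0" using assms by simp
  show "0 \<le> poisson_weight N r" using N by (simp add: poisson_weight_def)
  have "(1 + \<bar>r\<bar>)\<^sup>2 \<le> 2 * (1 + r\<^sup>2)"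
    using sum_squares_bound[of 1 "\<bar>r\<bar>"] by (simp add: power2_sum)
  then have "N\<^sup>2 * (1 + \<bar>r\<bar>)\<^sup>2 \<le> N\<^sup>2 * (2 * (1 + r\<^sup>2))"
    using N by (intro mult_left_mono) auto
  also have "\<dots> \<le> 2 * (N\<^sup>2 + 1) * (N\<^sup>2 + r\<^sup>2)"
    by (simp add: algebra_simps)
  finally show "poisson_weight N r \<le> 2 * (N\<^sup>2 + 1) / (1 + \<bar>r\<bar>)\<^sup>2"
    using N by (simp add: poisson_weight_def divide_simps add_pos_nonneg)
qed

lemma continuous_poisson_weight: "N > 0 \<Longrightarrow> continuous_on S (poisson_weight N)"
  unfolding poisson_weight_def[abs_def] by (intro continuous_intros) (auto simp: sum_power2_eq_zero_iff)

lemma poisson_weight_integrable: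
  fixes k :: "real \<Rightarrow> 'b::banach"
  assumes "N > 0" "continuous_on UNIV k" "\<And>r. norm (k r) \<le> C"
  shows "(\<lambda>r. poisson_weight N r *\<^sub>R k r) integrable_on UNIV"
proof (rule integrable_on_UNIV_dominated[OF _ _ weight_integrable])
  show "continuous_on UNIV (\<lambda>r. poisson_weight N r *\<^sub>R k r)"
    by (intro continuous_intros continuous_poisson_weight assms)
  show "norm (poisson_weight N r *\<^sub>R k r) \<le> (2 * (N\<^sup>2 + 1) * C) / (1 + \<bar>r\<bar>)\<^sup>2" for r
  proof -
    have "norm (poisson_weight N r *\<^sub>R k r) \<le> 2 * (N\<^sup>2 + 1) / (1 + \<bar>r\<bar>)\<^sup>2 * C"
      unfolding norm_scaleR using poisson_weight_bound[OF assms(1), of r] assms(3)[of r] by (intro mult_mono) auto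
    then show ?thesis by simp
  qed
qed

lemma integral_UNIV_reflect:
  fixes f :: "real \<Rightarrow> 'b::banach"
  assumes "f integrable_on UNIV" "(\<lambda>r. f (- r)) integrable_on UNIV"
  shows "integral UNIV (\<lambda>r. f (- r)) = integral UNIV f"
proof (rule LIMSEQ_unique[OF integral_symmetric_tendsto[OF assms(2)]])
  have "integral {- real n..real n} (\<lambda>r. f (- r)) = integral {- real n..real n} f" for n
    using Henstock_Kurzweil_Integration.integral_reflect_real[of "real n" "- real n" f] by simp
  then show "(\<lambda>n. integral {- real n..real n} (\<lambda>r. f (- r))) \<longlonglongrightarrow> integral UNIV f"
    using integral_symmetric_tendsto[OF assms(1)] by simp
qed

context resolvent_family
begin

text \<open>The Poisson formula for the left half-plane, obtained from Cauchy's formula at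
  \<open>\<delta> - N\<close>. Division by \<open>z - c\<close>, with \<open>c\<close> the mirror
  image of that point, supplies the missing decay and at the same time completes the kernel: on the
  line the two linear factors multiply to \<open>- (N^2 + r^2)\<close>.\<close>

lemma poisson:
  assumes \<phi>: "bounded_linear \<phi>" "\<And>c x. \<phi> (c *\<^sub>C x) = c * \<phi> x" and "\<delta> < 0" "N > 0"
  shows "((\<lambda>r. poisson_weight N r *\<^sub>R \<phi> (L (Complex \<delta> r) x)) has_integral (of_real (pi * N) * \<phi> (L (of_real (\<delta> - N)) x))) UNIV"
proof -
  define c where "c = complex_of_real (\<delta> + N)"
  \<comment> \<open>Both limits are needed: \<open>\<delta> / 2\<close> stays in the region where
    \<open>L\<close> is holomorphic, and \<open>\<delta> + N\<close> keeps the pole \<open>c\<close>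
    out of the open half-plane.\<close>
  define \<omega> where "\<omega> = min (\<delta> / 2) (\<delta> + N)"
  have \<omega>: "\<delta> < \<omega>" "\<omega> < 0" "\<omega> \<le> \<delta> + N"
    using assms by (auto simp: \<omega>_def)
  obtain K where K: "K > 0" "\<And>z x. Re z \<le> \<delta> \<Longrightarrow> norm (L z x) \<le> K * norm x"
    using boundE[OF assms(3)] by metis
  obtain C where C: "C > 0" "\<And>x. norm (\<phi> x) \<le> norm x * C"
    using bounded_linear.pos_bounded[OF \<phi>(1)] by blast
  have "((\<lambda>r. (\<phi> (L (Complex \<delta> r) x) / (Complex \<delta> r - c)) / (Complex \<delta> r - of_real (\<delta> - N))) has_integral
      2 * pi * (\<phi> (L (of_real (\<delta> - N)) x) / (of_real (\<delta> - N) - c))) UNIV"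
  proof (rule cauchy_left_halfplane[where \<psi> = "\<lambda>z. \<phi> (L z x) / (z - c)" and c = c and B = "C * (K * norm x)", OF _ \<omega>(1)])
    show "(\<lambda>z. \<phi> (L z x) / (z - c)) holomorphic_on {z. Re z < \<omega>}"
      using \<omega> by (intro holomorphic_on_divide holomorphic_L[OF _ \<phi>] holomorphic_intros) (auto simp: c_def)
    show "cmod (\<phi> (L z x) / (z - c)) \<le> C * (K * norm x) / cmod (z - c)" if "Re z \<le> \<delta>" for z
    proof -
      have "cmod (\<phi> (L z x)) \<le> norm (L z x) * C"
        by (rule C(2))
      also have "\<dots> \<le> C * (K * norm x)"
        using K(2)[OF that, of x] C(1) by simp
      finally show ?thesis
        unfolding norm_divide by (rule divide_right_mono) simp
    qed
  qed (use assms in \<open>auto simp: c_def\<close>)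
  from has_integral_mult_right[OF this, of "- of_real (N\<^sup>2)"]
  have "((\<lambda>r. - of_real (N\<^sup>2) * ((\<phi> (L (Complex \<delta> r) x) / (Complex \<delta> r - c)) / (Complex \<delta> r - of_real (\<delta> - N)))) has_integral
      - of_real (N\<^sup>2) * (2 * pi * (\<phi> (L (of_real (\<delta> - N)) x) / (of_real (\<delta> - N) - c)))) UNIV" .
  moreover have "- of_real (N\<^sup>2) * ((\<phi> (L (Complex \<delta> r) x) / (Complex \<delta> r - c)) / (Complex \<delta> r - of_real (\<delta> - N)))
      = poisson_weight N r *\<^sub>R \<phi> (L (Complex \<delta> r) x)" for r
  proof -
    have "(Complex \<delta> r - c) * (Complex \<delta> r - of_real (\<delta> - N)) = - of_real (N\<^sup>2 + r\<^sup>2)"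
      by (simp add: c_def complex_eq_iff power2_eq_square algebra_simps)
    moreover have "N\<^sup>2 + r\<^sup>2 > 0"
      using assms by (simp add: add_pos_nonneg)
    ultimately show ?thesis
      by (simp add: poisson_weight_def scaleR_conv_of_real del: of_real_add of_real_diff)
  qed
  moreover have "- of_real (N\<^sup>2) * (2 * pi * (\<phi> (L (of_real (\<delta> - N)) x) / (of_real (\<delta> - N) - c)))
      = of_real (pi * N) * \<phi> (L (of_real (\<delta> - N)) x)"
  proof -
    have c: "of_real (\<delta> - N) - c = - of_real (2 * N)"
      by (simp add: c_def)
    show ?thesis
      unfolding c using assms by (simp add: power2_eq_square)
  qed
  ultimately show ?thesis by simp
qed

text \<open>
  With \<open>Q y = \<integral>\<^sub>0\<^sup>\<infinity> e\<^sup>2\<^sup>\<delta>\<^sup>t \<langle>V\<^sub>t y, V\<^sub>t x\<rangle> dt\<close> one has \<open>\<parallel>L z x\<parallel>\<^sup>2 = - 2 Re Q (L z x)\<close> on the line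
  \<open>Re z = \<delta>\<close>. The right-hand side is the real part of a holomorphic function, whose Poisson integral
  is a point evaluation. This replaces Plancherel's theorem for vector-valued functions.
\<close>

lemma square_function:
  assumes V: "\<And>t. t \<ge> 0 \<Longrightarrow> bounded_clinear (V t)" "\<And>t y. t \<ge> 0 \<Longrightarrow> norm (V t y) \<le> M * norm y" "\<And>y. V 0 y = y"
    and cont: "\<And>y. continuous_on {0..} (\<lambda>t. cinner (V t y) (V t x))"
    and deriv: "\<And>z t. Re z < 0 \<Longrightarrow> t \<ge> 0 \<Longrightarrow>
      ((\<lambda>t. exp (of_real t * z) *\<^sub>C V t (L z x)) has_vector_derivative (exp (of_real t * z) *\<^sub>C V t x)) (at t within {0..})"
    and M: "M > 0" "\<And>z y. Re z < 0 \<Longrightarrow> norm (L z y) \<le> M / \<bar>Re z\<bar> * norm y"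
    and \<delta>: "\<delta> < 0" and N: "N > 0"
  shows "(\<lambda>r. poisson_weight N r * (norm (L (Complex \<delta> r) x))\<^sup>2) integrable_on UNIV"
    "integral UNIV (\<lambda>r. poisson_weight N r * (norm (L (Complex \<delta> r) x))\<^sup>2) \<le> pi * M ^ 3 / \<bar>\<delta>\<bar> * (norm x)\<^sup>2"
proof -
  define q where "q y t = exp (2 * \<delta> * t) *\<^sub>R cinner (V t y) (V t x)" for y t
  define Q where "Q y = integral {0..} (q y)" for y
  have qb: "norm (q y t) \<le> (M\<^sup>2 * norm y * norm x) * exp (2 * \<delta> * t)" if "t \<ge> 0" for y t
  proof -
    have "cmod (cinner (V t y) (V t x)) \<le> (M * norm y) * (M * norm x)"
      by (rule order_trans[OF cauchy_schwarz]) (use V(2)[OF that] M(1) in \<open>auto intro!: mult_mono\<close>)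
    then have "exp (2 * \<delta> * t) * cmod (cinner (V t y) (V t x)) \<le> exp (2 * \<delta> * t) * ((M * norm y) * (M * norm x))"
      by (intro mult_left_mono) auto
    then show ?thesis
      by (simp add: q_def power2_eq_square ac_simps)
  qed
  have \<delta>2: "2 * \<delta> < 0" using \<delta> by simp
  have qi: "q y integrable_on {0..}" for y
  proof (rule integrable_on_halfline_dominated[OF _ qb exp_integrable(1)[OF \<delta>2]])
    show "continuous_on {0..} (q y)"
      unfolding q_def by (intro continuous_intros cont)
  qed
  have Qb: "norm (Q y) \<le> M\<^sup>2 * norm y * norm x / \<bar>2 * \<delta>\<bar>" for y
    using integral_norm_bound_integral[OF qi exp_integrable(1)[OF \<delta>2] qb] exp_integrable(2)[OF \<delta>2]
    by (simp add: Q_def)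
  have Qlin: "bounded_linear Q"
  proof (rule bounded_linear_intro)
    show "Q (y + y') = Q y + Q y'" for y y'
    proof -
      have "Q (y + y') = integral {0..} (\<lambda>t. q y t + q y' t)"
        unfolding Q_def
        by (rule integral_cong) (use V(1) in \<open>simp add: q_def cinner_add_left scaleR_add_right
          linear_add bounded_linear.linear bounded_clinear_def\<close>)
      then show ?thesis
        by (simp add: Q_def integral_add qi)
    qed
    show "Q (r *\<^sub>R y) = r *\<^sub>R Q y" for r y
    proof -
      have "Q (r *\<^sub>R y) = integral {0..} (\<lambda>t. r *\<^sub>R q y t)"
        unfolding Q_def
        by (rule integral_cong) (use V(1) in \<open>simp add: q_def cinner_scaleR_left
          linear_scale bounded_linear.linear bounded_clinear_def\<close>)
      then show ?thesis
        by (simp add: Q_def)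
    qed
    show "norm (Q y) \<le> norm y * (M\<^sup>2 * norm x / \<bar>2 * \<delta>\<bar>)" for y
      using Qb[of y] by (simp add: ac_simps)
  qed
  have Qc: "Q (c *\<^sub>C y) = c * Q y" for c y
  proof -
    have "Q (c *\<^sub>C y) = integral {0..} (\<lambda>t. c * q y t)"
      unfolding Q_def
      by (rule integral_cong) (use V(1) in \<open>simp add: q_def cinner_scaleC_left bounded_clinear_def\<close>)
    then show ?thesis
      by (simp add: Q_def)
  qed
  \<comment> \<open>With \<open>h t = exp (t z) V t (L z x)\<close>, the derivative of
    \<open>|h t|^2\<close> is \<open>2 Re (q (L z x) t)\<close>, by the assumed formula for
    \<open>h'\<close>. Integration from \<open>0\<close> to infinity leaves
    \<open>- |h 0|^2\<close>.\<close>
  have key: "(norm (L z x))\<^sup>2 = - 2 * Re (Q (L z x))" if z: "Re z = \<delta>" for z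
  proof -
    have z0: "Re z < 0" using z \<delta> by simp
    define h where "h t = exp (of_real t * z) *\<^sub>C V t (L z x)" for t
    define h' where "h' t = exp (of_real t * z) *\<^sub>C V t x" for t
    have hd: "(h has_vector_derivative h' t) (at t within {0..})" if "t \<ge> 0" for t
      unfolding h_def h'_def by (rule deriv[OF z0 that])
    have kd: "((\<lambda>t. Re (cinner (h t) (h t))) has_vector_derivative (2 * Re (q (L z x) t))) (at t within {0..})" if t: "t \<ge> 0" for t
    proof -
      have "((\<lambda>t. cinner (h t) (h t)) has_vector_derivative (cinner (h t) (h' t) + cinner (h' t) (h t))) (at t within {0..})"
        by (rule bounded_bilinear_has_vector_derivative[OF bounded_bilinear_cinner hd[OF t] hd[OF t]])
      then have "((\<lambda>t. Re (cinner (h t) (h t))) has_vector_derivative Re (cinner (h t) (h' t) + cinner (h' t) (h t))) (at t within {0..})"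
        by (rule bounded_linear.has_vector_derivative[OF bounded_linear_Re])
      moreover have "cinner (h t) (h' t) = q (L z x) t"
      proof -
        have "exp (of_real t * z) * cnj (exp (of_real t * z)) = of_real (exp (2 * \<delta> * t))"
        proof -
          have "exp (of_real t * z) * cnj (exp (of_real t * z)) = of_real ((cmod (exp (of_real t * z)))\<^sup>2)"
            by (rule complex_norm_square[symmetric])
          also have "(cmod (exp (of_real t * z)))\<^sup>2 = exp (2 * \<delta> * t)"
            by (simp add: z power2_eq_square exp_add[symmetric])
          finally show ?thesis .
        qed
        moreover have "cinner (h t) (h' t) = (exp (of_real t * z) * cnj (exp (of_real t * z))) * cinner (V t (L z x)) (V t x)"
          unfolding h_def h'_def cinner_scaleC_left cinner_scaleC_right by (simp only: ac_simps)
        ultimately show ?thesis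
          by (simp only: q_def scaleR_conv_of_real)
      qed
      moreover have "cinner (h' t) (h t) = cnj (cinner (h t) (h' t))"
        by (rule cinner_commute)
      ultimately show ?thesis by simp
    qed
    have "integral {0..} (\<lambda>t. 2 * Re (q (L z x) t)) = - Re (cinner (h 0) (h 0))"
    proof (rule integral_halfline_derivative[OF kd])
      show "(\<lambda>t. 2 * Re (q (L z x) t)) integrable_on {0..}"
        using integrable_linear[OF qi bounded_linear_Re, of "L z x"]
        by (simp add: o_def integrable_on_mult_right)
      show "((\<lambda>t. Re (cinner (h t) (h t))) \<longlongrightarrow> 0) at_top"
      proof (rule Lim_null_comparison)
        show "\<forall>\<^sub>F t in at_top. norm (Re (cinner (h t) (h t))) \<le> (M * norm (L z x))\<^sup>2 * exp (2 * \<delta> * t)"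
        proof (rule eventually_mono[OF eventually_ge_at_top[of 0]])
          fix t :: real
          assume t: "0 \<le> t"
          have "norm (h t) \<le> exp (\<delta> * t) * (M * norm (L z x))"
            using V(2)[OF t, of "L z x"] by (simp add: h_def norm_scaleC z mult.commute)
          then have "(norm (h t))\<^sup>2 \<le> (exp (\<delta> * t) * (M * norm (L z x)))\<^sup>2"
            by (intro power_mono) auto
          also have "\<dots> = (M * norm (L z x))\<^sup>2 * exp (2 * \<delta> * t)"
            by (simp add: power_mult_distrib exp_double[symmetric] ac_simps)
          finally show "norm (Re (cinner (h t) (h t))) \<le> (M * norm (L z x))\<^sup>2 * exp (2 * \<delta> * t)"
            by (simp add: cinner_self)
        qed
      qed (rule exp_decay_tendsto[OF \<delta>2])
    qed
    moreover have "integral {0..} (\<lambda>t. 2 * Re (q (L z x) t)) = 2 * Re (Q (L z x))"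
      using integral_linear[OF qi bounded_linear_Re, of "L z x"] by (simp add: o_def Q_def)
    moreover have "h 0 = L z x"
      by (simp add: h_def V(3) scaleC_one)
    ultimately show ?thesis
      by (simp add: cinner_self)
  qed
  have "((\<lambda>r. - 2 * Re (poisson_weight N r *\<^sub>R Q (L (Complex \<delta> r) x))) has_integral
      - 2 * Re (of_real (pi * N) * Q (L (of_real (\<delta> - N)) x))) UNIV"
    using has_integral_linear[OF poisson[OF Qlin Qc \<delta> N, of x] bounded_linear_Re]
    by (intro has_integral_mult_right) (simp add: o_def)
  moreover have "- 2 * Re (poisson_weight N r *\<^sub>R Q (L (Complex \<delta> r) x)) = poisson_weight N r * (norm (L (Complex \<delta> r) x))\<^sup>2" for r
    by (subst key) simp_all
  ultimately have I: "((\<lambda>r. poisson_weight N r * (norm (L (Complex \<delta> r) x))\<^sup>2) has_integral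
      - 2 * Re (of_real (pi * N) * Q (L (of_real (\<delta> - N)) x))) UNIV"
    by simp
  then show "(\<lambda>r. poisson_weight N r * (norm (L (Complex \<delta> r) x))\<^sup>2) integrable_on UNIV"
    by blast
  have "- 2 * Re (of_real (pi * N) * Q (L (of_real (\<delta> - N)) x)) \<le> 2 * cmod (of_real (pi * N) * Q (L (of_real (\<delta> - N)) x))"
    using abs_Re_le_cmod[of "of_real (pi * N) * Q (L (of_real (\<delta> - N)) x)"] by linarith
  also have "cmod (of_real (pi * N) * Q (L (of_real (\<delta> - N)) x)) = pi * N * norm (Q (L (of_real (\<delta> - N)) x))"
    unfolding norm_mult norm_of_real using N by simp
  also have "2 * (pi * N * norm (Q (L (of_real (\<delta> - N)) x))) \<le> 2 * (pi * N * (M\<^sup>2 * (M / N * norm x) * norm x / \<bar>2 * \<delta>\<bar>))"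
  proof -
    \<comment> \<open>The resolvent bound at the evaluation point is of order \<open>1 / N\<close>
      and cancels the factor \<open>pi N\<close> of the Poisson formula, so the estimate does not
      depend on \<open>N\<close>. It contributes the third factor \<open>M\<close>; the other two
      come from the bound on \<open>Q\<close>.\<close>
    have "norm (L (of_real (\<delta> - N)) x) \<le> M / \<bar>\<delta> - N\<bar> * norm x"
      using M(2)[of "of_real (\<delta> - N)" x] \<delta> N by simp
    also have "\<dots> \<le> M / N * norm x"
      using \<delta> N M by (intro mult_right_mono divide_left_mono) (auto intro: mult_pos_pos)
    finally have "M\<^sup>2 * norm (L (of_real (\<delta> - N)) x) * norm x / \<bar>2 * \<delta>\<bar> \<le> M\<^sup>2 * (M / N * norm x) * norm x / \<bar>2 * \<delta>\<bar>"
      by (intro divide_right_mono mult_right_mono mult_left_mono) auto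
    then have "norm (Q (L (of_real (\<delta> - N)) x)) \<le> M\<^sup>2 * (M / N * norm x) * norm x / \<bar>2 * \<delta>\<bar>"
      using Qb order_trans by blast
    then show ?thesis
      using N by (intro mult_left_mono) auto
  qed
  also have "\<dots> = pi * M ^ 3 / \<bar>\<delta>\<bar> * (norm x)\<^sup>2"
    using N \<delta> by (simp add: field_simps eval_nat_numeral)
  finally show "integral UNIV (\<lambda>r. poisson_weight N r * (norm (L (Complex \<delta> r) x))\<^sup>2) \<le> pi * M ^ 3 / \<bar>\<delta>\<bar> * (norm x)\<^sup>2"
    using I by (simp add: integral_unique)
qed

end

text \<open>A weak derivative that is norm continuous is a strong one: the mean value inequality for
  the scalar functions gives a remainder bound proportional to the norm of \<open>v\<close>, and the
  same neighbourhood of \<open>t\<close> works for all \<open>v\<close>.\<close>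

lemma weak_vector_derivative:
  fixes f :: "real \<Rightarrow> 'a::complex_hilbert_space"
  assumes weak: "\<And>v t. t \<ge> 0 \<Longrightarrow> ((\<lambda>t. cinner v (f t)) has_vector_derivative cinner v (d t)) (at t within {0..})"
    and cont: "continuous_on {0..} d" and t: "t \<ge> 0"
  shows "(f has_vector_derivative d t) (at t within {0..})"
  unfolding has_vector_derivative_def has_derivative_within_alt
proof (intro conjI allI impI)
  show "bounded_linear (\<lambda>h. h *\<^sub>R d t)"
    by (rule bounded_linear_scaleR_left)
  fix e :: real
  assume e: "e > 0"
  then obtain \<eta> where \<eta>: "\<eta> > 0" "\<And>s. s \<ge> 0 \<Longrightarrow> \<bar>s - t\<bar> < \<eta> \<Longrightarrow> norm (d s - d t) \<le> e"
    using cont t unfolding continuous_on_iff by (metis atLeast_iff dist_norm dist_real_def less_imp_le)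
  have "norm (f s - f t - (s - t) *\<^sub>R d t) \<le> e * norm (s - t)" if s: "s \<ge> 0" "norm (s - t) < \<eta>" for s
  proof (rule norm_le_if_cinner_le)
    fix v
    let ?S = "{min s t..max s t}"
    define g where "g a = cinner v (f a) - a *\<^sub>R cinner v (d t)" for a
    have "norm (g s - g t) \<le> (e * norm v) * \<bar>s - t\<bar>"
    proof (rule vector_derivative_bound[where S = ?S])
      fix a assume a: "a \<in> ?S"
      have "(g has_vector_derivative (cinner v (d a) - 1 *\<^sub>R cinner v (d t))) (at a within {0..})"
        unfolding g_def
        by (intro has_vector_derivative_diff weak bounded_linear.has_vector_derivative[OF bounded_linear_scaleR_left] has_vector_derivative_id)
           (use a s t in auto)
      then show "(g has_vector_derivative (cinner v (d a - d t))) (at a within ?S)"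
        using s t by (simp add: cinner_diff_right) (rule has_vector_derivative_within_subset, auto)
      have "norm (d a - d t) \<le> e"
        using a s t by (intro \<eta>(2)) auto
      then show "norm (cinner v (d a - d t)) \<le> e * norm v"
        using cauchy_schwarz[of v "d a - d t"] mult_left_mono[of "norm (d a - d t)" e "norm v"] by (simp add: mult.commute)
    qed auto
    moreover have "g s - g t = cinner v (f s - f t - (s - t) *\<^sub>R d t)"
      by (simp add: g_def cinner_diff_right cinner_scaleR_right scaleR_diff_left)
    ultimately have "norm (cinner v (f s - f t - (s - t) *\<^sub>R d t)) \<le> e * norm (s - t) * norm v"
      by (simp add: ac_simps)
    then show "cmod (cinner (f s - f t - (s - t) *\<^sub>R d t) v) \<le> e * norm (s - t) * norm v"
      by (subst cinner_commute) simp
  qed (use e in auto)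
  then show "\<exists>\<eta>>0. \<forall>s\<in>{0..}. norm (s - t) < \<eta> \<longrightarrow> norm (f s - f t - (s - t) *\<^sub>R d t) \<le> e * norm (s - t)"
    using \<eta>(1) by auto
qed

section \<open>Orbits of the semigroup, the Laplace transform, and the adjoint families\<close>

locale semigroup_operator = half_plane_operator +
  fixes T :: "real \<Rightarrow> 'a \<Rightarrow> 'a" and M :: real
  assumes C0: "C0_semigroup T" and T_norm: "t \<ge> 0 \<Longrightarrow> norm (T t x) \<le> M * norm x" and M_pos: "M > 0"
    and generator: "semigroup_generator T = op_uminus A"
begin

lemma T_clinear: "t \<ge> 0 \<Longrightarrow> bounded_clinear (T t)"
  and T_0: "T 0 x = x"
  and T_add: "s \<ge> 0 \<Longrightarrow> t \<ge> 0 \<Longrightarrow> T (s + t) x = T s (T t x)"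
  and T_tendsto_0: "((\<lambda>t. T t x) \<longlongrightarrow> x) (at_right 0)"
  using C0 by (auto simp: C0_semigroup_def)

lemma T_linear: "t \<ge> 0 \<Longrightarrow> linear (T t)"
  using T_clinear bounded_clinearD bounded_linear.linear by blast

lemma mem_A_iff: "(x, y) \<in> A \<longleftrightarrow> ((\<lambda>t. (1 / t) *\<^sub>R (T t x - x)) \<longlongrightarrow> - y) (at_right 0)"
proof -
  have "(x, y) \<in> A \<longleftrightarrow> (x, - y) \<in> op_uminus A"
    unfolding op_uminus_def by force
  then show ?thesis
    by (simp flip: generator add: semigroup_generator_def)
qed

text \<open>\<open>T t\<close> commutes with the difference quotients at \<open>0\<close>. It thus
  preserves the domain of \<open>A\<close> and commutes with \<open>A\<close> there, which the
  resolvent inherits.\<close>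

lemma T_R_commute:
  assumes "Re z < 0" "t \<ge> 0"
  shows "T t (R z x) = R z (T t x)"
proof -
  define v where "v = R z x"
  have "(v, z *\<^sub>C v - x) \<in> A"
    unfolding v_def by (rule R_mem[OF assms(1)])
  then have "((\<lambda>s. (1 / s) *\<^sub>R (T s v - v)) \<longlongrightarrow> - (z *\<^sub>C v - x)) (at_right 0)"
    by (simp add: mem_A_iff)
  then have "((\<lambda>s. T t ((1 / s) *\<^sub>R (T s v - v))) \<longlongrightarrow> T t (- (z *\<^sub>C v - x))) (at_right 0)"
    by (rule bounded_linear.tendsto[OF bounded_clinearD(1)[OF T_clinear[OF assms(2)]]])
  then have "((\<lambda>s. (1 / s) *\<^sub>R (T s (T t v) - T t v)) \<longlongrightarrow> T t (- (z *\<^sub>C v - x))) (at_right 0)"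
  proof (rule Lim_transform_eventually)
    show "\<forall>\<^sub>F s in at_right 0. T t ((1 / s) *\<^sub>R (T s v - v)) = (1 / s) *\<^sub>R (T s (T t v) - T t v)"
      using eventually_at_right_less[of "0::real"]
    proof eventually_elim
      case (elim s)
      then have "T t (T s v) = T s (T t v)"
        using T_add[of t s v] T_add[of s t v] assms by (simp add: add.commute)
      then show ?case
        using T_linear[OF assms(2)] by (simp add: linear_scale linear_diff)
    qed
  qed
  moreover have "T t (- (z *\<^sub>C v - x)) = - (z *\<^sub>C T t v - T t x)"
    using T_linear[OF assms(2)] bounded_clinearD(2)[OF T_clinear[OF assms(2)]]
    by (simp add: linear_diff)
  ultimately have "(T t v, z *\<^sub>C T t v - T t x) \<in> A"
    by (simp add: mem_A_iff)
  then show ?thesis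
    using mem_iff[OF assms(1), of "T t v" "z *\<^sub>C T t v - T t x"] by (simp add: v_def)
qed

lemma T_diff_le: "s \<ge> 0 \<Longrightarrow> t \<ge> 0 \<Longrightarrow> norm (T s x - T t x) \<le> M * norm (T \<bar>s - t\<bar> x - x)"
proof (induction s t rule: linorder_wlog)
  case (le s t)
  have "T t x - T s x = T s (T (t - s) x - x)"
    using le T_add[of s "t - s" x] by (simp add: linear_diff T_linear)
  then have "norm (T s x - T t x) \<le> M * norm (T (t - s) x - x)"
    using le T_norm[of s "T (t - s) x - x"] by (subst norm_minus_commute) simp
  then show ?case
    using le by (simp add: abs_minus_commute)
next
  case (sym s t)
  then show ?case
    by (simp add: norm_minus_commute abs_minus_commute)
qed

lemma abs_diff_at_right: "filterlim (\<lambda>s. \<bar>s - t\<bar>) (at_right 0) (at t within S)" for t :: real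
proof -
  have "((\<lambda>s. \<bar>s - t\<bar>) \<longlongrightarrow> \<bar>t - t\<bar>) (at t within S)"
    by (intro tendsto_intros)
  then show ?thesis
    by (auto simp: filterlim_at eventually_at_filter)
qed

lemma continuous_T: "continuous_on {0..} (\<lambda>t. T t x)"
  unfolding continuous_on_def
proof
  fix t :: real
  assume t: "t \<in> {0..}"
  have "((\<lambda>s. M * norm (T \<bar>s - t\<bar> x - x)) \<longlongrightarrow> M * norm (x - x)) (at t within {0..})"
    by (intro tendsto_intros filterlim_compose[OF T_tendsto_0 abs_diff_at_right])
  then have lim: "((\<lambda>s. M * norm (T \<bar>s - t\<bar> x - x)) \<longlongrightarrow> 0) (at t within {0..})"
    by simp
  have "\<forall>\<^sub>F s in at t within {0..}. norm (T s x - T t x) \<le> M * norm (T \<bar>s - t\<bar> x - x)"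
    unfolding eventually_at_filter using t by (intro always_eventually) (auto intro: T_diff_le)
  from Lim_null_comparison[OF this lim] show "((\<lambda>t. T t x) \<longlongrightarrow> T t x) (at t within {0..})"
    by (simp only: LIM_zero_iff)
qed

text \<open>The generator only gives a right derivative at time \<open>0\<close>; the difference
  quotient at \<open>t\<close> is reduced to it by factoring out the semigroup at the smaller of the
  two times.\<close>

lemma T_orbit_derivative:
  assumes "(v, y) \<in> A" "t \<ge> 0"
  shows "((\<lambda>t. T t v) has_vector_derivative T t (- y)) (at t within {0..})"
proof -
  define D where "D s = (1 / s) *\<^sub>R (T s v - v)" for s
  have D: "(D \<longlongrightarrow> - y) (at_right 0)"
    using assms(1) by (simp add: mem_A_iff D_def[abs_def])
  have est: "norm (T s v - T t v - (s - t) *\<^sub>R T t (- y)) / norm (s - t) \<le> M * norm (D \<bar>s - t\<bar> - (- y)) + norm (T s (- y) - T t (- y))"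
    if s: "s \<ge> 0" "s \<noteq> t" for s
  proof (cases "t < s")
    case True
    then have "T s v = T t (T (s - t) v)"
      using T_add[of t "s - t" v] assms by simp
    then have "T s v - T t v - (s - t) *\<^sub>R T t (- y) = (s - t) *\<^sub>R T t (D (s - t) - (- y))"
      using True assms T_linear[OF assms(2)]
      by (simp add: D_def linear_diff linear_scale linear_add linear_neg scaleR_diff_right scaleR_add_right)
    then have "norm (T s v - T t v - (s - t) *\<^sub>R T t (- y)) / norm (s - t) = norm (T t (D (s - t) - (- y)))"
      using True by simp
    also have "\<dots> \<le> M * norm (D (s - t) - (- y))"
      using T_norm assms by blast
    finally show ?thesis
      using True by (simp add: add_increasing2)
  next
    case False
    \<comment> \<open>For the left derivative the factor taken out is \<open>T s\<close> with
      \<open>s\<close> moving, so the error contains the extra term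
      \<open>T s (- y) - T t (- y)\<close>, controlled by strong continuity.\<close>
    then have st: "s < t" using s by simp
    then have "T t v = T s (T (t - s) v)"
      using T_add[of s "t - s" v] s by simp
    then have "T s v - T t v - (s - t) *\<^sub>R T t (- y) = - ((t - s) *\<^sub>R (T s (D (t - s) - (- y)) + (T s (- y) - T t (- y))))"
      using st T_linear[OF s(1)]
      by (simp add: D_def linear_diff linear_scale linear_add linear_neg scaleR_diff_right scaleR_add_right scaleR_diff_left algebra_simps)
    then have "norm (T s v - T t v - (s - t) *\<^sub>R T t (- y)) / norm (s - t) = norm (T s (D (t - s) - (- y)) + (T s (- y) - T t (- y)))"
      using st by simp
    also have "\<dots> \<le> M * norm (D (t - s) - (- y)) + norm (T s (- y) - T t (- y))"
      using T_norm[OF s(1)] by (intro norm_triangle_le add_right_mono)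
    finally show ?thesis
      using st by (simp add: abs_if)
  qed
  have "((\<lambda>s. M * norm (D \<bar>s - t\<bar> - (- y)) + norm (T s (- y) - T t (- y))) \<longlongrightarrow>
      M * norm (- y - (- y)) + norm (T t (- y) - T t (- y))) (at t within {0..})"
    using continuous_T[of "- y"] assms(2) unfolding continuous_on_def
    by (intro tendsto_intros filterlim_compose[OF D abs_diff_at_right]) auto
  then have lim: "((\<lambda>s. M * norm (D \<bar>s - t\<bar> - (- y)) + norm (T s (- y) - T t (- y))) \<longlongrightarrow> 0) (at t within {0..})"
    by simp
  have "\<forall>\<^sub>F s in at t within {0..}. norm (norm (T s v - T t v - (s - t) *\<^sub>R T t (- y)) / norm (s - t))
      \<le> M * norm (D \<bar>s - t\<bar> - (- y)) + norm (T s (- y) - T t (- y))"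
    unfolding eventually_at_filter using est by (intro always_eventually) auto
  from Lim_null_comparison[OF this lim] show ?thesis
    unfolding has_vector_derivative_def has_derivative_iff_norm
    by (auto intro: bounded_linear_scaleR_left)
qed

text \<open>The two terms with \<open>z\<close> in the product rule cancel, leaving the orbit of
  \<open>x\<close> itself. This single formula yields the Laplace representation of the resolvent as
  well as the square function estimate.\<close>

lemma weighted_orbit_derivative:
  assumes "Re z < 0" "t \<ge> 0"
  shows "((\<lambda>t. exp (of_real t * z) *\<^sub>C T t (R z x)) has_vector_derivative (exp (of_real t * z) *\<^sub>C T t x)) (at t within {0..})"
proof -
  let ?v = "R z x" and ?e = "exp (of_real t * z)"
  have "((\<lambda>t. exp (of_real t * z) *\<^sub>C T t ?v) has_vector_derivative
      (?e *\<^sub>C T t (- (z *\<^sub>C ?v - x)) + (z * ?e) *\<^sub>C T t ?v)) (at t within {0..})"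
    by (rule bounded_bilinear_has_vector_derivative[OF bounded_bilinear_scaleC exp_has_vector_derivative T_orbit_derivative[OF R_mem]])
       (use assms in auto)
  moreover have "?e *\<^sub>C T t (- (z *\<^sub>C ?v - x)) + (z * ?e) *\<^sub>C T t ?v = ?e *\<^sub>C T t x"
    using T_linear[OF assms(2)] bounded_clinearD(2)[OF T_clinear[OF assms(2)]]
    by (simp add: linear_diff scaleC_diff_right scaleC_scaleC mult.commute)
  ultimately show ?thesis by simp
qed

text \<open>Integrating the weighted orbit derivative represents \<open>R z x\<close> as minus the
  integral of \<open>exp (t z) T t x\<close> over \<open>t >= 0\<close>; the majorant is a decaying
  exponential.\<close>

lemma R_norm_le:
  assumes "Re z < 0"
  shows "norm (R z x) \<le> M / \<bar>Re z\<bar> * norm x"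
proof -
  let ?h = "\<lambda>t. exp (of_real t * z) *\<^sub>C T t (R z x)" and ?h' = "\<lambda>t. exp (of_real t * z) *\<^sub>C T t x"
  have bound: "norm (exp (of_real t * z) *\<^sub>C T t y) \<le> (M * norm y) * exp (Re z * t)" if "t \<ge> 0" for t y
    using T_norm[OF that, of y] by (simp add: norm_scaleC mult.commute[of t])
  have int: "?h' integrable_on {0..}"
    by (rule integrable_on_halfline_dominated[OF _ bound exp_integrable(1)[OF assms]])
       (intro continuous_intros continuous_T)
  have "(?h \<longlongrightarrow> 0) at_top"
    by (rule Lim_null_comparison[OF _ exp_decay_tendsto[OF assms]], rule eventually_mono[OF eventually_ge_at_top[of 0]])
       (rule bound)
  then have "integral {0..} ?h' = - ?h 0"
    using integral_halfline_derivative[OF weighted_orbit_derivative[OF assms] int] by blast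
  then have "norm (R z x) = norm (integral {0..} ?h')"
    by (simp add: T_0 scaleC_one)
  also have "\<dots> \<le> integral {0..} (\<lambda>t. (M * norm x) * exp (Re z * t))"
    by (rule integral_norm_bound_integral[OF int exp_integrable(1)[OF assms]]) (use bound in auto)
  finally show ?thesis
    using exp_integrable(2)[OF assms, of "M * norm x"] by simp
qed

lemma square_function_R:
  assumes "\<delta> < 0" "N > 0"
  shows "(\<lambda>r. poisson_weight N r * (norm (R (Complex \<delta> r) x))\<^sup>2) integrable_on UNIV"
    "integral UNIV (\<lambda>r. poisson_weight N r * (norm (R (Complex \<delta> r) x))\<^sup>2) \<le> pi * M ^ 3 / \<bar>\<delta>\<bar> * (norm x)\<^sup>2"
proof -
  have "continuous_on {0..} (\<lambda>t. cinner (T t y) (T t x))" for y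
    by (intro continuous_intros continuous_T)
  note sq = R.square_function[where V = T, OF T_clinear T_norm T_0 this weighted_orbit_derivative M_pos R_norm_le assms]
  show "(\<lambda>r. poisson_weight N r * (norm (R (Complex \<delta> r) x))\<^sup>2) integrable_on UNIV"
    by (rule sq(1))
  show "integral UNIV (\<lambda>r. poisson_weight N r * (norm (R (Complex \<delta> r) x))\<^sup>2) \<le> pi * M ^ 3 / \<bar>\<delta>\<bar> * (norm x)\<^sup>2"
    by (rule sq(2))
qed

text \<open>The resolvent of the adjoint of \<open>A\<close>. The conjugate in the argument makes
  the family holomorphic in \<open>z\<close> instead of antiholomorphic.\<close>

definition R' :: "complex \<Rightarrow> 'a \<Rightarrow> 'a" where
  "R' z = adj (R (cnj z))"

definition T' :: "real \<Rightarrow> 'a \<Rightarrow> 'a" where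
  "T' t = adj (T t)"

lemma cinner_R': "Re z < 0 \<Longrightarrow> cinner x (R' z y) = cinner (R (cnj z) x) y"
  unfolding R'_def by (rule cinner_adj[symmetric]) (rule R.bcl, simp)

lemma cinner_T': "t \<ge> 0 \<Longrightarrow> cinner x (T' t y) = cinner (T t x) y"
  unfolding T'_def by (rule cinner_adj[symmetric]) (rule T_clinear)

lemma cinner_right_eqI: "(\<And>v. cinner v x = cinner v y) \<Longrightarrow> x = (y::'a)"
  by (metis cinner_commute cinner_eqI)

lemma R'_norm_le: "Re z < 0 \<Longrightarrow> norm (R' z y) \<le> M / \<bar>Re z\<bar> * norm y"
  unfolding R'_def using R_norm_le[of "cnj z"] by (intro norm_adj_le R.bcl) auto

lemma T'_norm_le: "t \<ge> 0 \<Longrightarrow> norm (T' t y) \<le> M * norm y"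
  unfolding T'_def using T_norm T_clinear by (intro norm_adj_le)

text \<open>Adjoints reverse products, so the resolvent identity passes to \<open>R'\<close> after
  the two resolvents have been commuted.\<close>

sublocale R': resolvent_family R'
proof
  show "bounded_clinear (R' z)" if "Re z < 0" for z
    unfolding R'_def using R_norm_le[of "cnj z"] that
    by (intro adj_bounded_clinear[where K = "M / \<bar>Re z\<bar>"] R.bcl) auto
  show "\<exists>K. \<forall>z x. Re z \<le> \<delta> \<longrightarrow> norm (R' z x) \<le> K * norm x" if \<delta>: "\<delta> < 0" for \<delta>
  proof (intro exI allI impI)
    fix z x
    assume z: "Re z \<le> \<delta>"
    then have "norm (R' z x) \<le> M / \<bar>Re z\<bar> * norm x"
      using \<delta> by (intro R'_norm_le) auto
    also have "\<dots> \<le> M / \<bar>\<delta>\<bar> * norm x"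
      using z \<delta> M_pos by (intro mult_right_mono divide_left_mono) (auto intro: mult_neg_neg)
    finally show "norm (R' z x) \<le> M / \<bar>\<delta>\<bar> * norm x" .
  qed
  show "R' z x - R' w x = (w - z) *\<^sub>C R' z (R' w x)" if "Re z < 0" "Re w < 0" for z w x
  proof (rule cinner_right_eqI)
    fix v
    have "R (cnj z) v - R (cnj w) v = (cnj w - cnj z) *\<^sub>C R (cnj w) (R (cnj z) v)"
      using that by (subst R.commute) (auto intro: R.resolvent_identity)
    from arg_cong[OF this, of "\<lambda>u. cinner u x"]
    show "cinner v (R' z x - R' w x) = cinner v ((w - z) *\<^sub>C R' z (R' w x))"
      using that by (simp add: cinner_diff_right cinner_diff_left cinner_scaleC_left cinner_scaleC_right cinner_R')
  qed
qed

text \<open>Moving both adjoints onto \<open>v\<close> leaves a difference of the orbit of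
  \<open>R (cnj \<mu>) v\<close>. This vector lies in the domain of \<open>A\<close>, so its orbit
  is Lipschitz with a constant proportional to the norm of \<open>v\<close>; \<open>C\<close>
  combines this with the norm of \<open>u\<close>.\<close>

lemma continuous_T':
  assumes "Re \<mu> < 0"
  shows "continuous_on {0..} (\<lambda>t. T' t (R' \<mu> u))"
proof -
  let ?\<mu> = "cnj \<mu>"
  have \<mu>: "Re ?\<mu> < 0" using assms by simp
  obtain K where K: "K > 0" "\<And>x. norm (R ?\<mu> x) \<le> K * norm x"
    using R.boundE[OF \<mu>] by (metis order_refl)
  define C where "C = M * (cmod \<mu> * K + 1) * norm u"
  have "norm (T' s (R' \<mu> u) - T' t (R' \<mu> u)) \<le> C * \<bar>s - t\<bar>" if "s \<ge> 0" "t \<ge> 0" for s t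
  proof (rule norm_le_if_cinner_le)
    fix v
    let ?y = "?\<mu> *\<^sub>C R ?\<mu> v - v"
    have y: "norm ?y \<le> (cmod \<mu> * K + 1) * norm v"
    proof -
      have "norm ?y \<le> norm (?\<mu> *\<^sub>C R ?\<mu> v) + norm v"
        by (rule norm_triangle_ineq4)
      also have "\<dots> \<le> cmod \<mu> * (K * norm v) + norm v"
        using K(2)[of v] by (simp add: norm_scaleC mult_left_mono)
      finally show ?thesis by (simp add: algebra_simps)
    qed
    have "norm (T s (R ?\<mu> v) - T t (R ?\<mu> v)) \<le> (M * norm ?y) * \<bar>s - t\<bar>"
    proof (rule vector_derivative_bound[OF _ T_orbit_derivative[OF R_mem[OF \<mu>]]])
      show "norm (T a (- ?y)) \<le> M * norm ?y" if "a \<in> {0..}" for a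
        using T_norm[of a "- ?y"] that by (simp only: norm_minus_cancel atLeast_iff)
    qed (use that in auto)
    also have "\<dots> \<le> (M * ((cmod \<mu> * K + 1) * norm v)) * \<bar>s - t\<bar>"
      using y M_pos by (intro mult_right_mono mult_left_mono) auto
    finally have 1: "norm (T s (R ?\<mu> v) - T t (R ?\<mu> v)) \<le> M * (cmod \<mu> * K + 1) * norm v * \<bar>s - t\<bar>"
      by (simp add: mult.assoc)
    have "cinner v (T' s (R' \<mu> u) - T' t (R' \<mu> u)) = cinner (T s (R ?\<mu> v) - T t (R ?\<mu> v)) u"
      using that assms by (simp add: cinner_diff_right cinner_diff_left cinner_T' cinner_R' T_R_commute)
    then have "cmod (cinner v (T' s (R' \<mu> u) - T' t (R' \<mu> u))) \<le> M * (cmod \<mu> * K + 1) * norm v * \<bar>s - t\<bar> * norm u"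
      using cauchy_schwarz[of "T s (R ?\<mu> v) - T t (R ?\<mu> v)" u] mult_right_mono[OF 1, of "norm u"] by simp
    then show "cmod (cinner (T' s (R' \<mu> u) - T' t (R' \<mu> u)) v) \<le> C * \<bar>s - t\<bar> * norm v"
      by (subst cinner_commute) (simp add: C_def ac_simps)
  qed (use M_pos K in \<open>auto simp: C_def\<close>)
  then have "C-lipschitz_on {0..} (\<lambda>t. T' t (R' \<mu> u))"
    using M_pos K by (intro lipschitz_onI) (auto simp: C_def dist_norm)
  then show ?thesis
    by (rule lipschitz_on_continuous_on)
qed

text \<open>
  Orbits of the adjoint semigroup are a priori only weakly continuous, but they are Lipschitz on the
  range of \<open>R' \<mu>\<close>.
\<close>

lemma square_function_R':
  assumes "\<delta> < 0" "N > 0" "Re \<mu> < 0" and y: "y = R' \<mu> u"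
  shows "(\<lambda>r. poisson_weight N r * (norm (R' (Complex \<delta> r) y))\<^sup>2) integrable_on UNIV"
    "integral UNIV (\<lambda>r. poisson_weight N r * (norm (R' (Complex \<delta> r) y))\<^sup>2) \<le> pi * M ^ 3 / \<bar>\<delta>\<bar> * (norm y)\<^sup>2"
proof -
  have cl: "bounded_clinear (T' t)" if "t \<ge> 0" for t
    unfolding T'_def using T_norm T_clinear that by (intro adj_bounded_clinear)
  have T'_0: "T' 0 x = x" for x
    by (rule cinner_right_eqI) (simp add: cinner_T' T_0)
  have cT': "continuous_on {0..} (\<lambda>t. T' t y)"
    unfolding y by (rule continuous_T'[OF assms(3)])
  \<comment> \<open>The orbit of \<open>v\<close> may be only weakly continuous. It is moved to the
    other side of the inner product, where \<open>T t (T' t y)\<close> is norm continuous because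
    the orbit of \<open>y\<close> is and \<open>T\<close> is uniformly bounded and strongly
    continuous.\<close>
  have cont: "continuous_on {0..} (\<lambda>t. cinner (T' t v) (T' t y))" for v
  proof -
    have "continuous_on {0..} (\<lambda>t. T t (T' t y))"
      unfolding continuous_on_def
    proof
      fix t :: real
      assume t: "t \<in> {0..}"
      have 1: "((\<lambda>s. T s (T' t y)) \<longlongrightarrow> T t (T' t y)) (at t within {0..})"
        using continuous_T t unfolding continuous_on_def by blast
      have "((\<lambda>s. M * norm (T' s y - T' t y)) \<longlongrightarrow> M * norm (T' t y - T' t y)) (at t within {0..})"
        using cT' t unfolding continuous_on_def by (intro tendsto_intros) auto
      then have lim: "((\<lambda>s. M * norm (T' s y - T' t y)) \<longlongrightarrow> 0) (at t within {0..})"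
        by simp
      have "\<forall>\<^sub>F s in at t within {0..}. norm (T s (T' s y) - T s (T' t y)) \<le> M * norm (T' s y - T' t y)"
        unfolding eventually_at_filter using T_norm T_linear
        by (intro always_eventually) (auto simp flip: linear_diff)
      from tendsto_add[OF Lim_null_comparison[OF this lim] 1]
      show "((\<lambda>t. T t (T' t y)) \<longlongrightarrow> T t (T' t y)) (at t within {0..})"
        by simp
    qed
    then have "continuous_on {0..} (\<lambda>t. cinner v (T t (T' t y)))"
      by (intro continuous_intros)
    moreover have "cinner v (T t (T' t y)) = cinner (T' t v) (T' t y)" if "t \<in> {0..}" for t
      using that cinner_T'[of t "T' t y" v] by (metis atLeast_iff cinner_commute)
    ultimately show ?thesis
      by (rule continuous_on_eq)
  qed
  \<comment> \<open>Weakly this is the corresponding formula for \<open>T\<close> and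
    \<open>R (cnj z)\<close> tested against \<open>y\<close>; continuity of the orbit of
    \<open>y\<close> upgrades it to a norm derivative.\<close>
  have deriv: "((\<lambda>t. exp (of_real t * z) *\<^sub>C T' t (R' z y)) has_vector_derivative (exp (of_real t * z) *\<^sub>C T' t y)) (at t within {0..})"
    if "Re z < 0" "t \<ge> 0" for z t
  proof (rule weak_vector_derivative[OF _ _ that(2)])
    show "continuous_on {0..} (\<lambda>t. exp (of_real t * z) *\<^sub>C T' t y)"
      by (intro continuous_intros cT')
    fix v t
    assume t: "t \<ge> (0::real)"
    have "((\<lambda>t. cinner (exp (of_real t * cnj z) *\<^sub>C T t (R (cnj z) v)) y) has_vector_derivative
        cinner (exp (of_real t * cnj z) *\<^sub>C T t v) y) (at t within {0..})"
      by (intro bounded_linear.has_vector_derivative[OF bounded_linear_cinner_left] weighted_orbit_derivative)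
         (use that t in auto)
    moreover have "cinner (exp (of_real t * cnj z) *\<^sub>C T t v) y = cinner v (exp (of_real t * z) *\<^sub>C T' t y)"
      using t by (simp add: cinner_scaleC_left cinner_scaleC_right cinner_T' exp_cnj)
    moreover have "cinner (exp (of_real t * cnj z) *\<^sub>C T t (R (cnj z) v)) y = cinner v (exp (of_real t * z) *\<^sub>C T' t (R' z y))" if "t \<in> {0..}" for t
      using that \<open>Re z < 0\<close> by (simp add: cinner_scaleC_left cinner_scaleC_right cinner_T' cinner_R' T_R_commute exp_cnj)
    ultimately show "((\<lambda>t. cinner v (exp (of_real t * z) *\<^sub>C T' t (R' z y))) has_vector_derivative
        cinner v (exp (of_real t * z) *\<^sub>C T' t y)) (at t within {0..})"
      using t by (auto elim!: has_vector_derivative_transform[rotated 2])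
  qed
  note sq = R'.square_function[where V = T', OF cl T'_norm_le T'_0 cont deriv M_pos R'_norm_le assms(1,2)]
  show "(\<lambda>r. poisson_weight N r * (norm (R' (Complex \<delta> r) y))\<^sup>2) integrable_on UNIV"
    by (rule sq(1))
  show "integral UNIV (\<lambda>r. poisson_weight N r * (norm (R' (Complex \<delta> r) y))\<^sup>2) \<le> pi * M ^ 3 / \<bar>\<delta>\<bar> * (norm y)\<^sup>2"
    by (rule sq(2))
qed

end

section \<open>From the semigroup to the functional calculus\<close>

lemma quad_decay_mult_bounded:
  fixes g k :: "complex \<Rightarrow> complex"
  assumes "quad_decay \<delta> g" "continuous_on UNIV (\<lambda>r. k (Complex \<delta> r))" "\<And>r. cmod (k (Complex \<delta> r)) \<le> C"
  shows "quad_decay \<delta> (\<lambda>z. g z * k z)"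
proof -
  obtain D where D: "\<And>r. cmod (g (Complex \<delta> r)) \<le> D / (1 + \<bar>r\<bar>)\<^sup>2"
    using assms(1) by (auto simp: quad_decay_def)
  have "cmod (g (Complex \<delta> r) * k (Complex \<delta> r)) \<le> (D * C) / (1 + \<bar>r\<bar>)\<^sup>2" for r
  proof -
    have "cmod (g (Complex \<delta> r) * k (Complex \<delta> r)) \<le> D / (1 + \<bar>r\<bar>)\<^sup>2 * C"
      unfolding norm_mult using D[of r] assms(3)[of r] order_trans[OF norm_ge_zero D[of r]] by (intro mult_mono) auto
    then show ?thesis by simp
  qed
  then show ?thesis
    using assms(1,2) by (auto simp: quad_decay_def intro!: continuous_intros)
qed

lemma quad_decay_tendsto_0:
  assumes "quad_decay \<delta> g"
  shows "((\<lambda>r. g (Complex \<delta> r)) \<longlongrightarrow> 0) at_infinity"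
proof -
  obtain C where C: "\<And>r. norm (g (Complex \<delta> r)) \<le> C / (1 + \<bar>r\<bar>)\<^sup>2"
    using assms by (auto simp: quad_decay_def)
  have C0: "C \<ge> 0"
    using order_trans[OF norm_ge_zero C[of 0]] by simp
  have "norm (g (Complex \<delta> r)) \<le> C * norm (inverse r)" if "1 \<le> norm r" for r
  proof -
    have "1 + \<bar>r\<bar> \<le> (1 + \<bar>r\<bar>) * (1 + \<bar>r\<bar>)"
      using mult_left_mono[of 1 "1 + \<bar>r\<bar>" "1 + \<bar>r\<bar>"] by simp
    then have "\<bar>r\<bar> \<le> (1 + \<bar>r\<bar>)\<^sup>2"
      unfolding power2_eq_square by linarith
    then have "C / (1 + \<bar>r\<bar>)\<^sup>2 \<le> C / \<bar>r\<bar>"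
      using C0 that by (intro divide_left_mono) (auto intro!: mult_pos_pos zero_less_power)
    then show ?thesis
      using C[of r] by (simp add: divide_inverse abs_inverse)
  qed
  then have ev: "\<forall>\<^sub>F r in at_infinity. norm (g (Complex \<delta> r)) \<le> C * norm (inverse r)"
    unfolding eventually_at_infinity by blast
  have "((\<lambda>r::real. C * norm (inverse r)) \<longlongrightarrow> 0) at_infinity"
    by (intro tendsto_mult_right_zero tendsto_norm_zero tendsto_inverse_0)
  with ev show ?thesis
    by (rule Lim_null_comparison)
qed

lemma dense_convergent:
  fixes S :: "nat \<Rightarrow> 'a::real_normed_vector \<Rightarrow> 'b::banach"
  assumes D: "closure (range D) = UNIV" and lip: "\<And>n x y. norm (S n x - S n y) \<le> M * norm (x - y)"
    and conv: "\<And>x. convergent (\<lambda>n. S n (D x))"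
  shows "convergent (\<lambda>n. S n x)"
proof -
  have "Cauchy (\<lambda>n. S n x)"
  proof (rule metric_CauchyI)
    fix e :: real
    assume e: "e > 0"
    define M' where "M' = max M 1"
    have M': "M' > 0" "M \<le> M'" by (auto simp: M'_def)
    obtain u where u: "norm (D u - x) < e / (3 * M')"
      using D closure_approachable[of x "range D"] e M' by (auto simp: dist_norm dest!: spec[of _ "e / (3 * M')"])
    then have u': "M * norm (x - D u) < e / 3"
      using M' e mult_right_mono[OF M'(2) norm_ge_zero[of "D u - x"]]
      by (simp add: field_simps norm_minus_commute)
    have "Cauchy (\<lambda>n. S n (D u))"
      using conv Cauchy_convergent_iff by blast
    then obtain N where N: "\<And>m n. m \<ge> N \<Longrightarrow> n \<ge> N \<Longrightarrow> dist (S m (D u)) (S n (D u)) < e / 3"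
      using e metric_CauchyD[of "\<lambda>n. S n (D u)" "e / 3"] by auto
    have "dist (S m x) (S n x) < e" if "m \<ge> N" "n \<ge> N" for m n
    proof -
      have "dist (S k x) (S k (D u)) < e / 3" for k
        using lip[of k x "D u"] u' by (simp add: dist_norm)
      from this[of m] this[of n] N[OF that] show ?thesis
        using dist_triangle[of "S m x" "S n x" "S m (D u)"] dist_triangle[of "S m (D u)" "S n x" "S n (D u)"]
        by (simp add: dist_commute)
    qed
    then show "\<exists>N. \<forall>m\<ge>N. \<forall>n\<ge>N. dist (S m x) (S n x) < e"
      by blast
  qed
  then show ?thesis
    by (simp add: Cauchy_convergent_iff)
qed

section \<open>Resolvent approximation of the identity and the bilinear square function
  estimate\<close>

context semigroup_operator
begin

text \<open>On the range of \<open>R (- 1)\<close> the resolvent identity reduces the claim to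
  \<open>R (- n)\<close> tending to \<open>0\<close> strongly; the bound \<open>M / n\<close>
  extends it by density. The sign comes from \<open>R (- n) = - (n + A)^-1\<close>.\<close>

lemma resolvent_approximation: "(\<lambda>n. real n *\<^sub>R R (- of_nat n) v) \<longlonglongrightarrow> - v"
proof (rule dense_tendsto[where D = "R (- 1)" and M = "max M 1" and G = uminus])
  show "closure (range (R (- 1))) = UNIV"
    by (rule closure_range_R) simp
  have scale: "norm (real n *\<^sub>R R (- of_nat n) x) \<le> M * norm x" if "n \<ge> 1" for n x
    using R_norm_le[of "- of_nat n" x] that by (simp add: field_simps)
  show "\<forall>\<^sub>F n in sequentially. \<forall>x y. norm (real n *\<^sub>R R (- of_nat n) x - real n *\<^sub>R R (- of_nat n) y) \<le> max M 1 * norm (x - y)"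
  proof (rule eventually_mono[OF eventually_ge_at_top[of 1]], intro allI)
    fix n :: nat and x y
    assume n: "1 \<le> n"
    have "norm (real n *\<^sub>R R (- of_nat n) (x - y)) \<le> max M 1 * norm (x - y)"
      using scale[OF n, of "x - y"] by (meson max.cobounded1 mult_right_mono norm_ge_zero order_trans)
    then show "norm (real n *\<^sub>R R (- of_nat n) x - real n *\<^sub>R R (- of_nat n) y) \<le> max M 1 * norm (x - y)"
      using n by (simp add: R.L_diff scaleR_diff_right)
  qed
  show "norm (- x - - y) \<le> max M 1 * norm (x - y)" for x y :: 'a
    using mult_right_mono[of 1 "max M 1" "norm (x - y)"] by (simp add: norm_minus_commute)
  fix u
  have lim: "(\<lambda>n. R (- of_nat n) x) \<longlonglongrightarrow> 0" for x
  proof (rule Lim_null_comparison)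
    show "\<forall>\<^sub>F n in sequentially. norm (R (- of_nat n) x) \<le> M * norm x * inverse (real n)"
      by (rule eventually_mono[OF eventually_ge_at_top[of 1]])
         (use R_norm_le[of "- of_nat _" x] in \<open>auto simp: divide_inverse mult_ac\<close>)
    show "(\<lambda>n. M * norm x * inverse (real n)) \<longlonglongrightarrow> 0"
      by (intro tendsto_mult_right_zero lim_inverse_n)
  qed
  have "(\<lambda>n. R (- of_nat n) u + R (- of_nat n) (R (- 1) u) - R (- 1) u) \<longlonglongrightarrow> 0 + 0 - R (- 1) u"
    by (intro tendsto_intros lim)
  then have "(\<lambda>n. R (- of_nat n) u + R (- of_nat n) (R (- 1) u) - R (- 1) u) \<longlonglongrightarrow> - R (- 1) u"
    by simp
  then show "(\<lambda>n. real n *\<^sub>R R (- of_nat n) (R (- 1) u)) \<longlonglongrightarrow> - R (- 1) u"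
  proof (rule Lim_transform_eventually)
    show "\<forall>\<^sub>F n in sequentially. R (- of_nat n) u + R (- of_nat n) (R (- 1) u) - R (- 1) u = real n *\<^sub>R R (- of_nat n) (R (- 1) u)"
    proof (rule eventually_mono[OF eventually_ge_at_top[of 1]])
      fix n :: nat
      assume n: "1 \<le> n"
      have "R (- of_nat n) u - R (- 1) u = (- 1 - (- of_nat n)) *\<^sub>C R (- of_nat n) (R (- 1) u)"
        by (rule R.resolvent_identity) (use n in auto)
      also have "\<dots> = real n *\<^sub>R R (- of_nat n) (R (- 1) u) - R (- 1 * of_nat n) (R (- 1) u)"
        by (simp add: scaleC_diff_left scaleC_one scaleR_scaleC)
      finally show "R (- of_nat n) u + R (- of_nat n) (R (- 1) u) - R (- 1) u = real n *\<^sub>R R (- of_nat n) (R (- 1) u)"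
        by (simp add: algebra_simps)
    qed
  qed
qed

text \<open>An arbitrary \<open>y\<close> is replaced by the vectors \<open>n R' (- n) y\<close>,
  which lie in the admissible range and have norm at most \<open>M\<close> times that of
  \<open>y\<close>; hence the factor \<open>M\<close>.\<close>

lemma norm_le_via_R':
  assumes C: "C \<ge> 0" and "\<And>\<mu> u. Re \<mu> < 0 \<Longrightarrow> cmod (cinner v (R' \<mu> u)) \<le> C * norm (R' \<mu> u)"
  shows "norm v \<le> C * M"
proof (rule norm_le_if_cinner_le)
  fix y
  have "(\<lambda>n. cmod (cinner (real n *\<^sub>R R (- of_nat n) v) y)) \<longlonglongrightarrow> cmod (cinner (- v) y)"
    by (intro tendsto_intros resolvent_approximation)
  moreover have "cmod (cinner (real n *\<^sub>R R (- of_nat n) v) y) \<le> C * M * norm y" if "n \<ge> 1" for n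
  proof -
    have "cinner (real n *\<^sub>R R (- of_nat n) v) y = real n *\<^sub>R cinner v (R' (- of_nat n) y)"
      using that by (simp add: cinner_scaleR_left cinner_R')
    then have "cmod (cinner (real n *\<^sub>R R (- of_nat n) v) y) \<le> real n * (C * norm (R' (- of_nat n) y))"
      using assms(2)[of "- of_nat n" y] that by (simp add: mult_left_mono)
    also have "\<dots> \<le> real n * (C * (M / real n * norm y))"
      using R'_norm_le[of "- of_nat n" y] that C by (intro mult_left_mono) auto
    also have "\<dots> = C * M * norm y"
      using that by simp
    finally show ?thesis .
  qed
  ultimately show "cmod (cinner v y) \<le> C * M * norm y"
    by (intro LIMSEQ_le_const2[where X = "\<lambda>n. cmod (cinner (real n *\<^sub>R R (- of_nat n) v) y)"])
       (auto simp: cinner_minus_left)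
qed (use C M_pos in simp)

text \<open>One resolvent is moved to the other side of the inner product, and the Cauchy-Schwarz
  inequality for integrals is replaced by its pointwise form
  \<open>p q <= s / 2 p^2 + q^2 / (2 s)\<close>. The adjoint resolvent then sits at the conjugate
  point, which the evenness of the weight and a reflection of the line repair.\<close>

lemma square_form:
  assumes "\<delta> < 0" "N > 0" "Re \<mu> < 0" and y: "y = R' \<mu> u"
    and int: "(\<lambda>r. poisson_weight N r * cmod (cinner (R (Complex \<delta> r) (R (Complex \<delta> r) x)) y)) integrable_on UNIV"
  shows "integral UNIV (\<lambda>r. poisson_weight N r * cmod (cinner (R (Complex \<delta> r) (R (Complex \<delta> r) x)) y))
    \<le> pi * M ^ 3 / \<bar>\<delta>\<bar> * norm x * norm y"
proof (cases "x = 0 \<or> y = 0")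
  case True
  have "R (Complex \<delta> r) 0 = 0" for r
    using linear_0[OF bounded_linear.linear[OF R.blin]] assms by simp
  with True show ?thesis by auto
next
  case False
  \<comment> \<open>The value of \<open>s\<close> that makes both summands equal, so that their sum
    is the product of the norms.\<close>
  define s where "s = norm y / norm x"
  have s: "s > 0" using False by (simp add: s_def)
  let ?b = "\<lambda>r. poisson_weight N r * (norm (R' (Complex \<delta> r) y))\<^sup>2"
  let ?a = "\<lambda>r. poisson_weight N r * (norm (R (Complex \<delta> r) x))\<^sup>2"
  note a = square_function_R[OF assms(1,2), of x]
  note b = square_function_R'[OF assms(1,2,3) y]
  have even: "poisson_weight N (- r) = poisson_weight N r" for r
    by (simp add: poisson_weight_def)
  obtain K where K: "K > 0" "\<And>z x. Re z \<le> \<delta> \<Longrightarrow> norm (R' z x) \<le> K * norm x"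
    using R'.boundE[OF assms(1)] by metis
  have "(\<lambda>r. poisson_weight N r *\<^sub>R (norm (R' (Complex \<delta> (- r)) y))\<^sup>2) integrable_on UNIV"
  proof (rule poisson_weight_integrable[OF assms(2)])
    show "continuous_on UNIV (\<lambda>r. (norm (R' (Complex \<delta> (- r)) y))\<^sup>2)"
      by (intro continuous_intros continuous_on_compose2[OF R'.continuous_L_line]) (use assms in auto)
    show "norm ((norm (R' (Complex \<delta> (- r)) y))\<^sup>2) \<le> (K * norm y)\<^sup>2" for r
      using K(2)[of "Complex \<delta> (- r)" y] by (simp add: power_mono)
  qed
  then have b': "(\<lambda>r. ?b (- r)) integrable_on UNIV"
    by (simp add: even)
  have bi: "integral UNIV (\<lambda>r. ?b (- r)) = integral UNIV ?b"
    by (rule integral_UNIV_reflect[OF b(1) b'])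
  have "integral UNIV (\<lambda>r. poisson_weight N r * cmod (cinner (R (Complex \<delta> r) (R (Complex \<delta> r) x)) y))
      \<le> integral UNIV (\<lambda>r. s / 2 * ?a r + 1 / (2 * s) * ?b (- r))"
  proof (rule integral_le[OF int])
    show "(\<lambda>r. s / 2 * ?a r + 1 / (2 * s) * ?b (- r)) integrable_on UNIV"
      by (intro integrable_add integrable_on_mult_right a b')
    fix r
    let ?z = "Complex \<delta> r"
    have "cinner (R ?z (R ?z x)) y = cinner (R ?z x) (R' (cnj ?z) y)"
      using assms by (simp add: cinner_R')
    then have 1: "cmod (cinner (R ?z (R ?z x)) y) \<le> norm (R ?z x) * norm (R' (Complex \<delta> (- r)) y)"
      using cauchy_schwarz[of "R ?z x" "R' (cnj ?z) y"] by (simp only: complex_cnj)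
    have amgm: "p * q \<le> s / 2 * p\<^sup>2 + 1 / (2 * s) * q\<^sup>2" for p q :: real
    proof -
      have "0 \<le> (s * p - q)\<^sup>2" by simp
      also have "(s * p - q)\<^sup>2 = 2 * s * (s / 2 * p\<^sup>2 + 1 / (2 * s) * q\<^sup>2 - p * q)"
        using s by (simp add: field_simps power2_eq_square)
      finally show ?thesis
        using s by (simp add: zero_le_mult_iff)
    qed
    have "poisson_weight N r * cmod (cinner (R ?z (R ?z x)) y)
        \<le> poisson_weight N r * (s / 2 * (norm (R ?z x))\<^sup>2 + 1 / (2 * s) * (norm (R' (Complex \<delta> (- r)) y))\<^sup>2)"
      by (intro mult_left_mono order_trans[OF 1 amgm] poisson_weight_bound assms)
    then show "poisson_weight N r * cmod (cinner (R ?z (R ?z x)) y) \<le> s / 2 * ?a r + 1 / (2 * s) * ?b (- r)"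
      unfolding even by (simp add: algebra_simps)
  qed
  also have "\<dots> = s / 2 * integral UNIV ?a + 1 / (2 * s) * integral UNIV ?b"
    using a(1) b' by (simp only: integral_add integrable_on_mult_right integral_mult_right bi)
  also have "\<dots> \<le> s / 2 * (pi * M ^ 3 / \<bar>\<delta>\<bar> * (norm x)\<^sup>2) + 1 / (2 * s) * (pi * M ^ 3 / \<bar>\<delta>\<bar> * (norm y)\<^sup>2)"
    using s by (intro add_mono mult_left_mono a b) auto
  also have "\<dots> = pi * M ^ 3 / \<bar>\<delta>\<bar> * norm x * norm y"
    using False by (simp add: s_def field_simps power2_eq_square)
  finally show ?thesis .
qed

end

section \<open>The calculus of the first derivative of a bounded holomorphic function\<close>

locale semigroup_function = semigroup_operator +
  fixes f :: "complex \<Rightarrow> complex" and \<omega> B :: real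
  assumes \<omega>: "\<omega> < 0" and f_holo: "f holomorphic_on half_plane \<omega>"
    and f_bound: "z \<in> half_plane \<omega> \<Longrightarrow> cmod (f z) \<le> B"
begin

abbreviation "\<delta> \<equiv> \<omega> / 2"
text \<open>The order is \<open>\<omega> < \<omega>' < \<delta> < 0\<close>: \<open>f\<close> is
  bounded to the right of \<open>\<omega>\<close>, its derivative to the right of
  \<open>\<omega>'\<close>, and the integration runs along \<open>\<delta>\<close>.\<close>

abbreviation "\<omega>' \<equiv> 3 * \<omega> / 4"

lemma open_half_plane: "open (half_plane a)"
  unfolding half_plane_def by (rule open_halfspace_Re_gt)

lemma B_nonneg: "B \<ge> 0"
  by (rule order_trans[OF norm_ge_zero f_bound[of 0]]) (use \<omega> in \<open>simp add: half_plane_def\<close>)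

text \<open>Cauchy's estimate with radius \<open>|\<omega>| / 8\<close>, half the gap between
  \<open>\<omega>\<close> and \<open>\<omega>'\<close>, so that closed discs stay inside the open
  half-plane.\<close>

definition B1 :: real where "B1 = 8 * B / \<bar>\<omega>\<bar>"

lemma B1_nonneg: "B1 \<ge> 0"
  using B_nonneg by (simp add: B1_def)

lemma deriv_bound:
  assumes "z \<in> half_plane \<omega>'"
  shows "cmod (deriv f z) \<le> B1"
proof -
  have sub: "cball z (\<bar>\<omega>\<bar> / 8) \<subseteq> half_plane \<omega>"
  proof
    fix u
    assume "u \<in> cball z (\<bar>\<omega>\<bar> / 8)"
    then have "\<bar>Re z - Re u\<bar> \<le> \<bar>\<omega>\<bar> / 8"
      using abs_Re_le_cmod[of "z - u"] by (simp add: dist_norm)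
    then show "u \<in> half_plane \<omega>"
      using assms \<omega> by (simp add: half_plane_def)
  qed
  have "cmod ((deriv ^^ 1) f z) \<le> fact 1 * B / (\<bar>\<omega>\<bar> / 8) ^ 1"
  proof (rule Cauchy_inequality)
    show "f holomorphic_on ball z (\<bar>\<omega>\<bar> / 8)"
      using f_holo sub ball_subset_cball by (blast intro: holomorphic_on_subset)
    show "continuous_on (cball z (\<bar>\<omega>\<bar> / 8)) f"
      using f_holo sub by (blast intro: holomorphic_on_imp_continuous_on holomorphic_on_subset)
    show "cmod (f x) \<le> B" if "cmod (z - x) = \<bar>\<omega>\<bar> / 8" for x
      using sub that by (intro f_bound) (auto simp: dist_norm)
  qed (use \<omega> in simp)
  then show ?thesis
    by (simp add: B1_def mult.commute)
qed

lemma half_plane_mono: "a \<le> b \<Longrightarrow> half_plane b \<subseteq> half_plane a"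
  by (auto simp: half_plane_def)

lemma deriv_holo: "deriv f holomorphic_on half_plane \<omega>'"
  using holomorphic_deriv[OF f_holo open_half_plane] half_plane_mono[of \<omega> \<omega>'] \<omega>
  by (auto intro: holomorphic_on_subset)

lemma deriv_Hinf: "deriv f \<in> Hinf \<omega>'"
  unfolding Hinf_def using deriv_holo deriv_bound by (auto simp: bounded_iff)

text \<open>
  \<open>F N\<close> is the derivative of the regularization \<open>f z (N / (N + z - \<delta>))\<^sup>2\<close>, whose modulus on the line
  \<open>Re z = \<delta>\<close> is that of \<open>f\<close> times the Poisson weight.
\<close>

definition pole :: "real \<Rightarrow> complex" where
  "pole N = of_real (\<delta> - N)"

definition G :: "real \<Rightarrow> complex \<Rightarrow> complex" where
  "G N z = f z * (of_real (N\<^sup>2) / (z - pole N)\<^sup>2)"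

definition F :: "real \<Rightarrow> complex \<Rightarrow> complex" where
  "F N z = (of_real (N\<^sup>2) * deriv f z - 2 * of_real (N\<^sup>2) * f z / (z - pole N)) * (1 / (z - pole N)\<^sup>2)"

lemma pole_left: "N > - \<omega> \<Longrightarrow> z \<in> half_plane \<omega> \<Longrightarrow> z \<noteq> pole N"
  using \<omega> by (auto simp: half_plane_def pole_def)

lemma elementary_F:
  assumes N: "N > - \<omega>"
  shows "elementary \<omega>' \<delta> (F N)"
  unfolding F_def[abs_def]
proof (rule elementary_mult)
  have N0: "N > 0" using N \<omega> by simp
  show "elementary \<omega>' \<delta> (\<lambda>z. 1 / (z - pole N)\<^sup>2)"
    by (rule elementary_inverse_square) (use N \<omega> in \<open>auto simp: pole_def\<close>)
  have "z - pole N \<noteq> 0" if "z \<in> half_plane \<omega>'" for z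
    using pole_left[OF N] that half_plane_mono[of \<omega> \<omega>'] \<omega> by auto
  then show "(\<lambda>z. of_real (N\<^sup>2) * deriv f z - 2 * of_real (N\<^sup>2) * f z / (z - pole N)) holomorphic_on half_plane \<omega>'"
    using half_plane_mono[of \<omega> \<omega>'] \<omega>
    by (intro holomorphic_intros deriv_holo holomorphic_on_subset[OF f_holo]) auto
  fix z
  assume z: "\<delta> \<le> Re z"
  have "N \<le> cmod (z - pole N)"
    using complex_Re_le_cmod[of "z - pole N"] z by (simp add: pole_def)
  moreover have "cmod (f z) \<le> B" "cmod (deriv f z) \<le> B1"
    using z \<omega> by (auto intro!: f_bound deriv_bound simp: half_plane_def)
  ultimately have "2 * N\<^sup>2 * cmod (f z) / cmod (z - pole N) \<le> 2 * N\<^sup>2 * B / N"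
    using N0 B_nonneg by (intro frac_le mult_left_mono) auto
  moreover have "N\<^sup>2 * cmod (deriv f z) \<le> N\<^sup>2 * B1"
    using \<open>cmod (deriv f z) \<le> B1\<close> by (intro mult_left_mono) auto
  ultimately show "cmod (of_real (N\<^sup>2) * deriv f z - 2 * of_real (N\<^sup>2) * f z / (z - pole N)) \<le> N\<^sup>2 * B1 + 2 * N\<^sup>2 * B / N"
    by (intro norm_triangle_le_diff) (simp add: norm_mult norm_divide norm_power)
qed

lemma cmod_pole_line: "(cmod (Complex \<delta> r - pole N))\<^sup>2 = N\<^sup>2 + r\<^sup>2"
  by (simp add: pole_def cmod_power2)

lemma quad_decay_G:
  assumes "N > - \<omega>"
  shows "quad_decay \<delta> (G N)"
proof (rule quad_decayI[where a = "pole N" and b = "pole N" and C = "B * N\<^sup>2"])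
  have "continuous_on (half_plane \<omega>) (G N)"
    unfolding G_def using pole_left[OF assms]
    by (intro holomorphic_on_imp_continuous_on holomorphic_intros f_holo) auto
  then show "continuous_on UNIV (\<lambda>r. G N (Complex \<delta> r))"
    by (rule continuous_on_line) (use \<omega> in \<open>simp add: half_plane_def\<close>)
  show "cmod (G N (Complex \<delta> r)) \<le> B * N\<^sup>2 / (cmod (Complex \<delta> r - pole N) * cmod (Complex \<delta> r - pole N))" for r
  proof -
    have "cmod (f (Complex \<delta> r)) * (N\<^sup>2 / (cmod (Complex \<delta> r - pole N))\<^sup>2) \<le> B * (N\<^sup>2 / (cmod (Complex \<delta> r - pole N))\<^sup>2)"
      using \<omega> by (intro mult_right_mono f_bound) (auto simp: half_plane_def)
    then show ?thesis
      by (simp add: G_def norm_mult norm_divide norm_power power2_eq_square)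
  qed
qed (use assms \<omega> in \<open>auto simp: pole_def\<close>)

lemma G_derivative:
  assumes "N > - \<omega>" "z \<in> half_plane \<omega>"
  shows "(G N has_field_derivative F N z) (at z)"
proof -
  have "f field_differentiable at z"
    using f_holo open_half_plane assms by (simp add: holomorphic_on_open field_differentiable_def)
  then have "(f has_field_derivative deriv f z) (at z)"
    by (simp add: DERIV_deriv_iff_field_differentiable)
  moreover have "((\<lambda>z. of_real (N\<^sup>2) / (z - pole N)\<^sup>2) has_field_derivative - 2 * of_real (N\<^sup>2) / (z - pole N) ^ 3) (at z)"
  proof -
    have "((\<lambda>u. of_real (N\<^sup>2) / u\<^sup>2) has_field_derivative - 2 * of_real (N\<^sup>2) / u ^ 3) (at u)" if "u \<noteq> 0" for u :: complex
      using that by (auto intro!: derivative_eq_intros simp: divide_simps eval_nat_numeral)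
    note outer = this
    have "((\<lambda>z. z - pole N) has_field_derivative 1) (at z)"
      by (auto intro!: derivative_eq_intros)
    from DERIV_chain2[OF outer this] show ?thesis
      using pole_left[OF assms] by simp
  qed
  ultimately have "(G N has_field_derivative
      f z * (- 2 * of_real (N\<^sup>2) / (z - pole N) ^ 3) + deriv f z * (of_real (N\<^sup>2) / (z - pole N)\<^sup>2)) (at z)"
    unfolding G_def[abs_def] by (rule DERIV_mult')
  moreover have "f z * (- 2 * of_real (N\<^sup>2) / (z - pole N) ^ 3) + deriv f z * (of_real (N\<^sup>2) / (z - pole N)\<^sup>2) = F N z"
  proof -
    have "a * (- 2 * c / p ^ 3) + b * (c / p\<^sup>2) = (c * b - 2 * c * a / p) * (1 / p\<^sup>2)" for a b c p :: complex
      by (cases "p = 0") (auto simp: field_simps eval_nat_numeral)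
    then show ?thesis
      by (simp only: F_def)
  qed
  ultimately show ?thesis by simp
qed

text \<open>The scalar resolvent function is bounded on the line and has derivative
  \<open>- <R(z)^2 x, y>\<close>, and \<open>F N\<close> is the derivative of \<open>G N\<close>.
  The decay of \<open>G N\<close> removes the boundary terms.\<close>

lemma E_F_by_parts:
  assumes N: "N > - \<omega>"
  shows "cinner (R.E \<delta> (F N) x) y = - ((1 / (2 * pi)) *\<^sub>R
    integral UNIV (\<lambda>r. G N (Complex \<delta> r) * cinner (R (Complex \<delta> r) (R (Complex \<delta> r) x)) y))"
    "(\<lambda>r. G N (Complex \<delta> r) * cinner (R (Complex \<delta> r) (R (Complex \<delta> r) x)) y) integrable_on UNIV"
    "(\<lambda>r. poisson_weight N r * cmod (cinner (R (Complex \<delta> r) (R (Complex \<delta> r) x)) y)) integrable_on UNIV"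
proof -
  have N0: "N > 0" using N \<omega> by simp
  have \<delta>: "\<delta> < 0" using \<omega> by simp
  let ?l = "Complex \<delta>"
  define \<phi> where "\<phi> z = cinner (R z x) y" for z
  define \<psi> where "\<psi> z = cinner (R z (R z x)) y" for z
  have \<phi>': "(\<phi> has_field_derivative - \<psi> z) (at z)" if "Re z < 0" for z
    unfolding \<phi>_def[abs_def] \<psi>_def
    by (rule R.has_derivative_L[OF that bounded_linear_cinner_left]) (simp add: cinner_scaleC_left)
  obtain K where K: "K > 0" "\<And>z x. Re z \<le> \<delta> \<Longrightarrow> norm (R z x) \<le> K * norm x"
    using R.boundE[OF \<delta>] by metis
  have \<phi>_bound: "cmod (\<phi> (?l r)) \<le> K * norm x * norm y" for r
    unfolding \<phi>_def by (rule order_trans[OF cauchy_schwarz], rule mult_right_mono, rule K(2)) simp_all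
  have \<psi>_bound: "cmod (\<psi> (?l r)) \<le> K * (K * norm x) * norm y" for r
  proof -
    have "norm (R (?l r) (R (?l r) x)) \<le> K * norm (R (?l r) x)"
      by (rule K(2)) simp
    also have "\<dots> \<le> K * (K * norm x)"
      using K(1) K(2)[of "?l r" x] by (intro mult_left_mono) auto
    finally show ?thesis
      unfolding \<psi>_def by (intro order_trans[OF cauchy_schwarz] mult_right_mono) auto
  qed
  have \<phi>_cont: "continuous_on UNIV (\<lambda>r. \<phi> (?l r))"
    unfolding \<phi>_def by (intro continuous_intros R.continuous_L_line \<delta>)
  \<comment> \<open>In \<open>\<psi>\<close> the vector under the outer resolvent moves with
    \<open>z\<close> too; its continuity is read off from
    \<open>\<psi> = - deriv \<phi>\<close>.\<close>
  have "\<phi> holomorphic_on {z. Re z < 0}"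
    unfolding \<phi>_def[abs_def] by (rule R.holomorphic_cinner_L) simp
  then have "deriv \<phi> holomorphic_on {z. Re z < 0}"
    by (intro holomorphic_deriv open_halfspace_Re_lt)
  then have "continuous_on {z. Re z < 0} (deriv \<phi>)"
    by (rule holomorphic_on_imp_continuous_on)
  then have "continuous_on {z. Re z < 0} (\<lambda>z. - deriv \<phi> z)"
    by (intro continuous_intros)
  then have "continuous_on {z. Re z < 0} \<psi>"
    by (rule continuous_on_eq) (use DERIV_imp_deriv[OF \<phi>'] in simp)
  then have \<psi>_cont: "continuous_on UNIV (\<lambda>r. \<psi> (?l r))"
    by (rule continuous_on_line) (use \<delta> in auto)
  have qd: "quad_decay \<delta> (\<lambda>z. F N z * \<phi> z)" "quad_decay \<delta> (\<lambda>z. G N z * \<psi> z)" "quad_decay \<delta> (\<lambda>z. G N z * \<phi> z)"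
    by (rule quad_decay_mult_bounded[OF elementary_quad_decay[OF elementary_F[OF N]] \<phi>_cont \<phi>_bound]
        quad_decay_mult_bounded[OF quad_decay_G[OF N] \<psi>_cont \<psi>_bound]
        quad_decay_mult_bounded[OF quad_decay_G[OF N] \<phi>_cont \<phi>_bound])+
  note int = quad_decay_integrable[OF qd(1)] quad_decay_integrable[OF qd(2)]
  have "integral UNIV (\<lambda>r. \<i> * (F N (?l r) * \<phi> (?l r) - G N (?l r) * \<psi> (?l r))) = 0"
  proof (rule integral_line_derivative[where h = "\<lambda>r. G N (?l r) * \<phi> (?l r)"])
    fix t
    have "(?l has_vector_derivative \<i>) (at t)"
      unfolding Complex_eq by (auto intro!: derivative_eq_intros)
    moreover have "((\<lambda>z. G N z * \<phi> z) has_field_derivative (F N (?l t) * \<phi> (?l t) - G N (?l t) * \<psi> (?l t))) (at (?l t))"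
      using \<omega> by (auto intro!: derivative_eq_intros G_derivative[OF N] \<phi>' simp: half_plane_def)
    ultimately show "((\<lambda>r. G N (?l r) * \<phi> (?l r)) has_vector_derivative
        \<i> * (F N (?l t) * \<phi> (?l t) - G N (?l t) * \<psi> (?l t))) (at t)"
      using field_vector_diff_chain_at by (fastforce simp: o_def)
    show "(\<lambda>r. \<i> * (F N (?l r) * \<phi> (?l r) - G N (?l r) * \<psi> (?l r))) integrable_on UNIV"
      by (intro integrable_on_mult_right integrable_diff int)
    show "((\<lambda>r. G N (?l r) * \<phi> (?l r)) \<longlongrightarrow> 0) at_top" "((\<lambda>r. G N (?l r) * \<phi> (?l r)) \<longlongrightarrow> 0) at_bot"
      using quad_decay_tendsto_0[OF qd(3)] tendsto_mono at_top_le_at_infinity at_bot_le_at_infinity by blast+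
  qed
  then have "integral UNIV (\<lambda>r. F N (?l r) * \<phi> (?l r)) = integral UNIV (\<lambda>r. G N (?l r) * \<psi> (?l r))"
    using int by (simp add: integral_diff)
  then show "cinner (R.E \<delta> (F N) x) y = - ((1 / (2 * pi)) *\<^sub>R
    integral UNIV (\<lambda>r. G N (Complex \<delta> r) * cinner (R (Complex \<delta> r) (R (Complex \<delta> r) x)) y))"
    using R.E_cinner[OF \<delta> elementary_quad_decay[OF elementary_F[OF N]], of x y]
    by (simp only: \<phi>_def \<psi>_def)
  show "(\<lambda>r. G N (Complex \<delta> r) * cinner (R (Complex \<delta> r) (R (Complex \<delta> r) x)) y) integrable_on UNIV"
    using int(2) by (simp only: \<psi>_def)
  have "(\<lambda>r. poisson_weight N r *\<^sub>R cmod (\<psi> (?l r))) integrable_on UNIV"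
    by (rule poisson_weight_integrable[OF N0, where C = "K * (K * norm x) * norm y"])
       (use \<psi>_cont \<psi>_bound in \<open>auto intro!: continuous_intros\<close>)
  then show "(\<lambda>r. poisson_weight N r * cmod (cinner (R (Complex \<delta> r) (R (Complex \<delta> r) x)) y)) integrable_on UNIV"
    by (simp add: \<psi>_def)
qed

text \<open>On the line the modulus of \<open>G N\<close> is at most \<open>B\<close> times the
  Poisson weight, so the bilinear estimate applies uniformly in \<open>N\<close>. With
  \<open>|\<delta>| = |\<omega>| / 2\<close> the factors \<open>2\<close> and \<open>pi\<close>
  cancel exactly, and testing on the range of \<open>R'\<close> adds the fourth
  \<open>M\<close>.\<close>

lemma E_F_norm_le:
  assumes N: "N > - \<omega>"
  shows "norm (R.E \<delta> (F N) x) \<le> B * M ^ 4 / \<bar>\<omega>\<bar> * norm x"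
proof -
  have N0: "N > 0" using N \<omega> by simp
  have \<delta>: "\<delta> < 0" using \<omega> by simp
  have "norm (R.E \<delta> (F N) x) \<le> (B * M ^ 3 / \<bar>\<omega>\<bar> * norm x) * M"
  proof (rule norm_le_via_R')
    fix \<mu> u
    assume \<mu>: "Re \<mu> < 0"
    let ?y = "R' \<mu> u" and ?\<psi> = "\<lambda>r. cinner (R (Complex \<delta> r) (R (Complex \<delta> r) x)) (R' \<mu> u)"
    note parts = E_F_by_parts[OF N, of x ?y]
    have "cmod (integral UNIV (\<lambda>r. G N (Complex \<delta> r) * ?\<psi> r)) \<le> integral UNIV (\<lambda>r. B * (poisson_weight N r * cmod (?\<psi> r)))"
    proof (rule integral_norm_bound_integral[OF parts(2) integrable_on_mult_right[OF parts(3)]])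
      fix r
      have "cmod (G N (Complex \<delta> r)) = cmod (f (Complex \<delta> r)) * poisson_weight N r"
        by (simp add: G_def norm_mult norm_divide norm_power cmod_pole_line poisson_weight_def)
      also have "\<dots> \<le> B * poisson_weight N r"
        using \<omega> by (intro mult_right_mono f_bound poisson_weight_bound N0) (auto simp: half_plane_def)
      finally have "cmod (G N (Complex \<delta> r)) * cmod (?\<psi> r) \<le> (B * poisson_weight N r) * cmod (?\<psi> r)"
        by (intro mult_right_mono) auto
      then show "cmod (G N (Complex \<delta> r) * ?\<psi> r) \<le> B * (poisson_weight N r * cmod (?\<psi> r))"
        by (simp add: norm_mult mult.assoc)
    qed
    also have "\<dots> = B * integral UNIV (\<lambda>r. poisson_weight N r * cmod (?\<psi> r))"
      by simp
    also have "\<dots> \<le> B * (pi * M ^ 3 / \<bar>\<delta>\<bar> * norm x * norm ?y)"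
      by (intro mult_left_mono square_form[OF \<delta> N0 \<mu> refl parts(3)] B_nonneg)
    finally have "1 / (2 * pi) * cmod (integral UNIV (\<lambda>r. G N (Complex \<delta> r) * ?\<psi> r))
        \<le> 1 / (2 * pi) * (B * (pi * M ^ 3 / \<bar>\<delta>\<bar> * norm x * norm ?y))"
      by (intro mult_left_mono) auto
    also have "\<dots> = B * M ^ 3 / \<bar>\<omega>\<bar> * norm x * norm ?y"
      using \<omega> by (simp add: field_simps)
    finally show "cmod (cinner (R.E \<delta> (F N) x) ?y) \<le> B * M ^ 3 / \<bar>\<omega>\<bar> * norm x * norm ?y"
      unfolding parts(1) norm_minus_cancel norm_scaleR by simp
  qed (use B_nonneg M_pos in auto)
  then show ?thesis
    by (simp add: eval_nat_numeral ac_simps)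
qed

definition \<mu> :: complex where "\<mu> = of_real (2 * \<omega>)"

lemma \<mu>_simps: "Re \<mu> = 2 * \<omega>" "Re \<mu> < 0" "Re \<mu> \<le> \<omega>'" "Re \<mu> < \<omega>'" "Re \<mu> < \<delta>"
  using \<omega> by (auto simp: \<mu>_def)

lemma E_resolvent_cube:
  assumes "elementary \<omega>' \<delta> g"
  shows "R.E \<delta> g (R \<mu> (R \<mu> (R \<mu> x))) = R.E \<delta> (\<lambda>z. g z / (\<mu> - z) / (\<mu> - z) / (\<mu> - z)) x"
proof -
  have \<delta>: "\<delta> < 0" using \<omega> by simp
  show ?thesis
    using assms elementary_divide[OF assms \<mu>_simps(3)] elementary_divide[OF elementary_divide[OF assms \<mu>_simps(3)] \<mu>_simps(3)]
    by (simp add: R.E_resolvent[OF _ \<delta> \<mu>_simps(5)])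
qed

text \<open>On the line \<open>F N - deriv f\<close> is bounded only by a multiple of
  \<open>(1 + |r|) / N\<close>. Two of the three resolvents correspond to the regularization in the
  definition of the calculus; the third absorbs the linear growth, and quadratic decay with a
  constant of order \<open>1 / N\<close> remains.\<close>

lemma E_F_tendsto:
  fixes x :: 'a
  defines "N \<equiv> (\<lambda>n. real n + 1 - \<omega>)"
  shows "(\<lambda>n. R.E \<delta> (F (N n)) (R \<mu> (R \<mu> (R \<mu> x)))) \<longlonglongrightarrow>
    R.E \<delta> (\<lambda>z. deriv f z / (z - \<mu>)\<^sup>2) (R \<mu> x)"
proof -
  have \<delta>: "\<delta> < 0" using \<omega> by simp
  have N: "N n > - \<omega>" "N n > 0" for n using \<omega> by (auto simp: N_def)
  let ?k = "\<lambda>z. deriv f z / (z - \<mu>)\<^sup>2 / (\<mu> - z)"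
  let ?F3 = "\<lambda>n z. F (N n) z / (\<mu> - z) / (\<mu> - z) / (\<mu> - z)"
  have el: "elementary \<omega>' \<delta> (\<lambda>z. deriv f z / (z - \<mu>)\<^sup>2)"
    by (rule elementary_Hinf[OF deriv_Hinf \<mu>_simps(3)]) (use \<omega> in simp)
  then have lim_eq: "R.E \<delta> (\<lambda>z. deriv f z / (z - \<mu>)\<^sup>2) (R \<mu> x) = R.E \<delta> ?k x"
    by (rule R.E_resolvent[OF _ \<delta> \<mu>_simps(5)])
  obtain W where W: "W > 0" "\<And>g C x. continuous_on UNIV (\<lambda>r. g (Complex \<delta> r)) \<Longrightarrow>
    (\<And>r. cmod (g (Complex \<delta> r)) \<le> C / (1 + \<bar>r\<bar>)\<^sup>2) \<Longrightarrow> norm (R.E \<delta> g x) \<le> C * W * norm x"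
    using R.E_norm_le[OF \<delta>] by metis
  obtain K where K: "K > 0" "\<And>r. 1 + \<bar>r\<bar> \<le> K * cmod (Complex \<delta> r - \<mu>)"
    using line_distance[of \<mu> \<delta>] \<mu>_simps(5) by (metis less_irrefl)
  define C where "C = 2 * (B1 + B) * K ^ 3"
  have F3: "elementary \<omega>' \<delta> (?F3 n)" for n
    by (intro elementary_divide elementary_F N \<mu>_simps)
  have k: "elementary \<omega>' \<delta> ?k"
    by (intro elementary_divide el \<mu>_simps)
  have diff: "norm (R.E \<delta> (?F3 n) x - R.E \<delta> ?k x) \<le> C / N n * W * norm x" for n
  proof -
    have neg: "quad_decay \<delta> (\<lambda>z. - ?k z)"
      using elementary_quad_decay[OF k] by (auto simp: quad_decay_def intro: continuous_on_minus)
    have "R.E \<delta> (?F3 n) x - R.E \<delta> ?k x = R.E \<delta> (\<lambda>z. ?F3 n z + - ?k z) x"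
      unfolding R.E_add_left[OF \<delta> elementary_quad_decay[OF F3] neg] R.E_minus_left by simp
    also have "norm \<dots> \<le> C / N n * W * norm x"
    proof (rule W(2))
      show "continuous_on UNIV (\<lambda>r. ?F3 n (Complex \<delta> r) + - ?k (Complex \<delta> r))"
        using elementary_quad_decay[OF F3] neg by (intro continuous_on_add) (auto simp: quad_decay_def)
      fix r
      define z where "z = Complex \<delta> r"
      define p where "p = z - pole (N n)"
      define m where "m = N n"
      have m: "m > 0" using N by (simp add: m_def)
      have p: "p = Complex m r" by (simp add: p_def z_def pole_def m_def complex_eq_iff)
      have pm: "m \<le> cmod p" "\<bar>r\<bar> \<le> cmod p"
        using complex_Re_le_cmod[of p] abs_Im_le_cmod[of p] by (auto simp: p)
      have p0: "cmod p > 0" by (rule less_le_trans[OF m pm(1)])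
      have z\<mu>: "z - \<mu> \<noteq> 0" using \<mu>_simps(5) by (auto simp: z_def complex_eq_iff)
      have fz: "cmod (f z) \<le> B" "cmod (deriv f z) \<le> B1"
        using \<omega> by (auto intro!: f_bound deriv_bound simp: half_plane_def z_def)
      \<comment> \<open>On the line \<open>p = m + i r\<close>. The first term measures how far the
        regularizer is from \<open>1\<close>, the second comes from its derivative; they are of
        order \<open>|r| / m\<close> and \<open>1 / m\<close>.\<close>
      define D where "D = deriv f z * ((of_real (m\<^sup>2) - p\<^sup>2) / p\<^sup>2) - 2 * f z * (of_real (m\<^sup>2) / p ^ 3)"
      have D: "F (N n) z - deriv f z = D"
        using p0 unfolding F_def p_def[symmetric] unfolding m_def[symmetric] D_def
        by (simp add: field_simps eval_nat_numeral)
      have 1: "cmod ((of_real (m\<^sup>2) - p\<^sup>2) / p\<^sup>2) \<le> 2 * \<bar>r\<bar> / m"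
      proof -
        have "of_real (m\<^sup>2) - p\<^sup>2 = (of_real m - p) * (of_real m + p)"
          by (simp add: power2_eq_square algebra_simps)
        moreover have "cmod (of_real m - p) = \<bar>r\<bar>"
          by (simp add: p cmod_def)
        moreover have "cmod (of_real m + p) \<le> 2 * cmod p"
          using norm_triangle_ineq[of "of_real m" p] pm m by simp
        ultimately have "cmod (of_real (m\<^sup>2) - p\<^sup>2) \<le> \<bar>r\<bar> * (2 * cmod p)"
          by (simp add: norm_mult mult_left_mono)
        then have "cmod ((of_real (m\<^sup>2) - p\<^sup>2) / p\<^sup>2) \<le> \<bar>r\<bar> * (2 * cmod p) / (cmod p)\<^sup>2"
          unfolding norm_divide norm_power by (intro divide_right_mono) auto
        also have "\<dots> = 2 * \<bar>r\<bar> / cmod p"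
          using p0 by (simp add: power2_eq_square)
        also have "\<dots> \<le> 2 * \<bar>r\<bar> / m"
          using pm m p0 by (intro divide_left_mono) auto
        finally show ?thesis .
      qed
      have 2: "cmod (of_real (m\<^sup>2) / p ^ 3) \<le> 1 / m"
      proof -
        have "m ^ 3 \<le> cmod p ^ 3"
          using pm m by (intro power_mono) auto
        then have "m\<^sup>2 / cmod p ^ 3 \<le> m\<^sup>2 / m ^ 3"
          using m p0 by (intro divide_left_mono) auto
        also have "m\<^sup>2 / m ^ 3 = 1 / m"
          using m by (simp add: eval_nat_numeral)
        finally show ?thesis
          by (simp add: norm_divide norm_power)
      qed
      have "cmod D \<le> cmod (deriv f z) * cmod ((of_real (m\<^sup>2) - p\<^sup>2) / p\<^sup>2) + 2 * cmod (f z) * cmod (of_real (m\<^sup>2) / p ^ 3)"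
        unfolding D_def by (rule order_trans[OF norm_triangle_ineq4]) (simp only: norm_mult norm_numeral order_refl)
      also have "\<dots> \<le> B1 * (2 * \<bar>r\<bar> / m) + 2 * B * (1 / m)"
        using fz 1 2 B_nonneg B1_nonneg m by (intro add_mono mult_mono) auto
      also have "\<dots> \<le> 2 * (B1 + B) * (1 + \<bar>r\<bar>) / m"
        using m B_nonneg B1_nonneg by (simp add: field_simps)
      finally have D_le: "cmod D \<le> 2 * (B1 + B) * (1 + \<bar>r\<bar>) / m" .
      have "?F3 n z + - ?k z = D / (\<mu> - z) ^ 3"
        using z\<mu> unfolding D[symmetric] power2_commute[of z \<mu>] by (simp add: eval_nat_numeral diff_divide_distrib mult.assoc)
      then have "cmod (?F3 n z + - ?k z) = cmod D / cmod (z - \<mu>) ^ 3"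
        by (simp add: norm_divide norm_power norm_minus_commute)
      also have "\<dots> \<le> (2 * (B1 + B) * (1 + \<bar>r\<bar>) / m) / ((1 + \<bar>r\<bar>) / K) ^ 3"
      proof (rule frac_le)
        have "(1 + \<bar>r\<bar>) / K \<le> cmod (z - \<mu>)"
          using K(1) K(2)[of r] by (simp add: z_def field_simps)
        then show "((1 + \<bar>r\<bar>) / K) ^ 3 \<le> cmod (z - \<mu>) ^ 3"
          using K by (intro power_mono) auto
        show "0 < ((1 + \<bar>r\<bar>) / K) ^ 3"
          using K(1) by (intro zero_less_power divide_pos_pos) auto
      qed (use D_le order_trans[OF norm_ge_zero D_le] in auto)
      also have "\<dots> = C / m / (1 + \<bar>r\<bar>)\<^sup>2"
      proof -
        have "1 + \<bar>r\<bar> \<noteq> 0" by simp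
        then show ?thesis
          using m K(1) unfolding C_def by (simp add: divide_simps eval_nat_numeral)
      qed
      finally show "cmod (?F3 n (Complex \<delta> r) + - ?k (Complex \<delta> r)) \<le> C / N n / (1 + \<bar>r\<bar>)\<^sup>2"
        by (simp add: z_def m_def)
    qed
    finally show ?thesis .
  qed
  have "(\<lambda>n. C / N n * W * norm x) \<longlonglongrightarrow> 0"
  proof -
    have "filterlim N at_top sequentially"
      unfolding N_def
      by (rule filterlim_at_top_mono[OF filterlim_real_sequentially]) (use \<omega> in auto)
    then have "(\<lambda>n. C / N n) \<longlonglongrightarrow> 0"
      by (intro tendsto_divide_0[OF tendsto_const] filterlim_at_top_imp_at_infinity)
    then show ?thesis
      by (intro tendsto_mult_left_zero)
  qed
  then have "(\<lambda>n. R.E \<delta> (?F3 n) x - R.E \<delta> ?k x) \<longlonglongrightarrow> 0"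
    by (rule Lim_null_comparison[OF always_eventually[OF allI[OF diff]]])
  then have "(\<lambda>n. R.E \<delta> (?F3 n) x) \<longlonglongrightarrow> R.E \<delta> ?k x"
    by (simp only: LIM_zero_iff)
  then show ?thesis
    unfolding lim_eq by (simp only: E_resolvent_cube[OF elementary_F[OF N(1)]])
qed

text \<open>The operators of the regularized symbols are uniformly bounded and converge on a dense
  range, hence strongly. Their limit satisfies the equation that characterizes the calculus of
  \<open>deriv f\<close>, and the uniform bound survives.\<close>

lemma calculus_deriv:
  obtains S where "half_plane_calculus A (deriv f) = {(x, S x) |x. True}" "bounded_clinear S"
    "\<And>x. norm (S x) \<le> B * M ^ 4 / \<bar>\<omega>\<bar> * norm x"
proof -
  have \<delta>: "\<delta> < 0" using \<omega> by simp
  define N where "N n = real n + 1 - \<omega>" for n :: nat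
  have N: "N n > - \<omega>" for n by (simp add: N_def)
  define S where "S n = R.E \<delta> (F (N n))" for n
  define C where "C = B * M ^ 4 / \<bar>\<omega>\<bar>"
  let ?D = "\<lambda>x. R \<mu> (R \<mu> (R \<mu> x))" and ?k = "\<lambda>z. deriv f z / (z - \<mu>)\<^sup>2"
  note qd = elementary_quad_decay[OF elementary_F[OF N]]
  have S_cl: "bounded_clinear (S n)" for n
    unfolding S_def by (rule R.E_bounded_clinear[OF \<delta> qd])
  note S_lin = bounded_linear.linear[OF bounded_clinearD(1)[OF S_cl]]
  have S_norm: "norm (S n x) \<le> C * norm x" for n x
    unfolding S_def C_def by (rule E_F_norm_le[OF N])
  have R_cont: "continuous_on UNIV (R \<mu>)"
    by (rule linear_continuous_on[OF R.blin[OF \<mu>_simps(2)]])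
  have S_lim: "(\<lambda>n. S n (?D x)) \<longlonglongrightarrow> R.E \<delta> ?k (R \<mu> x)" for x
    unfolding S_def N_def by (rule E_F_tendsto)
  note dense = closure_range_R[OF \<mu>_simps(2)]
  have "convergent (\<lambda>n. S n x)" for x
  proof (rule dense_convergent[where D = ?D and M = C])
    show "closure (range ?D) = UNIV"
      by (rule dense_range_comp[OF R_cont dense dense_range_comp[OF R_cont dense dense]])
    show "norm (S n x - S n y) \<le> C * norm (x - y)" for n x y
      using S_norm[of n "x - y"] by (simp add: linear_diff[OF S_lin])
    show "convergent (\<lambda>n. S n (?D x))" for x
      using S_lim by (auto simp: convergent_def)
  qed
  then obtain T where T: "\<And>x. (\<lambda>n. S n x) \<longlonglongrightarrow> T x"
    unfolding convergent_def by metis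
  have T_norm: "norm (T x) \<le> C * norm x" for x
    by (rule LIMSEQ_le_const2[OF tendsto_norm[OF T]]) (use S_norm in auto)
  have T_cl: "bounded_clinear T"
  proof (rule bounded_clinearI[OF _ _ T_norm])
    show "T (x + y) = T x + T y" for x y
      by (rule LIMSEQ_unique[OF T]) (simp add: linear_add[OF S_lin] tendsto_add T)
    show "T (c *\<^sub>C x) = c *\<^sub>C T x" for c x
      by (rule LIMSEQ_unique[OF T]) (simp add: bounded_clinearD(2)[OF S_cl] tendsto_scaleC T)
  qed
  have T_R: "R \<mu> (T x) = T (R \<mu> x)" for x
  proof (rule LIMSEQ_unique)
    show "(\<lambda>n. R \<mu> (S n x)) \<longlonglongrightarrow> R \<mu> (T x)"
      by (intro bounded_linear.tendsto[OF R.blin[OF \<mu>_simps(2)]] T)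
    have "R \<mu> (S n x) = S n (R \<mu> x)" for n
      unfolding S_def
      by (rule R.E_commute[OF \<delta> qd R.bcl]) (use \<mu>_simps \<omega> in \<open>auto intro: R.commute\<close>)
    then show "(\<lambda>n. R \<mu> (S n x)) \<longlonglongrightarrow> T (R \<mu> x)"
      using T by simp
  qed
  have el: "elementary \<omega>' \<delta> ?k"
    by (rule elementary_Hinf[OF deriv_Hinf \<mu>_simps(3)]) (use \<omega> in simp)
  \<comment> \<open>On the range of \<open>R \<mu>\<close> the equation is uniqueness of limits,
    combined with the commutation of \<open>T\<close> and \<open>R \<mu>\<close>. Both sides are
    bounded operators, so density finishes; the norm form fits \<open>dense_le\<close>.\<close>
  have "norm (R \<mu> (R \<mu> (T x)) - R.E \<delta> ?k x) \<le> 0" for x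
  proof (rule dense_le[OF dense, where f = "\<lambda>x. norm (R \<mu> (R \<mu> (T x)) - R.E \<delta> ?k x)" and g = "\<lambda>_. 0"])
    have "bounded_linear (\<lambda>x. R \<mu> (R \<mu> (T x)))"
      using T_cl by (intro bounded_linear_compose[OF R.blin] \<mu>_simps bounded_clinearD)
    moreover have "bounded_linear (R.E \<delta> ?k)"
      by (rule bounded_clinearD(1)[OF R.E_bounded_clinear[OF \<delta> elementary_quad_decay[OF el]]])
    ultimately show "continuous_on UNIV (\<lambda>x. norm (R \<mu> (R \<mu> (T x)) - R.E \<delta> ?k x))"
      by (intro continuous_intros linear_continuous_on)
    show "norm (R \<mu> (R \<mu> (T (R \<mu> x))) - R.E \<delta> ?k (R \<mu> x)) \<le> 0" for x
      using LIMSEQ_unique[OF T S_lim, of x] by (simp add: T_R)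
  qed simp
  then have "half_plane_calculus A (deriv f) = {(x, T x) |x. True}"
    by (intro calculus_eq_graph[OF deriv_Hinf _ \<delta> \<mu>_simps(4)]) (use \<omega> in auto)
  then show thesis
    using T_cl T_norm by (intro that[of T]) (auto simp: C_def)
qed

end

section \<open>Higher derivatives and the two implications\<close>

context semigroup_operator
begin

lemma higher_deriv_Hinf:
  assumes f: "f \<in> Hinf \<omega>" and \<omega>: "\<omega> < 0"
  shows "(deriv ^^ k) f holomorphic_on half_plane (\<omega> / 2)"
    "z \<in> half_plane (\<omega> / 2) \<Longrightarrow> cmod ((deriv ^^ k) f z) \<le> fact k * Hinf_norm \<omega> f / (\<bar>\<omega>\<bar> / 4) ^ k"
proof -
  have holo: "f holomorphic_on half_plane \<omega>" and bdd: "bounded (f ` half_plane \<omega>)"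
    using f by (auto simp: Hinf_def)
  have op: "open (half_plane \<omega>)"
    unfolding half_plane_def by (rule open_halfspace_Re_gt)
  have norm: "cmod (f z) \<le> Hinf_norm \<omega> f" if "z \<in> half_plane \<omega>" for z
    unfolding Hinf_norm_def
    using that bdd by (intro cSUP_upper) (auto simp: bdd_above_def bounded_iff)
  show "(deriv ^^ k) f holomorphic_on half_plane (\<omega> / 2)"
    by (rule holomorphic_on_subset[OF holomorphic_higher_deriv[OF holo op]]) (use \<omega> in \<open>auto simp: half_plane_def\<close>)
  show "cmod ((deriv ^^ k) f z) \<le> fact k * Hinf_norm \<omega> f / (\<bar>\<omega>\<bar> / 4) ^ k" if z: "z \<in> half_plane (\<omega> / 2)"
  proof (rule Cauchy_inequality)
    have sub: "cball z (\<bar>\<omega>\<bar> / 4) \<subseteq> half_plane \<omega>"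
    proof
      fix u
      assume "u \<in> cball z (\<bar>\<omega>\<bar> / 4)"
      then have "\<bar>Re z - Re u\<bar> \<le> \<bar>\<omega>\<bar> / 4"
        using abs_Re_le_cmod[of "z - u"] by (simp add: dist_norm)
      then show "u \<in> half_plane \<omega>"
        using z \<omega> by (simp add: half_plane_def)
    qed
    show "f holomorphic_on ball z (\<bar>\<omega>\<bar> / 4)"
      using holo sub ball_subset_cball by (blast intro: holomorphic_on_subset)
    show "continuous_on (cball z (\<bar>\<omega>\<bar> / 4)) f"
      using holo sub by (blast intro: holomorphic_on_imp_continuous_on holomorphic_on_subset)
    show "cmod (f x) \<le> Hinf_norm \<omega> f" if "cmod (z - x) = \<bar>\<omega>\<bar> / 4" for x
      using sub that by (intro norm) (auto simp: dist_norm)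
  qed (use \<omega> in simp)
qed

text \<open>The first-derivative result is applied to the derivative of order \<open>m - 1\<close>
  on the half-plane at \<open>\<omega> / 2\<close>, where Cauchy's estimate with radius
  \<open>|\<omega>| / 4\<close> controls it.\<close>

lemma calculus_higher_deriv:
  assumes "m \<ge> 1" and f: "f \<in> Hinf \<omega>" and \<omega>: "\<omega> < 0"
  shows "bounded_operator (half_plane_calculus A ((deriv ^^ m) f))"
    "op_norm (half_plane_calculus A ((deriv ^^ m) f)) \<le> (fact (m - 1) * 4 ^ m * M ^ 4) / \<bar>\<omega>\<bar> ^ m * Hinf_norm \<omega> f"
proof -
  obtain k where k: "m = Suc k"
    using assms(1) by (cases m) auto
  define B where "B = fact k * Hinf_norm \<omega> f / (\<bar>\<omega>\<bar> / 4) ^ k"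
  interpret g: semigroup_function A T M "(deriv ^^ k) f" "\<omega> / 2" B
    using higher_deriv_Hinf(1)[OF f \<omega>, of k] higher_deriv_Hinf(2)[OF f \<omega>, of _ k] \<omega>
    by unfold_locales (auto simp: B_def)
  obtain S where S: "half_plane_calculus A ((deriv ^^ m) f) = {(x, S x) |x. True}" "bounded_clinear S"
    "\<And>x. norm (S x) \<le> B * M ^ 4 / \<bar>\<omega> / 2\<bar> * norm x"
    using g.calculus_deriv by (auto simp: k)
  show "bounded_operator (half_plane_calculus A ((deriv ^^ m) f))"
    unfolding bounded_operator_def using S by blast
  have "op_norm (half_plane_calculus A ((deriv ^^ m) f)) \<le> B * M ^ 4 / \<bar>\<omega> / 2\<bar>"
    unfolding op_norm_def S(1) op_fun_graph
    by (rule onorm_bound[OF _ S(3)]) (use g.B_nonneg M_pos in auto)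
  \<comment> \<open>Cauchy's estimate gives \<open>4 ^ (m - 1)\<close>, and the line of the new
    half-plane gives \<open>2\<close>; rounding this \<open>2\<close> up to \<open>4\<close>
    produces the uniform form \<open>4 ^ m\<close>.\<close>
  also have "\<dots> = (2 / 4) * ((fact (m - 1) * 4 ^ m * M ^ 4) / \<bar>\<omega>\<bar> ^ m * Hinf_norm \<omega> f)"
    using \<omega> unfolding B_def power_divide by (simp add: k field_simps)
  also have "\<dots> \<le> (fact (m - 1) * 4 ^ m * M ^ 4) / \<bar>\<omega>\<bar> ^ m * Hinf_norm \<omega> f"
  proof -
    have "0 \<le> Hinf_norm \<omega> f"
      using higher_deriv_Hinf(2)[OF f \<omega>, of 0 0] \<omega> order_trans[OF norm_ge_zero] by (auto simp: half_plane_def)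
    then have "0 \<le> (fact (m - 1) * 4 ^ m * M ^ 4) / \<bar>\<omega>\<bar> ^ m * Hinf_norm \<omega> f"
      using M_pos by (intro mult_nonneg_nonneg divide_nonneg_nonneg) auto
    then show ?thesis by simp
  qed
  finally show "op_norm (half_plane_calculus A ((deriv ^^ m) f)) \<le> (fact (m - 1) * 4 ^ m * M ^ 4) / \<bar>\<omega>\<bar> ^ m * Hinf_norm \<omega> f" .
qed

lemma strong_calculus: "m \<ge> 1 \<Longrightarrow> strong_m_bounded_Hinf_calculus_type_0 m A"
  unfolding strong_m_bounded_Hinf_calculus_type_0_def m_bounded_Hinf_calculus_def
proof (intro conjI allI impI)
  fix \<omega> :: real
  assume m: "m \<ge> 1" and \<omega>: "\<omega> < 0"
  show "\<exists>C\<ge>0. \<forall>f\<in>Hinf \<omega>. bounded_operator (half_plane_calculus A ((deriv ^^ m) f)) \<and>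
      op_norm (half_plane_calculus A ((deriv ^^ m) f)) \<le> C * Hinf_norm \<omega> f"
    using calculus_higher_deriv[OF m _ \<omega>] M_pos
    by (intro exI[of _ "(fact (m - 1) * 4 ^ m * M ^ 4) / \<bar>\<omega>\<bar> ^ m"]) auto
next
  assume m: "m \<ge> 1"
  show "\<exists>C\<ge>0. \<forall>\<omega><0. \<forall>f\<in>Hinf \<omega>. op_norm (half_plane_calculus A ((deriv ^^ m) f)) \<le> C / \<bar>\<omega>\<bar> ^ m * Hinf_norm \<omega> f"
    using calculus_higher_deriv(2)[OF m] M_pos
    by (intro exI[of _ "fact (m - 1) * 4 ^ m * M ^ 4"]) auto
qed

end

context half_plane_operator
begin

lemma semigroup_imp_calculus:
  assumes "generates_bounded_C0_semigroup (op_uminus A)" "m \<ge> 1"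
  shows "strong_m_bounded_Hinf_calculus_type_0 m A"
proof -
  obtain T M where T: "C0_semigroup T" "semigroup_generator T = op_uminus A" "\<And>t. t \<ge> 0 \<Longrightarrow> onorm (T t) \<le> M"
    using assms(1) by (auto simp: generates_bounded_C0_semigroup_def bounded_semigroup_def)
  have "norm (T t x) \<le> max M 1 * norm x" if "t \<ge> 0" for t x
  proof -
    have "bounded_linear (T t)"
      using T(1) that by (auto simp: C0_semigroup_def bounded_clinear_def)
    then have "norm (T t x) \<le> onorm (T t) * norm x"
      by (rule onorm)
    also have "\<dots> \<le> max M 1 * norm x"
      using T(3)[OF that] by (intro mult_right_mono) auto
    finally show ?thesis .
  qed
  \<comment> \<open>The maximum with \<open>1\<close> provides the positivity that the locale
    demands and a bound coming from \<open>onorm\<close> may lack.\<close>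
  then interpret semigroup_operator A T "max M 1"
    using T by unfold_locales auto
  show ?thesis
    by (rule strong_calculus[OF assms(2)])
qed

lemma higher_deriv_exp_minus:
  "(deriv ^^ m) (\<lambda>z. exp (- (c * z))) = (\<lambda>z. (- c) ^ m * exp (- (c * z)))" for c :: complex
proof (induction m)
  case (Suc m)
  have "deriv (\<lambda>z. (- c) ^ m * exp (- (c * z))) z = (- c) ^ Suc m * exp (- (c * z))" for z
    by (rule DERIV_imp_deriv) (auto intro!: derivative_eq_intros)
  then show ?case
    by (simp add: Suc.IH)
qed simp

lemma calculus_imp_semigroup:
  assumes "strong_m_bounded_Hinf_calculus_type_0 m A"
  shows "generates_bounded_C0_semigroup (op_uminus A)"
proof -
  obtain C where C: "C \<ge> 0" "\<And>\<omega> f. \<omega> < 0 \<Longrightarrow> f \<in> Hinf \<omega> \<Longrightarrow>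
      op_norm (half_plane_calculus A ((deriv ^^ m) f)) \<le> C / \<bar>\<omega>\<bar> ^ m * Hinf_norm \<omega> f"
    using assms by (auto simp: strong_m_bounded_Hinf_calculus_type_0_def)
  interpret half_plane_exponentials A "C * exp 1"
  proof unfold_locales
    fix t :: real and x
    assume t: "t > 0"
    define \<omega> where "\<omega> = - 1 / t"
    have \<omega>: "\<omega> < 0" using t by (simp add: \<omega>_def)
    let ?f = "\<lambda>z. exp (- (of_real t * z)) :: complex"
    have exp_bound: "cmod (?f z) \<le> exp (- (t * a))" if "z \<in> half_plane a" for z a
      using that t by (simp add: half_plane_def)
    have f: "?f \<in> Hinf a" for a
    proof -
      have "bounded (?f ` half_plane a)"
        unfolding bounded_iff using exp_bound by blast
      then show ?thesis
        by (auto simp: Hinf_def intro!: holomorphic_intros)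
    qed
    have "Hinf_norm \<omega> ?f \<le> exp 1"
      unfolding Hinf_norm_def
    proof (rule cSUP_least)
      show "half_plane \<omega> \<noteq> {}"
        using \<omega> by (auto simp: half_plane_def intro!: exI[of _ 0])
      show "cmod (?f z) \<le> exp 1" if "z \<in> half_plane \<omega>" for z
        using exp_bound[OF that] t by (simp add: \<omega>_def)
    qed
    moreover have "\<bar>\<omega>\<bar> ^ m = 1 / t ^ m"
      using t by (simp add: \<omega>_def power_divide)
    ultimately have "C / \<bar>\<omega>\<bar> ^ m * Hinf_norm \<omega> ?f \<le> C * t ^ m * exp 1"
      using C(1) t by (simp add: mult_left_mono)
    then have norm: "op_norm (half_plane_calculus A ((deriv ^^ m) ?f)) \<le> C * t ^ m * exp 1"
      using C(2)[OF \<omega> f] by linarith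
    have "m_bounded_Hinf_calculus m \<omega> A"
      using assms \<omega> by (simp add: strong_m_bounded_Hinf_calculus_type_0_def)
    then have bdd: "bounded_operator (half_plane_calculus A ((deriv ^^ m) ?f))"
      using f unfolding m_bounded_Hinf_calculus_def by blast
    \<comment> \<open>The derivative is \<open>a\<close> times the exponential, so dividing the
      vector obtained for it by \<open>a\<close> recovers the exponential itself and removes
      \<open>t ^ m\<close> from the bound.\<close>
    define a where "a = (- complex_of_real t) ^ m"
    have a: "a \<noteq> 0" "cmod a = t ^ m"
      using t by (auto simp: a_def norm_power)
    have df: "(deriv ^^ m) ?f = (\<lambda>z. a * ?f z)"
      by (simp only: higher_deriv_exp_minus a_def)
    \<comment> \<open>Only membership counts here, and the bound may depend on \<open>t\<close>. The
      quantitative estimate uses the half-plane at \<open>- 1 / t\<close>, while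
      \<open>- 3/2\<close> fits the fixed line \<open>- 1\<close> and point \<open>- 2\<close>;
      independence of the parameters joins the two.\<close>
    have "(\<lambda>z. a * ?f z) \<in> Hinf (- 3/2)"
    proof -
      have "cmod (a * ?f z) \<le> cmod a * exp (- (t * (- 3/2)))" if "z \<in> half_plane (- 3/2)" for z
        unfolding norm_mult using exp_bound[OF that] by (intro mult_left_mono) auto
      then show ?thesis
        unfolding Hinf_def bounded_iff by (auto intro!: holomorphic_intros exI[of _ "cmod a * exp (- (t * (- 3/2)))"])
    qed
    then have df_Hinf: "(deriv ^^ m) ?f \<in> Hinf (- 3/2)"
      by (simp only: df)
    have "- 3/2 < (- 1 :: real)" "(- 1 :: real) < 0" "Re (- 2) < - 3/2"
      by auto
    then obtain y where y: "R.E (- 1) (\<lambda>z. (deriv ^^ m) ?f z / (z - (- 2))\<^sup>2) x = R (- 2) (R (- 2) y)"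
      "norm y \<le> op_norm (half_plane_calculus A ((deriv ^^ m) ?f)) * norm x"
      by (rule bounded_calculusE[OF df_Hinf _ _ _ bdd])
    have el: "elementary (- 3/2) (- 1) (\<lambda>z. ?f z / (z - (- 2))\<^sup>2)"
      by (rule elementary_Hinf[OF f]) auto
    have "a *\<^sub>C R.E (- 1) (\<lambda>z. ?f z / (z - (- 2))\<^sup>2) x = R (- 2) (R (- 2) y)"
      unfolding y(1)[symmetric] df
      using R.E_mult_left[OF _ elementary_quad_decay[OF el], of a x] by simp
    then have "inverse a *\<^sub>C (a *\<^sub>C R.E (- 1) (\<lambda>z. ?f z / (z - (- 2))\<^sup>2) x) = R (- 2) (R (- 2) (inverse a *\<^sub>C y))"
      by (simp add: R.L_scaleC)
    then have "R.E (- 1) (\<lambda>z. ?f z / (z - (- 2))\<^sup>2) x = R (- 2) (R (- 2) (inverse a *\<^sub>C y))"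
      using a by (simp add: scaleC_scaleC scaleC_one)
    moreover have "norm (inverse a *\<^sub>C y) \<le> C * exp 1 * norm x"
    proof -
      have "norm y \<le> C * t ^ m * exp 1 * norm x"
        using y(2) norm by (meson mult_right_mono norm_ge_zero order_trans)
      then show ?thesis
        unfolding norm_scaleC norm_inverse a(2) using t by (simp add: field_simps)
    qed
    ultimately show "\<exists>y. R.E (- 1) (\<lambda>z. ?f z / (z - (- 2))\<^sup>2) x = R (- 2) (R (- 2) y) \<and> norm y \<le> C * exp 1 * norm x"
      by blast
  qed
  show ?thesis
    by (rule generates)
qed

end

theorem corollary4p4:
  fixes A :: "'a::complex_hilbert_space operator"
  assumes "linear_operator A"
    and "densely_defined A"
    and "half_plane_type_0 A"
  shows "(generates_bounded_C0_semigroup (op_uminus A) \<longleftrightarrow>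
            (\<exists>m\<ge>1. strong_m_bounded_Hinf_calculus_type_0 m A)) \<and>
         (generates_bounded_C0_semigroup (op_uminus A) \<longleftrightarrow>
            (\<forall>m\<ge>1. strong_m_bounded_Hinf_calculus_type_0 m A)) \<and>
         (generates_bounded_C0_semigroup (op_uminus A) \<longrightarrow>
            (\<forall>\<omega><0. \<forall>m\<ge>1. m_bounded_Hinf_calculus m \<omega> A))"
proof -
  interpret half_plane_operator A
    using assms by unfold_locales
  have "m_bounded_Hinf_calculus m \<omega> A" if "strong_m_bounded_Hinf_calculus_type_0 m A" "\<omega> < 0" for m \<omega>
    using that by (simp add: strong_m_bounded_Hinf_calculus_type_0_def)
  \<comment> \<open>\<open>order_refl\<close> supplies the witness \<open>m = 1\<close> when
    existence of some \<open>m\<close> is claimed or the universal form is specialized.\<close>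
  then show ?thesis
    using semigroup_imp_calculus calculus_imp_semigroup by (meson order_refl)
qed

end
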